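(* Let $R$ be a field of characteristic $0$. Let $\mathsf{C}$ be a finite subcategory of $\mathsf{B}$ which satisfies condition ( * ) of the context, and such that for any two objects $G$ and $H$ of $\mathsf{C}$ the morphism set $\mathsf{C}_{G,H}$ is closed under $G\times H$-conjugation. Let $G$ be an object of $\mathsf{C}$, let $(P,K)$ be a section of $G$ such that $e_{(P,K)}\in\mathsf{C}_{G,G}$, let $T$ be a simple $R\mathrm{Aut}_{\mathsf{C}}(P/K)$-module with character $\chi$, and let $S_{(P,K),T}$ be the corresponding simple $A_{\mathsf{C},R}^\kappa$-module. Then $e_{\mathsf{C}}\cdot S_{(P,K),T}\ne\{0\}$ if and only if there exist an object $H$ of $\mathsf{C}$ and a morphism $L=(P'',K'',\tau,P',K')\in\mathsf{C}_{H,H}$ with $q(L)=[P/K]$ such that $$\sum_{\substack{h\in H\\ (P',K')-{}^h(P'',K'')}}|K'\cap{}^hK''|\cdot\chi''\bigl(\tau\circ\beta(P',K';{}^hP'',{}^hK'')\circ\bar{c}_h\bigr)\ne0$$ in the field $R$. Here $\chi''$ is the character of the simple $R\mathrm{Aut}_{\mathsf{C}}(P''/K'')$-module $T''$ corresponding to $T$, and $\bar{c}_h\colon P''/K''\to{}^hP''/{}^hK''$ is the isomorphism induced by conjugation with $h$.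
   Context: All groups are finite. A section of $G$ is a pair $(P,K)$ with $K\unlhd P\le G$; ${}^hU=hUh^{-1}$ and ${}^h(P,K)=({}^hP,{}^hK)$. For $L\le G\times H$: $p_1(L),p_2(L)$ are the images under the projections; $k_1(L)=\{g\mid(g,1)\in L\}$, $k_2(L)=\{h\mid(1,h)\in L\}$; $q(L)$ is the common isomorphism class of $p_1(L)/k_1(L)\cong p_2(L)/k_2(L)$; $[Q]$ is the isomorphism class of $Q$. For sections $(B,A)$ of $G$, $(D,C)$ of $H$ and an isomorphism $\eta\colon D/C\to B/A$, $(B,A,\eta,D,C)$ denotes the subgroup $\{(g,h)\in B\times D\mid\eta(hC)=gA\}$ of $G\times H$; every subgroup of $G\times H$ has a unique such form. For $L\le G\times H$, $M\le H\times K$ put $L*M=\{(g,k)\in G\times K\mid\exists h\in H:(g,h)\in L,(h,k)\in M\}$. Sections $(B,A)$ and $(D,C)$ of a group are linked, written $(D,C)-(B,A)$, if $D\cap A=C\cap B$, $(D\cap B)C=D$ and $(D\cap B)A=B$. In that case $\beta(B,A;D,C)\colon D/C\to B/A$ is the unique isomorphism mapping $xC$ to $xA$ for all $x\in B\cap D$. $\mathsf{B}$ is a category whose objects form a set of finite groups in which every isomorphism type of finite group is represented, with $\mathrm{Hom}_{\mathsf{B}}(H,G)=\mathscr{S}_{G\times H}$ (the set of subgroups of $G\times H$) and composition $L\circ M=L*M$; the identity of $G$ is $\{(g,g)\mid g\in G\}$. For a subcategory $\mathsf{C}$ write $\mathsf{C}_{G,H}=\mathrm{Hom}_{\mathsf{C}}(H,G)$.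 A category is finite if its set of morphisms is finite. A finite group $Q$ is realized in $\mathsf{C}$ if there are $G,H\in\mathrm{Ob}(\mathsf{C})$ and $L\in\mathsf{C}_{G,H}$ with $q(L)=[Q]$. Condition ( * ): if $Q$ is realized in $\mathsf{C}$, $G,H\in\mathrm{Ob}(\mathsf{C})$, and $(P_1,K_1)$, $(P_2,K_2)$ are sections of $G$, $H$ with $P_1/K_1\cong Q\cong P_2/K_2$, then there exists an isomorphism $\alpha\colon P_2/K_2\to P_1/K_1$ with $(P_1,K_1,\alpha,P_2,K_2)\in\mathsf{C}_{G,H}$. $A:=A_{\mathsf{C},R}^\kappa$ is the free $R$-module on the morphisms of $\mathsf{C}$ with product $L\cdot M=\frac{|k_2(L)\cap k_1(M)|}{|H|}\,(L*M)$ for $L\in\mathsf{C}_{G,H}$, $M\in\mathsf{C}_{H,K}$, and product $0$ for non-composable morphisms. Put $\Delta_g(G)=\{(gxg^{-1},x)\mid x\in G\}$, $e_G=\sum_{g\in G}\Delta_g(G)$ and $e_{\mathsf{C}}=\sum_{G\in\mathrm{Ob}(\mathsf{C})}e_G$, an idempotent of $A$. For a section $(P,K)$ of $G\in\mathrm{Ob}(\mathsf{C})$: $e_{(P,K)}:=(P,K,\mathrm{id}_{P/K},P,K)$. If $e=e_{(P,K)}\in\mathsf{C}_{G,G}$, put $e'_{(P,K)}:=[G:K]\cdot e_{(P,K)}$, an idempotent of $A$; $\mathrm{Aut}_{\mathsf{C}}(P/K):=\{\alpha\in\mathrm{Aut}(P/K)\mid(P,K,\alpha,P,K)\in\mathsf{C}_{G,G}\}$;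 $\Gamma_e=\{(P,K,\alpha,P,K)\mid\alpha\in\mathrm{Aut}_{\mathsf{C}}(P/K)\}$ (the unit group of the monoid $e*\mathsf{C}_{G,G}*e$) and $J_e=(e*\mathsf{C}_{G,G}*e)\smallsetminus\Gamma_e$. Then $e'_{(P,K)}Ae'_{(P,K)}=R_\kappa\Gamma_e\oplus RJ_e$ ($R$-spans), where $RJ_e$ is an ideal and $R\mathrm{Aut}_{\mathsf{C}}(P/K)\cong R_\kappa\Gamma_e$ via $\alpha\mapsto[G:K](P,K,\alpha,P,K)$. For a simple $R\mathrm{Aut}_{\mathsf{C}}(P/K)$-module $T$, $\tilde T$ is $T$ viewed as an $e'_{(P,K)}Ae'_{(P,K)}$-module via this isomorphism with $RJ_e$ acting as $0$, and $$S_{(P,K),T}:=\mathrm{Hd}\bigl(Ae'_{(P,K)}\otimes_{e'_{(P,K)}Ae'_{(P,K)}}\tilde T\bigr),$$ where $\mathrm{Hd}(M)=M/\mathrm{Rad}(M)$ and $\mathrm{Rad}(M)$ is the intersection of all maximal submodules of $M$; it is a simple $A$-module. If $(P'',K'')$ is a section of $H\in\mathrm{Ob}(\mathsf C)$ with $P''/K''\cong P/K$, there is an isomorphism $\gamma\colon P''/K''\to P/K$ with $(P,K,\gamma,P'',K'')\in\mathsf{C}_{G,H}$, and $\alpha\mapsto\gamma\alpha\gamma^{-1}$ is a group isomorphism $\mathrm{Aut}_{\mathsf{C}}(P''/K'')\to\mathrm{Aut}_{\mathsf{C}}(P/K)$, well defined up to inner automorphisms of $\mathrm{Aut}_{\mathsf{C}}(P/K)$;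 $T''$ is the $R\mathrm{Aut}_{\mathsf{C}}(P''/K'')$-module obtained from $T$ by restriction along it. The argument of $\chi''$ in the displayed condition lies in $\mathrm{Aut}_{\mathsf{C}}(P''/K'')$. *)

theory Defs
  imports "HOL-Algebra.Bij" "HOL-Algebra.AbelCoset" "HOL-Algebra.Module" "HOL-Algebra.Free_Abelian_Groups"
begin

section \<open>Sections of groups and subgroups of direct products\<close>

definition is_section :: "'g monoid \<Rightarrow> 'g set \<Rightarrow> 'g set \<Rightarrow> bool" where
  "is_section G P K \<longleftrightarrow> subgroup P G \<and> K \<lhd> (G\<lparr>carrier := P\<rparr>)"

abbreviation subquot :: "'g monoid \<Rightarrow> 'g set \<Rightarrow> 'g set \<Rightarrow> 'g set monoid" where
  "subquot G P K \<equiv> (G\<lparr>carrier := P\<rparr>) Mod K"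

definition conj_set :: "'g monoid \<Rightarrow> 'g \<Rightarrow> 'g set \<Rightarrow> 'g set" where
  "conj_set G g U = (\<lambda>u. g \<otimes>\<^bsub>G\<^esub> u \<otimes>\<^bsub>G\<^esub> inv\<^bsub>G\<^esub> g) ` U"

definition k1 :: "'h monoid \<Rightarrow> ('g \<times> 'h) set \<Rightarrow> 'g set" where
  "k1 H L = {g. (g, \<one>\<^bsub>H\<^esub>) \<in> L}"

definition k2 :: "'g monoid \<Rightarrow> ('g \<times> 'h) set \<Rightarrow> 'h set" where
  "k2 G L = {h. (\<one>\<^bsub>G\<^esub>, h) \<in> L}"

text \<open>For \<open>L \<le> G \<times> H\<close>, the group \<open>p\<^sub>1(L)/k\<^sub>1(L)\<close>, a representative of the isomorphism
  class \<open>q(L)\<close>. Thus \<open>q(L) = [Q]\<close> reads \<open>q_group G H L \<cong> Q\<close>.\<close>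

definition q_group :: "'g monoid \<Rightarrow> 'h monoid \<Rightarrow> ('g \<times> 'h) set \<Rightarrow> 'g set monoid" where
  "q_group G H L = subquot G (fst ` L) (k1 H L)"

text \<open>The subgroup \<open>(B, A, \<eta>, D, C)\<close> of \<open>G \<times> H\<close>. The library's quotients consist of right
  cosets; as \<open>A\<close> and \<open>C\<close> are normal in \<open>B\<close> and \<open>D\<close>, these are the left cosets as well.\<close>

definition goursat ::
    "'g monoid \<Rightarrow> 'g set \<Rightarrow> 'g set \<Rightarrow> ('h set \<Rightarrow> 'g set) \<Rightarrow> 'h monoid \<Rightarrow> 'h set \<Rightarrow> 'h set \<Rightarrow> ('g \<times> 'h) set"
  where "goursat G B A \<eta> H D C = {(g, h). g \<in> B \<and> h \<in> D \<and> \<eta> (C #>\<^bsub>H\<^esub> h) = A #>\<^bsub>G\<^esub> g}"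

text \<open>The relation \<open>(D, C) - (B, A)\<close>.\<close>

definition linked :: "'g monoid \<Rightarrow> 'g set \<Rightarrow> 'g set \<Rightarrow> 'g set \<Rightarrow> 'g set \<Rightarrow> bool" where
  "linked G D C B A \<longleftrightarrow>
     D \<inter> A = C \<inter> B \<and> (D \<inter> B) <#>\<^bsub>G\<^esub> C = D \<and> (D \<inter> B) <#>\<^bsub>G\<^esub> A = B"

text \<open>\<open>\<beta>(B, A; D, C) : D/C \<rightarrow> B/A\<close>; isomorphisms are not extensional in the library, so
  extensionality is required separately to make the choice unique.\<close>

definition beta ::
    "'g monoid \<Rightarrow> 'g set \<Rightarrow> 'g set \<Rightarrow> 'g set \<Rightarrow> 'g set \<Rightarrow> ('g set \<Rightarrow> 'g set)" where
  "beta G B A D C = (THE f.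
     f \<in> iso (subquot G D C) (subquot G B A) \<and> f \<in> extensional (carrier (subquot G D C)) \<and>
     (\<forall>x \<in> B \<inter> D. f (C #>\<^bsub>G\<^esub> x) = A #>\<^bsub>G\<^esub> x))"


section \<open>The category and its subcategories\<close>

text \<open>\<open>Mor \<C> G H\<close> is \<open>Hom(H, G)\<close>; its values are relevant only at objects \<open>G\<close>, \<open>H\<close>.
  Composition of \<open>L \<in> Mor \<C> G H\<close> with \<open>M \<in> Mor \<C> H K\<close> is relational composition
  \<open>L O M\<close>, which is exactly \<open>L * M\<close>.\<close>

record 'g group_cat =
  Obj :: "'g monoid set"
  Mor :: "'g monoid \<Rightarrow> 'g monoid \<Rightarrow> ('g \<times> 'g) set set"

definition subgroup_cat :: "'g monoid set \<Rightarrow> 'g group_cat" where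
  "subgroup_cat \<G> = \<lparr>Obj = \<G>, Mor = (\<lambda>G H. {L. subgroup L (G \<times>\<times> H)})\<rparr>"

text \<open>Every finite group is isomorphic to one whose elements are natural numbers, so it is enough
  to quantify over those.\<close>

definition represents_finite_groups :: "'g monoid set \<Rightarrow> bool" where
  "represents_finite_groups \<G> \<longleftrightarrow>
     (\<forall>G \<in> \<G>. group G \<and> finite (carrier G)) \<and>
     (\<forall>(X :: nat monoid). group X \<and> finite (carrier X) \<longrightarrow> (\<exists>G \<in> \<G>. G \<cong> X))"

definition subcategory :: "'g group_cat \<Rightarrow> 'g group_cat \<Rightarrow> bool" where
  "subcategory \<C> \<B> \<longleftrightarrow>
     Obj \<C> \<subseteq> Obj \<B> \<and>
     (\<forall>G \<in> Obj \<C>. \<forall>H \<in> Obj \<C>. Mor \<C> G H \<subseteq> Mor \<B> G H) \<and>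
     (\<forall>G \<in> Obj \<C>. Id_on (carrier G) \<in> Mor \<C> G G) \<and>
     (\<forall>G \<in> Obj \<C>. \<forall>H \<in> Obj \<C>. \<forall>K \<in> Obj \<C>.
        \<forall>L \<in> Mor \<C> G H. \<forall>M \<in> Mor \<C> H K. L O M \<in> Mor \<C> G K)"

text \<open>A subset of \<open>G \<times> H\<close> is a morphism from \<open>H\<close> to \<open>G\<close> only together with its
  source and target; morphisms are therefore tagged as \<open>(G, L, H)\<close>.\<close>

type_synonym 'g arrow = "'g monoid \<times> ('g \<times> 'g) set \<times> 'g monoid"

definition arrows :: "'g group_cat \<Rightarrow> 'g arrow set" where
  "arrows \<C> = {(G, L, H). G \<in> Obj \<C> \<and> H \<in> Obj \<C> \<and> L \<in> Mor \<C> G H}"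

definition finite_cat :: "'g group_cat \<Rightarrow> bool" where
  "finite_cat \<C> \<longleftrightarrow> finite (arrows \<C>)"

definition conj_closed :: "'g group_cat \<Rightarrow> bool" where
  "conj_closed \<C> \<longleftrightarrow>
     (\<forall>G \<in> Obj \<C>. \<forall>H \<in> Obj \<C>. \<forall>L \<in> Mor \<C> G H. \<forall>x \<in> carrier (G \<times>\<times> H).
        conj_set (G \<times>\<times> H) x L \<in> Mor \<C> G H)"

definition realized :: "'g group_cat \<Rightarrow> 'q monoid \<Rightarrow> bool" where
  "realized \<C> Q \<longleftrightarrow> (\<exists>G \<in> Obj \<C>. \<exists>H \<in> Obj \<C>. \<exists>L \<in> Mor \<C> G H. q_group G H L \<cong> Q)"

text \<open>Condition \<open>(*)\<close>. The groups realized in \<open>\<C>\<close> are, up to isomorphism, of the form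
  \<open>q_group G H L\<close>, so \<open>Q\<close> may be taken over the type \<^typ>\<open>'g set\<close>.\<close>

definition condition_star :: "'g group_cat \<Rightarrow> bool" where
  "condition_star \<C> \<longleftrightarrow>
     (\<forall>(Q :: 'g set monoid) G H P1 K1 P2 K2.
        group Q \<and> realized \<C> Q \<and> G \<in> Obj \<C> \<and> H \<in> Obj \<C> \<and>
        is_section G P1 K1 \<and> is_section H P2 K2 \<and>
        subquot G P1 K1 \<cong> Q \<and> Q \<cong> subquot H P2 K2 \<longrightarrow>
        (\<exists>\<alpha> \<in> iso (subquot H P2 K2) (subquot G P1 K1). goursat G P1 K1 \<alpha> H P2 K2 \<in> Mor \<C> G H))"

definition e_sec :: "'g monoid \<Rightarrow> 'g set \<Rightarrow> 'g set \<Rightarrow> ('g \<times> 'g) set" where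
  "e_sec G P K = goursat G P K id G P K"

text \<open>\<open>Aut\<^sub>\<C>(P/K)\<close> as a subgroup of the library's automorphism group, whose elements are
  extensional functions on \<open>P/K\<close>.\<close>

definition AutC :: "'g group_cat \<Rightarrow> 'g monoid \<Rightarrow> 'g set \<Rightarrow> 'g set \<Rightarrow> ('g set \<Rightarrow> 'g set) monoid" where
  "AutC \<C> G P K = (AutoGroup (subquot G P K))
     \<lparr>carrier := {\<alpha> \<in> auto (subquot G P K). goursat G P K \<alpha> G P K \<in> Mor \<C> G G}\<rparr>"


section \<open>Modules over rings that need not be commutative\<close>

text \<open>The library's module locale requires a commutative ring. Its record is reused here; the fields
  \<open>mult\<close> and \<open>one\<close> of a module record carry no meaning.\<close>

locale left_module = R?: ring A + M?: abelian_group M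
  for A :: "('a, 'b) ring_scheme" and M :: "('a, 'm) module" (structure) +
  assumes smult_closed: "\<lbrakk>a \<in> carrier A; x \<in> carrier M\<rbrakk> \<Longrightarrow> a \<odot>\<^bsub>M\<^esub> x \<in> carrier M"
    and smult_l_distr: "\<lbrakk>a \<in> carrier A; b \<in> carrier A; x \<in> carrier M\<rbrakk> \<Longrightarrow>
      (a \<oplus>\<^bsub>A\<^esub> b) \<odot>\<^bsub>M\<^esub> x = a \<odot>\<^bsub>M\<^esub> x \<oplus>\<^bsub>M\<^esub> b \<odot>\<^bsub>M\<^esub> x"
    and smult_r_distr: "\<lbrakk>a \<in> carrier A; x \<in> carrier M; y \<in> carrier M\<rbrakk> \<Longrightarrow>
      a \<odot>\<^bsub>M\<^esub> (x \<oplus>\<^bsub>M\<^esub> y) = a \<odot>\<^bsub>M\<^esub> x \<oplus>\<^bsub>M\<^esub> a \<odot>\<^bsub>M\<^esub> y"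
    and smult_assoc: "\<lbrakk>a \<in> carrier A; b \<in> carrier A; x \<in> carrier M\<rbrakk> \<Longrightarrow>
      (a \<otimes>\<^bsub>A\<^esub> b) \<odot>\<^bsub>M\<^esub> x = a \<odot>\<^bsub>M\<^esub> (b \<odot>\<^bsub>M\<^esub> x)"
    and smult_one: "x \<in> carrier M \<Longrightarrow> \<one>\<^bsub>A\<^esub> \<odot>\<^bsub>M\<^esub> x = x"

definition simple_module :: "('a, 'b) ring_scheme \<Rightarrow> ('a, 'm) module \<Rightarrow> bool" where
  "simple_module A M \<longleftrightarrow> left_module A M \<and> carrier M \<noteq> {\<zero>\<^bsub>M\<^esub>} \<and>
     (\<forall>N. submodule N A M \<longrightarrow> N = {\<zero>\<^bsub>M\<^esub>} \<or> N = carrier M)"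

definition maximal_submodule :: "'m set \<Rightarrow> ('a, 'b) ring_scheme \<Rightarrow> ('a, 'm) module \<Rightarrow> bool" where
  "maximal_submodule N A M \<longleftrightarrow> submodule N A M \<and> N \<noteq> carrier M \<and>
     (\<forall>N'. submodule N' A M \<and> N \<subseteq> N' \<longrightarrow> N' = N \<or> N' = carrier M)"

definition Rad :: "('a, 'b) ring_scheme \<Rightarrow> ('a, 'm) module \<Rightarrow> 'm set" where
  "Rad A M = carrier M \<inter> \<Inter>{N. maximal_submodule N A M}"

definition quot_module :: "('a, 'm) module \<Rightarrow> 'm set \<Rightarrow> ('a, 'm set) module" where
  "quot_module M N =
     \<lparr>carrier = a_rcosets\<^bsub>M\<^esub> N, mult = undefined, one = undefined, ring.zero = N, add = set_add M,
      smult = (\<lambda>a X. \<Union>x\<in>X. N +>\<^bsub>M\<^esub> (a \<odot>\<^bsub>M\<^esub> x))\<rparr>"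

definition Hd :: "('a, 'b) ring_scheme \<Rightarrow> ('a, 'm) module \<Rightarrow> ('a, 'm set) module" where
  "Hd A M = quot_module M (Rad A M)"

text \<open>For an idempotent \<open>e\<close> of \<open>A\<close>: the ring \<open>eAe\<close> with identity \<open>e\<close>, and the left
  ideal \<open>Ae\<close>.\<close>

definition corner_ring :: "('a, 'b) ring_scheme \<Rightarrow> 'a \<Rightarrow> ('a, 'b) ring_scheme" where
  "corner_ring A e =
     A\<lparr>carrier := (\<lambda>a. e \<otimes>\<^bsub>A\<^esub> a \<otimes>\<^bsub>A\<^esub> e) ` carrier A, one := e\<rparr>"

definition left_ideal_of :: "('a, 'b) ring_scheme \<Rightarrow> 'a \<Rightarrow> 'a set" where
  "left_ideal_of A e = (\<lambda>a. a \<otimes>\<^bsub>A\<^esub> e) ` carrier A"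

text \<open>\<open>Ae \<otimes> T\<close> over \<open>eAe\<close>, for a left \<open>eAe\<close>-module \<open>T\<close>: the free abelian group on
  \<open>Ae \<times> T\<close> (written multiplicatively in the library, with product \<open>+\<close>) modulo the subgroup
  generated by the tensor relations; \<open>A\<close> acts by \<open>a (x \<otimes> t) = ax \<otimes> t\<close>.\<close>

definition tensor_relations ::
    "('a, 'b) ring_scheme \<Rightarrow> 'a \<Rightarrow> ('a, 't) module \<Rightarrow> (('a \<times> 't) \<Rightarrow>\<^sub>0 int) set" where
  "tensor_relations A e T =
     {frag_of (x \<oplus>\<^bsub>A\<^esub> y, t) - frag_of (x, t) - frag_of (y, t) | x y t.
        x \<in> left_ideal_of A e \<and> y \<in> left_ideal_of A e \<and> t \<in> carrier T} \<union>
     {frag_of (x, t \<oplus>\<^bsub>T\<^esub> u) - frag_of (x, t) - frag_of (x, u) | x t u.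
        x \<in> left_ideal_of A e \<and> t \<in> carrier T \<and> u \<in> carrier T} \<union>
     {frag_of (x \<otimes>\<^bsub>A\<^esub> b, t) - frag_of (x, b \<odot>\<^bsub>T\<^esub> t) | x b t.
        x \<in> left_ideal_of A e \<and> b \<in> carrier (corner_ring A e) \<and> t \<in> carrier T}"

definition tensor_module ::
    "('a, 'b) ring_scheme \<Rightarrow> 'a \<Rightarrow> ('a, 't) module \<Rightarrow> ('a, (('a \<times> 't) \<Rightarrow>\<^sub>0 int) set) module" where
  "tensor_module A e T =
     (let F = free_Abelian_group (left_ideal_of A e \<times> carrier T);
          N = generate F (tensor_relations A e T)
      in \<lparr>carrier = carrier (F Mod N), mult = undefined, one = undefined,
          ring.zero = \<one>\<^bsub>F Mod N\<^esub>, add = (\<lambda>X Y. X \<otimes>\<^bsub>F Mod N\<^esub> Y),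
          smult = (\<lambda>a X. \<Union>f\<in>X. N #>\<^bsub>F\<^esub> frag_extend (\<lambda>(x, t). frag_of (a \<otimes>\<^bsub>A\<^esub> x, t)) f)\<rparr>)"


section \<open>Free modules over a field, group algebras and characters\<close>

text \<open>The free \<open>R\<close>-module on a set \<open>X\<close> is modelled by the finitely supported functions with
  support in \<open>X\<close>; \<open>Poly_Mapping.single x r\<close> is \<open>r x\<close>. \<open>linear_ext f\<close> is the linear extension
  of a map \<open>f\<close> given on the basis.\<close>

definition linear_ext :: "('a \<Rightarrow> ('b \<Rightarrow>\<^sub>0 'r::field)) \<Rightarrow> ('a \<Rightarrow>\<^sub>0 'r) \<Rightarrow> ('b \<Rightarrow>\<^sub>0 'r)" where
  "linear_ext f a =
     (\<Sum>x \<in> Poly_Mapping.keys a. Poly_Mapping.map ((*) (Poly_Mapping.lookup a x)) (f x))"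

definition based_algebra ::
    "'a set \<Rightarrow> ('a \<Rightarrow> 'a \<Rightarrow> ('a \<Rightarrow>\<^sub>0 'r::field)) \<Rightarrow> ('a \<Rightarrow>\<^sub>0 'r) \<Rightarrow> ('a \<Rightarrow>\<^sub>0 'r) ring" where
  "based_algebra X m u =
     \<lparr>carrier = {a. Poly_Mapping.keys a \<subseteq> X},
      mult = (\<lambda>a b. linear_ext (\<lambda>x. linear_ext (m x) b) a),
      one = u, ring.zero = 0, add = (+)\<rparr>"

definition group_algebra :: "'q monoid \<Rightarrow> ('q \<Rightarrow>\<^sub>0 'r::field) ring" where
  "group_algebra \<Gamma> =
     based_algebra (carrier \<Gamma>) (\<lambda>x y. Poly_Mapping.single (x \<otimes>\<^bsub>\<Gamma>\<^esub> y) 1)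
       (Poly_Mapping.single \<one>\<^bsub>\<Gamma>\<^esub> 1)"

text \<open>The trace of an endomorphism \<open>f\<close> of an \<open>R\<close>-vector space \<open>V\<close> having a finite basis.\<close>

definition is_fin_basis :: "('r::field, 't) module \<Rightarrow> 't set \<Rightarrow> bool" where
  "is_fin_basis V B \<longleftrightarrow> finite B \<and> B \<subseteq> carrier V \<and>
     (\<forall>v \<in> carrier V. \<exists>!c. c \<in> extensional B \<and> v = (\<Oplus>\<^bsub>V\<^esub>b\<in>B. c b \<odot>\<^bsub>V\<^esub> b))"

definition coords :: "('r::field, 't) module \<Rightarrow> 't set \<Rightarrow> 't \<Rightarrow> ('t \<Rightarrow> 'r)" where
  "coords V B v = (THE c. c \<in> extensional B \<and> v = (\<Oplus>\<^bsub>V\<^esub>b\<in>B. c b \<odot>\<^bsub>V\<^esub> b))"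

definition trace_on :: "('r::field, 't) module \<Rightarrow> ('t \<Rightarrow> 't) \<Rightarrow> 'r" where
  "trace_on V f = (let B = (SOME B. is_fin_basis V B) in \<Sum>b\<in>B. coords V B (f b) b)"

text \<open>\<open>change_scalars \<phi> T\<close> is \<open>T\<close> with \<open>a\<close> acting as \<open>\<phi> a\<close>.\<close>

definition change_scalars :: "('b \<Rightarrow> 'a) \<Rightarrow> ('a, 't) module \<Rightarrow> ('b, 't) module" where
  "change_scalars \<phi> T =
     \<lparr>carrier = carrier T, mult = mult T, one = one T, ring.zero = ring.zero T, add = add T,
      smult = (\<lambda>b t. \<phi> b \<odot>\<^bsub>T\<^esub> t)\<rparr>"

text \<open>The character of an \<open>R\<Gamma>\<close>-module; \<open>R\<close> acts through the multiples of the identity.\<close>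

definition module_character :: "'q monoid \<Rightarrow> ('q \<Rightarrow>\<^sub>0 'r::field, 't) module \<Rightarrow> 'q \<Rightarrow> 'r" where
  "module_character \<Gamma> T \<alpha> =
     trace_on (change_scalars (Poly_Mapping.single \<one>\<^bsub>\<Gamma>\<^esub>) T) (\<lambda>t. Poly_Mapping.single \<alpha> 1 \<odot>\<^bsub>T\<^esub> t)"


section \<open>The twisted category algebra\<close>

definition arrow_prod :: "'g arrow \<Rightarrow> 'g arrow \<Rightarrow> ('g arrow \<Rightarrow>\<^sub>0 'r::field_char_0)" where
  "arrow_prod = (\<lambda>(G, L, H) (H', M, K).
     if H = H'
     then Poly_Mapping.single (G, L O M, K)
            (of_nat (card (k2 G L \<inter> k1 K M)) / of_nat (card (carrier H)))
     else 0)"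

text \<open>The identity is \<open>\<Sum>\<^sub>G |G| id\<^sub>G\<close>, since \<open>id\<^sub>G \<cdot> M = |G|\<^sup>-\<^sup>1 M\<close>.\<close>

definition twisted_algebra :: "'g group_cat \<Rightarrow> ('g arrow \<Rightarrow>\<^sub>0 'r::field_char_0) ring" where
  "twisted_algebra \<C> =
     based_algebra (arrows \<C>) arrow_prod
       (\<Sum>G \<in> Obj \<C>. Poly_Mapping.single (G, Id_on (carrier G), G) (of_nat (card (carrier G))))"

definition Delta :: "'g monoid \<Rightarrow> 'g \<Rightarrow> ('g \<times> 'g) set" where
  "Delta G g = {(g \<otimes>\<^bsub>G\<^esub> x \<otimes>\<^bsub>G\<^esub> inv\<^bsub>G\<^esub> g, x) | x. x \<in> carrier G}"

definition e_grp :: "'g monoid \<Rightarrow> ('g arrow \<Rightarrow>\<^sub>0 'r::field_char_0)" where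
  "e_grp G = (\<Sum>g \<in> carrier G. Poly_Mapping.single (G, Delta G g, G) 1)"

definition e_cat :: "'g group_cat \<Rightarrow> ('g arrow \<Rightarrow>\<^sub>0 'r::field_char_0)" where
  "e_cat \<C> = (\<Sum>G \<in> Obj \<C>. e_grp G)"

definition e_idem :: "'g monoid \<Rightarrow> 'g set \<Rightarrow> 'g set \<Rightarrow> ('g arrow \<Rightarrow>\<^sub>0 'r::field_char_0)" where
  "e_idem G P K = Poly_Mapping.single (G, e_sec G P K, G) (of_nat (card (rcosets\<^bsub>G\<^esub> K)))"

text \<open>The projection of \<open>e'Ae' = R\<Gamma>\<^sub>e \<oplus> RJ\<^sub>e\<close> onto \<open>R\<Gamma>\<^sub>e\<close>, followed by the inverse of
  \<open>\<alpha> \<mapsto> [G:K] (P, K, \<alpha>, P, K)\<close>.\<close>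

definition corner_proj ::
    "'g group_cat \<Rightarrow> 'g monoid \<Rightarrow> 'g set \<Rightarrow> 'g set \<Rightarrow>
     ('g arrow \<Rightarrow>\<^sub>0 'r::field_char_0) \<Rightarrow> (('g set \<Rightarrow> 'g set) \<Rightarrow>\<^sub>0 'r)" where
  "corner_proj \<C> G P K a =
     (\<Sum>\<alpha> \<in> carrier (AutC \<C> G P K). Poly_Mapping.single \<alpha>
        (Poly_Mapping.lookup a (G, goursat G P K \<alpha> G P K, G) / of_nat (card (rcosets\<^bsub>G\<^esub> K))))"

definition simple_S ::
    "'g group_cat \<Rightarrow> 'g monoid \<Rightarrow> 'g set \<Rightarrow> 'g set \<Rightarrow>
     (('g set \<Rightarrow> 'g set) \<Rightarrow>\<^sub>0 'r::field_char_0, 't) module \<Rightarrow>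
     ('g arrow \<Rightarrow>\<^sub>0 'r, ((('g arrow \<Rightarrow>\<^sub>0 'r) \<times> 't) \<Rightarrow>\<^sub>0 int) set set) module" where
  "simple_S \<C> G P K T =
     Hd (twisted_algebra \<C>)
       (tensor_module (twisted_algebra \<C>) (e_idem G P K)
          (change_scalars (corner_proj \<C> G P K) T))"


section \<open>Transport of modules between isomorphic sections\<close>

text \<open>An isomorphism \<open>\<gamma> : P''/K'' \<rightarrow> P/K\<close> with \<open>(P, K, \<gamma>, P'', K'')\<close> a morphism of \<open>\<C>\<close>,
  and the resulting isomorphism \<open>\<alpha> \<mapsto> \<gamma> \<alpha> \<gamma>\<^sup>-\<^sup>1\<close>. A different \<open>\<gamma>\<close> changes the latter by an inner
  automorphism of \<open>Aut\<^sub>\<C>(P/K)\<close>, hence does not affect the character of the restricted module.\<close>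

definition transport_iso ::
    "'g group_cat \<Rightarrow> 'g monoid \<Rightarrow> 'g set \<Rightarrow> 'g set \<Rightarrow> 'g monoid \<Rightarrow> 'g set \<Rightarrow> 'g set \<Rightarrow>
     ('g set \<Rightarrow> 'g set)" where
  "transport_iso \<C> G P K H P'' K'' =
     (SOME \<gamma>. \<gamma> \<in> iso (subquot H P'' K'') (subquot G P K) \<and> goursat G P K \<gamma> H P'' K'' \<in> Mor \<C> G H)"

definition conj_by_iso ::
    "'x monoid \<Rightarrow> 'y monoid \<Rightarrow> ('x \<Rightarrow> 'y) \<Rightarrow> ('x \<Rightarrow> 'x) \<Rightarrow> ('y \<Rightarrow> 'y)" where
  "conj_by_iso X Y \<gamma> \<alpha> = restrict (\<gamma> \<circ> \<alpha> \<circ> inv_into (carrier X) \<gamma>) (carrier Y)"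

definition transport_module ::
    "'g group_cat \<Rightarrow> 'g monoid \<Rightarrow> 'g set \<Rightarrow> 'g set \<Rightarrow>
     (('g set \<Rightarrow> 'g set) \<Rightarrow>\<^sub>0 'r::field_char_0, 't) module \<Rightarrow>
     'g monoid \<Rightarrow> 'g set \<Rightarrow> 'g set \<Rightarrow> (('g set \<Rightarrow> 'g set) \<Rightarrow>\<^sub>0 'r, 't) module" where
  "transport_module \<C> G P K T H P'' K'' =
     change_scalars
       (linear_ext (\<lambda>\<alpha>. Poly_Mapping.single
          (conj_by_iso (subquot H P'' K'') (subquot G P K) (transport_iso \<C> G P K H P'' K'') \<alpha>) 1))
       T"

text \<open>\<open>\<tau> \<circ> \<beta>(P', K'; \<^sup>hP'', \<^sup>hK'') \<circ> c\<^sub>h\<close> as an extensional function on \<open>P''/K''\<close>, so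
  that it can be an element of \<open>AutC \<C> H P'' K''\<close>.\<close>

definition twist_aut ::
    "'g monoid \<Rightarrow> 'g set \<Rightarrow> 'g set \<Rightarrow> ('g set \<Rightarrow> 'g set) \<Rightarrow> 'g set \<Rightarrow> 'g set \<Rightarrow> 'g \<Rightarrow>
     ('g set \<Rightarrow> 'g set)" where
  "twist_aut H P'' K'' \<tau> P' K' h =
     restrict (\<tau> \<circ> beta H P' K' (conj_set H h P'') (conj_set H h K'') \<circ> conj_set H h)
       (carrier (subquot H P'' K''))"

end

theory Submission
  imports Defs "HOL.Vector_Spaces"
begin

text \<open>Write \<open>e\<close> for the idempotent attached to \<open>(P, K)\<close>, \<open>\<Gamma>\<close> for \<open>Aut\<^sub>\<C>(P/K)\<close>, and \<open>\<pi>\<close> for the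
  projection \<open>eAe \<rightarrow> R\<Gamma>\<close> with kernel \<open>RJ\<^sub>e\<close>. The module \<open>M = Ae \<otimes> T\<close> satisfies \<open>eM \<cong> T\<close>, which is
  simple, so \<open>M\<close> has exactly one maximal submodule, namely the set of all \<open>m\<close> with \<open>eAm = 0\<close>.
  Hence an element \<open>c\<close> of \<open>A\<close> acts nontrivially on the head of \<open>M\<close> if and only if \<open>\<pi>(eAcAe)\<close>
  acts nontrivially on \<open>T\<close> (\<open>head_smult_nonzero_iff\<close>).

  The span \<open>I\<close> of \<open>\<pi>(eAcAe)\<close> is a two-sided ideal of \<open>R\<Gamma>\<close>. By Maschke's theorem it has a left
  identity \<open>f\<close>. If \<open>I\<close> does not annihilate the simple module \<open>T\<close>, then \<open>f\<close> acts as the identity,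
  so that \<open>\<chi>(f) = dim T\<close>, which is nonzero in characteristic \<open>0\<close>. Therefore \<open>I\<close> acts
  nontrivially on \<open>T\<close> if and only if \<open>\<chi>\<close> does not vanish on a spanning set of \<open>I\<close>
  (\<open>character_detects_action\<close>).

  For \<open>c = e\<^sub>\<C>\<close> such a spanning set consists of the elements \<open>\<pi>(L e\<^sub>\<C> M)\<close> with morphisms \<open>L\<close>
  from some \<open>H\<close> to \<open>G\<close> and \<open>M\<close> from \<open>G\<close> to \<open>H\<close> that satisfy \<open>eL = L\<close> and \<open>Me = M\<close>. Up to
  a scalar, such an element is a weighted sum of those composites \<open>L * \<Delta>\<^sub>h * M\<close> with \<open>h \<in> H\<close> that lie in \<open>\<Gamma>\<^sub>e\<close>. Goursat's lemma shows
  that such a composite exists only if \<open>L = (P, K, \<sigma>, P', K')\<close> and \<open>M = (P'', K'', \<rho>, P, K)\<close>,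
  and that it lies in \<open>\<Gamma>\<^sub>e\<close> if and only if \<open>(P', K')\<close> and \<open>\<^sup>h(P'', K'')\<close> are linked; it is then
  the automorphism \<open>\<sigma> \<beta> c\<^sub>h \<rho>\<close>, and its weight is proportional to \<open>|K' \<inter> \<^sup>hK''|\<close>
  (\<open>chi_sandwich\<close>). Finally, condition \<open>(*)\<close> provides an isomorphism \<open>\<gamma> : P''/K'' \<rightarrow> P/K\<close> such
  that both it and its inverse give morphisms, and the invariance of the trace under cyclic
  permutations allows one to assume \<open>\<rho> = \<gamma>\<^sup>-\<^sup>1\<close>. With \<open>\<sigma> = \<gamma> \<tau>\<close> the sum becomes the one in the
  theorem.\<close>

section \<open>The head of an induced module\<close>

text \<open>Closure under negation is automatic, because \<open>-x = (-1)x\<close>.\<close>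

lemma (in left_module) submodule_criterion:
  assumes U: "U \<subseteq> carrier M" "U \<noteq> {}"
    and add: "\<And>x y. \<lbrakk>x \<in> U; y \<in> U\<rbrakk> \<Longrightarrow> x \<oplus> y \<in> U"
    and smult: "\<And>a x. \<lbrakk>a \<in> carrier A; x \<in> U\<rbrakk> \<Longrightarrow> a \<odot> x \<in> U"
  shows "submodule U A M"
proof (intro submodule.intro submodule_axioms.intro group.subgroupI[OF M.a_group])
  show "inv\<^bsub>add_monoid M\<^esub> x \<in> U" if x: "x \<in> U" for x
  proof -
    have xM: "x \<in> carrier M" using x U(1) by blast
    have z: "\<zero>\<^bsub>A\<^esub> \<odot> x \<in> carrier M" by (rule smult_closed) (use xM in auto)
    have "\<zero>\<^bsub>A\<^esub> \<odot> x \<oplus> \<zero>\<^bsub>A\<^esub> \<odot> x = \<zero>\<^bsub>A\<^esub> \<odot> x"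
      using smult_l_distr[of "\<zero>\<^bsub>A\<^esub>" "\<zero>\<^bsub>A\<^esub>" x] xM by simp
    then have "\<zero>\<^bsub>A\<^esub> \<odot> x = \<zero>" using z by (simp add: M.add.l_cancel_one)
    then have "(\<ominus>\<^bsub>A\<^esub> \<one>\<^bsub>A\<^esub>) \<odot> x \<oplus> x = \<zero>"
      using smult_l_distr[of "\<ominus>\<^bsub>A\<^esub> \<one>\<^bsub>A\<^esub>" "\<one>\<^bsub>A\<^esub>" x] smult_one[OF xM] xM by (simp add: R.l_neg)
    moreover have "(\<ominus>\<^bsub>A\<^esub> \<one>\<^bsub>A\<^esub>) \<odot> x \<in> U" by (rule smult) (use x in auto)
    ultimately show ?thesis
      using M.minus_equality[of "(\<ominus>\<^bsub>A\<^esub> \<one>\<^bsub>A\<^esub>) \<odot> x" x] xM U(1) by (auto simp: a_inv_def)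
  qed
qed (use U add smult in auto)

text \<open>The module \<open>Ae \<otimes> T\<close> for a simple \<open>eAe\<close>-module \<open>T\<close>. Computations take place on representatives
  in the free abelian group \<open>F\<close>: \<open>cls\<close> passes to the tensor product, and \<open>act a\<close> lifts
  multiplication by \<open>a\<close> to representatives.\<close>

locale induced_module = ring A for A (structure) +
  fixes e :: 'a and T :: "('a, 't) module"
  assumes e_closed: "e \<in> carrier A" and e_idem: "e \<otimes> e = e"
    and simple: "simple_module (corner_ring A e) T"
begin

abbreviation "Ae \<equiv> left_ideal_of A e"
abbreviation "eAe \<equiv> carrier (corner_ring A e)"
abbreviation "F \<equiv> free_Abelian_group (Ae \<times> carrier T)"
abbreviation "N \<equiv> generate F (tensor_relations A e T)"
abbreviation "M \<equiv> tensor_module A e T"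
abbreviation "act a \<equiv> frag_extend (\<lambda>(x, t). frag_of (a \<otimes> x, t))"
abbreviation "cls f \<equiv> N #>\<^bsub>F\<^esub> f"

sublocale T: left_module "corner_ring A e" T
  using simple by (simp add: simple_module_def)

lemma T_smult [simp]: "b \<in> eAe \<Longrightarrow> t \<in> carrier T \<Longrightarrow> b \<odot>\<^bsub>T\<^esub> t \<in> carrier T"
  by (rule T.smult_closed)

lemma e_in: "e \<in> Ae" "e \<in> eAe"
  using e_closed e_idem by (force simp: left_ideal_of_def corner_ring_def)+

lemma Ae_closed: "x \<in> Ae \<Longrightarrow> x \<in> carrier A"
  using e_closed by (auto simp: left_ideal_of_def)

lemma eAe_closed: "x \<in> eAe \<Longrightarrow> x \<in> carrier A"
  using e_closed by (auto simp: corner_ring_def)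

lemma Ae_e: "x \<in> Ae \<Longrightarrow> x \<otimes> e = x"
  using e_closed e_idem by (auto simp: left_ideal_of_def m_assoc)

lemma eAe_e: assumes "x \<in> eAe" shows "x \<otimes> e = x" "e \<otimes> x = x"
proof -
  obtain a where a: "a \<in> carrier A" "x = e \<otimes> a \<otimes> e"
    using assms by (auto simp: corner_ring_def)
  show "x \<otimes> e = x" using a e_closed e_idem by (simp add: m_assoc)
  have "e \<otimes> (e \<otimes> (a \<otimes> e)) = e \<otimes> (a \<otimes> e)"
    using a e_closed e_idem by (metis m_assoc m_closed)
  then show "e \<otimes> x = x" using a e_closed by (simp add: m_assoc)
qed

lemma Ae_left: "a \<in> carrier A \<Longrightarrow> x \<in> Ae \<Longrightarrow> a \<otimes> x \<in> Ae"
  using e_closed unfolding left_ideal_of_def by (force simp: m_assoc[symmetric])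

lemma Ae_add: "x \<in> Ae \<Longrightarrow> y \<in> Ae \<Longrightarrow> x \<oplus> y \<in> Ae"
  using e_closed by (auto simp: left_ideal_of_def image_iff l_distr[symmetric])

lemma eAe_Ae: "b \<in> eAe \<Longrightarrow> b \<in> Ae"
  using eAe_e eAe_closed unfolding left_ideal_of_def by force

lemma e_Ae: "x \<in> Ae \<Longrightarrow> e \<otimes> x \<in> eAe"
  using e_closed by (auto simp: left_ideal_of_def corner_ring_def m_assoc image_iff)

lemma corner_add [simp]: "x \<oplus>\<^bsub>corner_ring A e\<^esub> y = x \<oplus> y"
  and corner_mult [simp]: "x \<otimes>\<^bsub>corner_ring A e\<^esub> y = x \<otimes> y"
  and corner_one [simp]: "\<one>\<^bsub>corner_ring A e\<^esub> = e"
  by (auto simp: corner_ring_def)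

interpretation F: comm_group F
  by (rule abelian_free_Abelian_group)

lemma relations_closed: "tensor_relations A e T \<subseteq> carrier F"
proof -
  have k: "Poly_Mapping.keys (f - g) \<subseteq> S" if "Poly_Mapping.keys f \<subseteq> S" "Poly_Mapping.keys g \<subseteq> S"
    for f g :: "('a \<times> 't) \<Rightarrow>\<^sub>0 int" and S
    using keys_diff[of f g] that by blast
  have b: "x \<otimes> b \<in> Ae" if "x \<in> Ae" "b \<in> eAe" for x b
    using that Ae_left Ae_closed eAe_Ae by blast
  have "Poly_Mapping.keys r \<subseteq> Ae \<times> carrier T" if "r \<in> tensor_relations A e T" for r
    using that unfolding tensor_relations_def Un_iff mem_Collect_eq
    by (elim disjE exE conjE; hypsubst; intro k) (simp_all add: Ae_add b)
  then show ?thesis by auto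
qed

lemma N_subgroup: "subgroup N F"
  by (rule F.generate_is_subgroup[OF relations_closed])

lemma N_closed: "f \<in> N \<Longrightarrow> Poly_Mapping.keys f \<subseteq> Ae \<times> carrier T"
  using subgroup.mem_carrier[OF N_subgroup] by simp

lemma N_ops: "0 \<in> N" "f \<in> N \<Longrightarrow> g \<in> N \<Longrightarrow> f + g \<in> N" "f \<in> N \<Longrightarrow> - f \<in> N"
    "f \<in> N \<Longrightarrow> g \<in> N \<Longrightarrow> f - g \<in> N"
proof -
  show z: "0 \<in> N" using subgroup.one_closed[OF N_subgroup] by simp
  show p: "f \<in> N \<Longrightarrow> g \<in> N \<Longrightarrow> f + g \<in> N" for f g
    using subgroup.m_closed[OF N_subgroup, of f g] by simp
  show m: "f \<in> N \<Longrightarrow> - f \<in> N" for f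
    using subgroup.m_inv_closed[OF N_subgroup, of f] N_closed[of f] by simp
  show "f \<in> N \<Longrightarrow> g \<in> N \<Longrightarrow> f - g \<in> N"
    using p[of f "-g"] m[of g] by simp
qed

lemma relation_in_N: "r \<in> tensor_relations A e T \<Longrightarrow> r \<in> N"
  by (rule generate.incl)

lemma tensor_add_right: "x \<in> Ae \<Longrightarrow> t \<in> carrier T \<Longrightarrow> u \<in> carrier T \<Longrightarrow>
    frag_of (x, t \<oplus>\<^bsub>T\<^esub> u) - frag_of (x, t) - frag_of (x, u) \<in> N"
  by (rule relation_in_N) (auto simp: tensor_relations_def)
lemma tensor_balanced: "x \<in> Ae \<Longrightarrow> b \<in> eAe \<Longrightarrow> t \<in> carrier T \<Longrightarrow>
    frag_of (x \<otimes> b, t) - frag_of (x, b \<odot>\<^bsub>T\<^esub> t) \<in> N"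
  by (rule relation_in_N) (auto simp: tensor_relations_def)

lemma cls_eq: 
  assumes "f \<in> carrier F" "g \<in> carrier F"
  shows "cls f = cls g \<longleftrightarrow> f - g \<in> N"
proof -
  have "cls f = cls g \<longleftrightarrow> f \<in> cls g"
    using F.repr_independence[OF _ _ N_subgroup] F.rcos_self[OF assms(1) N_subgroup] assms by metis
  also have "\<dots> \<longleftrightarrow> f - g \<in> N"
    unfolding r_coset_def by (auto intro!: bexI[of _ "f - g"])
  finally show ?thesis .
qed

lemma N_normal: "N \<lhd> F"
  by (rule F.subgroup_imp_normal[OF N_subgroup])

lemma act_closed: "a \<in> carrier A \<Longrightarrow> f \<in> carrier F \<Longrightarrow> act a f \<in> carrier F"
proof -
  assume a: "a \<in> carrier A" and f: "f \<in> carrier F"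
  have "Poly_Mapping.keys (act a f) \<subseteq> (\<Union>p\<in>Poly_Mapping.keys f. Poly_Mapping.keys ((\<lambda>(x, t). frag_of (a \<otimes> x, t)) p))"
    by (rule keys_frag_extend)
  also have "\<dots> \<subseteq> Ae \<times> carrier T"
    using a f by (auto simp: Ae_left)
  finally show ?thesis by simp
qed

lemma act_N:
  assumes a: "a \<in> carrier A" and "f \<in> N"
  shows "act a f \<in> N"
proof -
  have "subgroup {f \<in> carrier F. act a f \<in> N} F"
  proof (rule F.subgroupI)
    show "{f \<in> carrier F. act a f \<in> N} \<subseteq> carrier F" by blast
    show "{f \<in> carrier F. act a f \<in> N} \<noteq> {}"
      using N_ops(1) by (auto intro!: exI[of _ 0])
    show "inv\<^bsub>F\<^esub> f \<in> {f \<in> carrier F. act a f \<in> N}" if "f \<in> {f \<in> carrier F. act a f \<in> N}" for f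
      using that N_ops(3) by (simp add: frag_extend_minus)
    show "f \<otimes>\<^bsub>F\<^esub> g \<in> {f \<in> carrier F. act a f \<in> N}"
      if "f \<in> {f \<in> carrier F. act a f \<in> N}" "g \<in> {f \<in> carrier F. act a f \<in> N}" for f g
      using that N_ops(2) F.m_closed[of f g] by (simp add: frag_extend_add)
  qed
  moreover have "tensor_relations A e T \<subseteq> {f \<in> carrier F. act a f \<in> N}"
  proof
    fix r assume r: "r \<in> tensor_relations A e T"
    have "act a r \<in> tensor_relations A e T"
      using r a Ae_left[OF a] unfolding tensor_relations_def Un_iff mem_Collect_eq
      apply (elim disjE exE conjE)
      subgoal for x y t
        by (rule disjI1, rule disjI1, rule exI[of _ "a \<otimes> x"], rule exI[of _ "a \<otimes> y"], rule exI[of _ t])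
           (simp add: frag_extend_diff r_distr Ae_closed)
      subgoal for x t u
        by (rule disjI1, rule disjI2, rule exI[of _ "a \<otimes> x"], rule exI[of _ "t"], rule exI[of _ u])
           (simp add: frag_extend_diff)
      subgoal for x b t
        by (rule disjI2, rule exI[of _ "a \<otimes> x"], rule exI[of _ b], rule exI[of _ t])
           (simp add: frag_extend_diff m_assoc Ae_closed eAe_closed)
      done
    then show "r \<in> {f \<in> carrier F. act a f \<in> N}"
      using relation_in_N relations_closed r by blast
  qed
  ultimately have "N \<subseteq> {f \<in> carrier F. act a f \<in> N}"
    by (rule F.generate_subgroup_incl[rotated])
  then show ?thesis using \<open>f \<in> N\<close> by blast
qed

lemma act_mult:
  assumes "a \<in> carrier A" "b \<in> carrier A" "f \<in> carrier F"
  shows "act (a \<otimes> b) f = act a (act b f)"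
proof -
  have "Poly_Mapping.keys f \<subseteq> Ae \<times> carrier T" using assms by simp
  then show ?thesis
    by (induction f rule: free_Abelian_group_induct[consumes 1, case_names zero diff gen])
      (use assms in \<open>auto simp: frag_extend_diff m_assoc Ae_closed\<close>)
qed

lemma M_carrier: "carrier M = cls ` carrier F"
  by (simp add: tensor_module_def Let_def carrier_FactGroup)

lemma M_zero: "\<zero>\<^bsub>M\<^esub> = N" "N = cls 0"
   apply (simp add: tensor_module_def Let_def)
  using F.coset_mult_one[OF subgroup.subset[OF N_subgroup]] by simp

lemma M_add: "f \<in> carrier F \<Longrightarrow> g \<in> carrier F \<Longrightarrow> cls f \<oplus>\<^bsub>M\<^esub> cls g = cls (f + g)"
  using normal.rcos_sum[OF N_normal, of f g] by (simp add: tensor_module_def Let_def)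

lemma M_smult: 
  assumes a: "a \<in> carrier A" and f: "f \<in> carrier F"
  shows "a \<odot>\<^bsub>M\<^esub> cls f = cls (act a f)"
proof -
  have "cls (act a g) = cls (act a f)" if "g \<in> cls f" for g
  proof -
    have g: "g - f \<in> N" using that unfolding r_coset_def by auto
    have gF: "g \<in> carrier F"
      using F.r_coset_subset_G[OF subgroup.subset[OF N_subgroup] f] that by blast
    then show ?thesis
      using act_N[OF a g] cls_eq[of "act a g" "act a f"] act_closed a f by (simp add: frag_extend_diff)
  qed
  moreover have "f \<in> cls f" by (rule F.rcos_self[OF f N_subgroup])
  ultimately have "(\<Union>g\<in>cls f. cls (act a g)) = cls (act a f)" by blast
  then show ?thesis by (simp add: tensor_module_def Let_def)
qed

lemma M_group:
  "carrier M = carrier (F Mod N)" "add M = monoid.mult (F Mod N)" "\<zero>\<^bsub>M\<^esub> = \<one>\<^bsub>F Mod N\<^esub>"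
  by (auto simp: tensor_module_def Let_def)

sublocale M: abelian_group M
proof -
  interpret FN: comm_group "F Mod N"
    by (rule F.abelian_FactGroup[OF N_subgroup])
  show "abelian_group M"
  proof (rule abelian_groupI, unfold M_group)
    show "\<exists>y\<in>carrier (F Mod N). y \<otimes>\<^bsub>F Mod N\<^esub> x = \<one>\<^bsub>F Mod N\<^esub>" if "x \<in> carrier (F Mod N)" for x
      using FN.l_inv[OF that] FN.inv_closed[OF that] by blast
  qed (assumption | rule FN.m_closed FN.one_closed FN.m_assoc FN.m_comm FN.l_one)+
qed

text \<open>The map \<open>x \<otimes> t \<mapsto> (ex)t\<close> on representatives. It is additive, and it identifies \<open>eM\<close> with \<open>T\<close>. A
  choice operator is needed because a homomorphism on a free abelian group is given by its
  values on the generators only.\<close>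

definition Psi :: "(('a \<times> 't) \<Rightarrow>\<^sub>0 int) \<Rightarrow> 't" where
  "Psi = (SOME h. h \<in> hom F (add_monoid T) \<and> (\<forall>(x, t) \<in> Ae \<times> carrier T. h (frag_of (x, t)) = (e \<otimes> x) \<odot>\<^bsub>T\<^esub> t))"

lemma Psi: "Psi \<in> hom F (add_monoid T)"
   and Psi_of: "x \<in> Ae \<Longrightarrow> t \<in> carrier T \<Longrightarrow> Psi (frag_of (x, t)) = (e \<otimes> x) \<odot>\<^bsub>T\<^esub> t"
proof -
  let ?f = "\<lambda>(x, t). (e \<otimes> x) \<odot>\<^bsub>T\<^esub> t"
  have "?f ` (Ae \<times> carrier T) \<subseteq> carrier (add_monoid T)"
    using T_smult[OF e_Ae] by auto
  then obtain h where h: "h \<in> hom F (add_monoid T)" "\<And>p. p \<in> Ae \<times> carrier T \<Longrightarrow> h (frag_of p) = ?f p"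
    by (rule comm_group.free_Abelian_group_universal[OF T.M.a_comm_group]) (rule that, assumption+)
  have "h \<in> hom F (add_monoid T) \<and> (\<forall>(x, t) \<in> Ae \<times> carrier T. h (frag_of (x, t)) = (e \<otimes> x) \<odot>\<^bsub>T\<^esub> t)"
    using h by simp
  then have "\<exists>h. h \<in> hom F (add_monoid T) \<and> (\<forall>(x, t) \<in> Ae \<times> carrier T. h (frag_of (x, t)) = (e \<otimes> x) \<odot>\<^bsub>T\<^esub> t)"
    by blast
  from someI_ex[OF this, folded Psi_def]
  have *: "Psi \<in> hom F (add_monoid T)" "\<forall>(x, t) \<in> Ae \<times> carrier T. Psi (frag_of (x, t)) = (e \<otimes> x) \<odot>\<^bsub>T\<^esub> t"
    by blast+
  show "Psi \<in> hom F (add_monoid T)" by (rule *)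
  show "Psi (frag_of (x, t)) = (e \<otimes> x) \<odot>\<^bsub>T\<^esub> t" if "x \<in> Ae" "t \<in> carrier T"
    using *(2) that by blast
qed

sublocale Psi: group_hom F "add_monoid T" Psi
  by (intro group_hom.intro group_hom_axioms.intro Psi T.M.a_group) auto

lemma Psi_closed [simp]: "f \<in> carrier F \<Longrightarrow> Psi f \<in> carrier T"
  using Psi.hom_closed by simp

lemma Psi_0: "Psi 0 = \<zero>\<^bsub>T\<^esub>" using Psi.hom_one by simp
lemma Psi_add: "f \<in> carrier F \<Longrightarrow> g \<in> carrier F \<Longrightarrow> Psi (f + g) = Psi f \<oplus>\<^bsub>T\<^esub> Psi g"
  using Psi.hom_mult[of f g] by simp
lemma Psi_minus: "f \<in> carrier F \<Longrightarrow> Psi (- f) = \<ominus>\<^bsub>T\<^esub> Psi f"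
  using Psi.hom_inv[of f] by (simp add: a_inv_def)
lemma Psi_diff: "f \<in> carrier F \<Longrightarrow> g \<in> carrier F \<Longrightarrow> Psi (f - g) = Psi f \<ominus>\<^bsub>T\<^esub> Psi g"
  using Psi_add[of f "-g"] Psi_minus[of g] by (simp add: a_minus_def)

lemma Psi_N: assumes "f \<in> N" shows "Psi f = \<zero>\<^bsub>T\<^esub>"
proof -
  have "subgroup (kernel F (add_monoid T) Psi) F" by (rule Psi.subgroup_kernel)
  moreover have "tensor_relations A e T \<subseteq> kernel F (add_monoid T) Psi"
  proof
    fix r assume r: "r \<in> tensor_relations A e T"
    have zero: "(t \<ominus>\<^bsub>T\<^esub> u) = \<zero>\<^bsub>T\<^esub>" if "t = u" "u \<in> carrier T" for t u
      using that by (simp add: a_minus_def T.M.r_neg)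
    have sub: "(t \<ominus>\<^bsub>T\<^esub> u) \<ominus>\<^bsub>T\<^esub> v = \<zero>\<^bsub>T\<^esub>" if "t = u \<oplus>\<^bsub>T\<^esub> v" "u \<in> carrier T" "v \<in> carrier T" for t u v
    proof -
      have "u \<oplus>\<^bsub>T\<^esub> v \<ominus>\<^bsub>T\<^esub> u = v"
        using that(2,3) T.M.a_comm[of u v] by (simp add: a_minus_def T.M.a_assoc T.M.r_neg)
      then show ?thesis using that by (simp add: a_minus_def T.M.r_neg)
    qed
    have xb: "x \<otimes> b \<in> Ae" if "x \<in> Ae" "b \<in> eAe" for x b
      using that Ae_left Ae_closed eAe_Ae by blast
    have d: "Poly_Mapping.keys (frag_of p - frag_of q) \<subseteq> Ae \<times> carrier T" if "p \<in> Ae \<times> carrier T" "q \<in> Ae \<times> carrier T" for p q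
      using that keys_diff[of "frag_of p" "frag_of q"] by auto
    have sm1: "(x \<oplus> y) \<odot>\<^bsub>T\<^esub> t = x \<odot>\<^bsub>T\<^esub> t \<oplus>\<^bsub>T\<^esub> y \<odot>\<^bsub>T\<^esub> t" if "x \<in> eAe" "y \<in> eAe" "t \<in> carrier T" for x y t
      using T.smult_l_distr[OF that] by simp
    have sm2: "(x \<otimes> y) \<odot>\<^bsub>T\<^esub> t = x \<odot>\<^bsub>T\<^esub> (y \<odot>\<^bsub>T\<^esub> t)" if "x \<in> eAe" "y \<in> eAe" "t \<in> carrier T" for x y t
      using T.smult_assoc[OF that] by simp
    have "Psi r = \<zero>\<^bsub>T\<^esub>"
      using r unfolding tensor_relations_def Un_iff mem_Collect_eq
      apply (elim disjE exE conjE)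
      subgoal for x y t
        by (simp add: Psi_diff d Psi_of Ae_add r_distr e_closed Ae_closed sm1 e_Ae sub)
      subgoal for x t u
        by (simp add: Psi_diff d Psi_of T.smult_r_distr e_Ae sub)
      subgoal for x b t
        by (simp add: Psi_diff d Psi_of xb m_assoc[symmetric] e_closed Ae_closed eAe_closed sm2 e_Ae zero)
      done
    then show "r \<in> kernel F (add_monoid T) Psi"
      using subsetD[OF relations_closed r] by (simp add: kernel_def)
  qed
  ultimately have "N \<subseteq> kernel F (add_monoid T) Psi"
    by (rule F.generate_subgroup_incl[rotated])
  then show ?thesis using assms by (auto simp: kernel_def)
qed

text \<open>This is \<open>eM = e \<otimes> T\<close>: as \<open>ex\<close> lies in \<open>eAe\<close> for \<open>x\<close> in \<open>Ae\<close>, one has \<open>e(x \<otimes> t) = ex \<otimes> t = e \<otimes>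
  (ex)t\<close>.\<close>

lemma cls_act_e:
  assumes "f \<in> carrier F"
  shows "cls (act e f) = cls (frag_of (e, Psi f))"
proof -
  have "Poly_Mapping.keys f \<subseteq> Ae \<times> carrier T" using assms by simp
  then have "act e f - frag_of (e, Psi f) \<in> N"
  proof (induction f rule: free_Abelian_group_induct[consumes 1, case_names zero diff gen])
    case zero
    have "frag_of (e, \<zero>\<^bsub>T\<^esub> \<oplus>\<^bsub>T\<^esub> \<zero>\<^bsub>T\<^esub>) - frag_of (e, \<zero>\<^bsub>T\<^esub>) - frag_of (e, \<zero>\<^bsub>T\<^esub>) \<in> N"
      by (rule tensor_add_right) (auto simp: e_in)
    then show ?case by (simp add: Psi_0)
  next
    case (diff f g)
    let ?t = "Psi f \<ominus>\<^bsub>T\<^esub> Psi g" and ?u = "Psi g"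
    have fg: "Psi f \<in> carrier T" "Psi g \<in> carrier T" using diff by auto
    have "frag_of (e, ?t \<oplus>\<^bsub>T\<^esub> ?u) - frag_of (e, ?t) - frag_of (e, ?u) \<in> N"
      by (rule tensor_add_right) (use fg e_in in auto)
    moreover have "?t \<oplus>\<^bsub>T\<^esub> ?u = Psi f" 
      using fg by (simp add: a_minus_def T.M.a_assoc T.M.l_neg)
    ultimately have "frag_of (e, Psi f) - frag_of (e, ?t) - frag_of (e, ?u) \<in> N" by simp
    from N_ops(2)[OF N_ops(4)[OF diff(3,4)] this] 
    have "act e f - act e g - frag_of (e, ?t) \<in> N" by (simp add: algebra_simps)
    then show ?case using diff by (simp add: frag_extend_diff Psi_diff)
  next
    case (gen p)
    obtain x t where p: "p = (x, t)" "x \<in> Ae" "t \<in> carrier T" using gen by auto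
    have "e \<otimes> (e \<otimes> x) = e \<otimes> x" using p eAe_e(2)[OF e_Ae] by blast
    then show ?case using tensor_balanced[OF e_in(1) e_Ae[OF p(2)] p(3)] p by (simp add: Psi_of)
  qed
  then show ?thesis
    using cls_eq[OF act_closed[OF e_closed assms], of "frag_of (e, Psi f)"] assms e_in by simp
qed

text \<open>The submodule of all \<open>m\<close> with \<open>eAm = 0\<close>, which turns out to be the radical.\<close>

definition M0 where "M0 = cls ` {f \<in> carrier F. \<forall>a \<in> carrier A. Psi (act a f) = \<zero>\<^bsub>T\<^esub>}"

lemma Psi_act_cong:
  assumes "f \<in> carrier F" "g \<in> carrier F" "cls f = cls g" "a \<in> carrier A"
  shows "Psi (act a f) = Psi (act a g)"
proof -
  have "act a (f - g) \<in> N" using cls_eq assms act_N by blast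
  then have "Psi (act a f) \<ominus>\<^bsub>T\<^esub> Psi (act a g) = \<zero>\<^bsub>T\<^esub>"
    using Psi_N[of "act a f - act a g"] Psi_diff[of "act a f" "act a g"] act_closed assms by (simp add: frag_extend_diff)
  then have "Psi (act a f) \<ominus>\<^bsub>T\<^esub> Psi (act a g) \<oplus>\<^bsub>T\<^esub> Psi (act a g) = \<zero>\<^bsub>T\<^esub> \<oplus>\<^bsub>T\<^esub> Psi (act a g)"
    by simp
  then show ?thesis
    using Psi_closed[OF act_closed] assms by (simp add: a_minus_def T.M.a_assoc T.M.l_neg)
qed

lemma cls_in_M0:
  assumes "f \<in> carrier F"
  shows "cls f \<in> M0 \<longleftrightarrow> (\<forall>a \<in> carrier A. Psi (act a f) = \<zero>\<^bsub>T\<^esub>)"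
proof
  assume "cls f \<in> M0"
  then obtain g where "g \<in> carrier F" "cls f = cls g" "\<forall>a \<in> carrier A. Psi (act a g) = \<zero>\<^bsub>T\<^esub>"
    by (auto simp: M0_def)
  then show "\<forall>a \<in> carrier A. Psi (act a f) = \<zero>\<^bsub>T\<^esub>"
    using Psi_act_cong[OF assms] by force
qed (use assms in \<open>auto simp: M0_def\<close>)

lemma M_inv: "f \<in> carrier F \<Longrightarrow> inv\<^bsub>add_monoid M\<^esub> (cls f) = cls (- f)"
  using M.add.inv_equality[of "cls (- f)" "cls f"] M_add[of "- f" f] M_zero M_carrier
  by (simp add: a_inv_def)

lemma M0_submodule: "submodule M0 A M"
proof (intro submodule.intro submodule_axioms.intro group.subgroupI[OF M.a_group])
  show "M0 \<subseteq> carrier (add_monoid M)" using M_carrier by (auto simp: M0_def)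
  have "cls 0 \<in> M0" by (subst cls_in_M0) (auto simp: Psi_0)
  then show "M0 \<noteq> {}" by blast
  show "inv\<^bsub>add_monoid M\<^esub> X \<in> M0" if "X \<in> M0" for X
    using that by (auto simp: M0_def M_inv frag_extend_minus Psi_minus act_closed simp del: carrier_free_Abelian_group_iff
       intro!: imageI) (auto simp: frag_extend_minus Psi_minus act_closed)
  show "X \<otimes>\<^bsub>add_monoid M\<^esub> Y \<in> M0" if XY: "X \<in> M0" "Y \<in> M0" for X Y
  proof -
    obtain f g where fg: "f \<in> carrier F" "g \<in> carrier F" "X = cls f" "Y = cls g" 
      using XY by (auto simp: M0_def)
    have "f + g \<in> carrier F" using F.m_closed[of f g] fg by simp
    then show ?thesis using XY fg
      by (simp del: carrier_free_Abelian_group_iff add: M_add cls_in_M0 frag_extend_add Psi_add act_closed)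
  qed
  show "a \<odot>\<^bsub>M\<^esub> X \<in> M0" if aX: "a \<in> carrier A" "X \<in> M0" for a X
  proof -
    obtain f where f: "f \<in> carrier F" "X = cls f" "\<forall>a \<in> carrier A. Psi (act a f) = \<zero>\<^bsub>T\<^esub>"
      using aX by (auto simp: M0_def)
    have "\<forall>b \<in> carrier A. Psi (act b (act a f)) = \<zero>\<^bsub>T\<^esub>"
      using f aX act_mult by (metis m_closed)
    then show ?thesis
      using f aX(1) by (simp del: carrier_free_Abelian_group_iff add: M_smult cls_in_M0 act_closed)
  qed
qed

text \<open>A submodule that is not contained in \<open>M0\<close> contains some \<open>e \<otimes> t\<close> with \<open>t \<noteq> 0\<close>. Since \<open>T\<close> is
  simple, it contains all of \<open>e \<otimes> T\<close>, which generates \<open>M\<close>.\<close>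

lemma proper_submodule_le:
  assumes N': "submodule N' A M" and neq: "N' \<noteq> carrier M"
  shows "N' \<subseteq> M0"
proof (rule ccontr)
  interpret N': submodule N' A M by (rule N')
  assume "\<not> N' \<subseteq> M0"
  then obtain X where X: "X \<in> N'" "X \<notin> M0" by blast
  then obtain f where f: "f \<in> carrier F" "X = cls f" using N'.subset M_carrier by auto
  then obtain a where a: "a \<in> carrier A" "Psi (act a f) \<noteq> \<zero>\<^bsub>T\<^esub>" using X cls_in_M0 by blast
  define U where "U = {t \<in> carrier T. cls (frag_of (e, t)) \<in> N'}"
  have fe: "frag_of (e, t) \<in> carrier F" if "t \<in> carrier T" for t using that e_in by simp
  have "submodule U (corner_ring A e) T"
  proof (rule T.submodule_criterion)
    show "U \<subseteq> carrier T" by (auto simp: U_def)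
    have "cls (frag_of (e, \<zero>\<^bsub>T\<^esub>)) = cls 0"
      using cls_act_e[of 0] by (simp add: Psi_0)
    then have "\<zero>\<^bsub>T\<^esub> \<in> U" using N'.one_closed M_zero by (simp add: U_def)
    then show "U \<noteq> {}" by blast
    show "t \<oplus>\<^bsub>T\<^esub> u \<in> U" if "t \<in> U" "u \<in> U" for t u
    proof -
      have tu: "t \<in> carrier T" "u \<in> carrier T" "cls (frag_of (e, t)) \<in> N'" "cls (frag_of (e, u)) \<in> N'"
        using that by (auto simp: U_def)
      have "cls (frag_of (e, t)) \<oplus>\<^bsub>M\<^esub> cls (frag_of (e, u)) \<in> N'"
        using N'.m_closed[OF tu(3,4)] by simp
      also have "cls (frag_of (e, t)) \<oplus>\<^bsub>M\<^esub> cls (frag_of (e, u)) = cls (frag_of (e, t) + frag_of (e, u))"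
        by (rule M_add) (use tu fe in auto)
      also have "\<dots> = cls (frag_of (e, t \<oplus>\<^bsub>T\<^esub> u))"
        using N_ops(3)[OF tensor_add_right[OF e_in(1) tu(1,2)]] 
        by (subst cls_eq) (use tu fe F.m_closed[OF fe fe] in \<open>auto simp: algebra_simps e_in\<close>)
      finally show ?thesis using tu by (simp add: U_def)
    qed
    show "b \<odot>\<^bsub>T\<^esub> t \<in> U" if b: "b \<in> eAe" and "t \<in> U" for b t
    proof -
      have t: "t \<in> carrier T" "cls (frag_of (e, t)) \<in> N'" using \<open>t \<in> U\<close> by (auto simp: U_def)
      have "b \<odot>\<^bsub>M\<^esub> cls (frag_of (e, t)) \<in> N'" using t(2) eAe_closed[OF b] by blast
      also have "b \<odot>\<^bsub>M\<^esub> cls (frag_of (e, t)) = cls (frag_of (e \<otimes> b, t))"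
        using M_smult[OF eAe_closed[OF b] fe[OF t(1)]] eAe_e[OF b] by simp
      also have "\<dots> = cls (frag_of (e, b \<odot>\<^bsub>T\<^esub> t))"
        using tensor_balanced[OF e_in(1) b t(1)] fe[of "b \<odot>\<^bsub>T\<^esub> t"] b t(1) eAe_e[OF b] eAe_Ae[OF b] by (subst cls_eq) auto
      finally show ?thesis using b t by (simp add: U_def)
    qed
  qed
  moreover have "Psi (act a f) \<in> U"
  proof -
    have "e \<odot>\<^bsub>M\<^esub> (a \<odot>\<^bsub>M\<^esub> cls f) \<in> N'" using X f e_closed a by blast
    then show ?thesis 
      using f a e_closed by (simp add: M_smult act_closed cls_act_e U_def del: carrier_free_Abelian_group_iff)
  qed
  ultimately have "U = carrier T" using simple a(2) unfolding simple_module_def by blast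
  have gen: "cls (frag_of p) \<in> N'" if pp: "p \<in> Ae \<times> carrier T" for p
  proof -
    obtain x t where p: "p = (x, t)" "x \<in> Ae" "t \<in> carrier T" using pp by auto
    have "x \<odot>\<^bsub>M\<^esub> cls (frag_of (e, t)) \<in> N'" 
      using p \<open>U = carrier T\<close> Ae_closed[OF p(2)] by (auto simp: U_def)
    then show ?thesis using M_smult[OF Ae_closed[OF p(2)] fe[OF p(3)]] p Ae_e by simp
  qed
  have "cls g \<in> N'" if "Poly_Mapping.keys g \<subseteq> Ae \<times> carrier T" for g
    using that
  proof (induction g rule: free_Abelian_group_induct[consumes 1, case_names zero diff gen])
    case zero then show ?case using N'.one_closed M_zero by simp
  next
    case (diff f g)
    have "cls (- g) \<in> N'" using N'.m_inv_closed[OF diff(4)] M_inv diff by simp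
    from N'.m_closed[OF diff(3) this] show ?case using M_add[of f "-g"] diff by simp
  qed (use gen in auto)
  then have "carrier M \<subseteq> N'" using M_carrier by auto
  then show False using neq N'.subset by auto
qed

lemma M0_proper: "M0 \<noteq> carrier M"
proof -
  obtain t where t: "t \<in> carrier T" "t \<noteq> \<zero>\<^bsub>T\<^esub>"
    using simple T.M.zero_closed unfolding simple_module_def by blast
  have f: "frag_of (e, t) \<in> carrier F" using t e_in by simp
  have "Psi (act e (frag_of (e, t))) = t" 
    using t e_in T.smult_one by (simp add: Psi_of e_idem)
  then have "cls (frag_of (e, t)) \<notin> M0" using f cls_in_M0 t e_closed by metis
  then show ?thesis using f M_carrier by blast
qed

lemma Rad_eq: "Rad A M = M0"
proof -
  have "maximal_submodule N' A M \<longleftrightarrow> N' = M0" for N'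
    using M0_submodule M0_proper proper_submodule_le unfolding maximal_submodule_def by blast
  then show ?thesis 
    using subgroup.subset[OF submodule.axioms(1)[OF M0_submodule]] by (auto simp: Rad_def)
qed

text \<open>Modulo the radical, \<open>cm\<close> vanishes if and only if \<open>eacm = 0\<close> for all \<open>a\<close>. On a generator \<open>m = x
  \<otimes> t\<close> the element \<open>eacm\<close> corresponds to \<open>(eacx)t\<close>.\<close>

theorem head_smult_nonzero_iff:
  assumes c: "c \<in> carrier A"
  shows "(\<lambda>s. c \<odot>\<^bsub>Hd A M\<^esub> s) ` carrier (Hd A M) \<noteq> {\<zero>\<^bsub>Hd A M\<^esub>} \<longleftrightarrow>
    (\<exists>a \<in> carrier A. \<exists>x \<in> carrier A. \<exists>t \<in> carrier T. (e \<otimes> (a \<otimes> (c \<otimes> (x \<otimes> e)))) \<odot>\<^bsub>T\<^esub> t \<noteq> \<zero>\<^bsub>T\<^esub>)"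
proof -
  interpret M0: submodule M0 A M by (rule M0_submodule)
  have sg: "subgroup M0 (add_monoid M)" ..
  have coset_eq: "M0 +>\<^bsub>M\<^esub> m = M0 +>\<^bsub>M\<^esub> m'" if "m \<in> M0 +>\<^bsub>M\<^esub> m'" "m' \<in> carrier M" for m m'
    using M.add.repr_independence[OF _ _ sg] that unfolding a_r_coset_def by simp
  have coset_M0: "M0 +>\<^bsub>M\<^esub> m = M0 \<longleftrightarrow> m \<in> M0" if "m \<in> carrier M" for m
    using M.add.coset_join1[OF _ _ sg] M.add.coset_join2[OF _ sg] that unfolding a_r_coset_def by auto
  have fac: "c \<odot>\<^bsub>M\<^esub> m \<in> carrier M" if m: "m \<in> carrier M" for m
  proof -
    obtain f where "f \<in> carrier F" "m = cls f" using m M_carrier by blast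
    then show ?thesis using M_smult[OF c] act_closed[OF c] M_carrier by blast
  qed
  have sm: "c \<odot>\<^bsub>Hd A M\<^esub> (M0 +>\<^bsub>M\<^esub> m) = M0 +>\<^bsub>M\<^esub> (c \<odot>\<^bsub>M\<^esub> m)" if m: "m \<in> carrier M" for m
  proof -
    have "M0 +>\<^bsub>M\<^esub> (c \<odot>\<^bsub>M\<^esub> m') = M0 +>\<^bsub>M\<^esub> (c \<odot>\<^bsub>M\<^esub> m)" if "m' \<in> M0 +>\<^bsub>M\<^esub> m" for m'
    proof -
      obtain n where n: "n \<in> M0" "m' = n \<oplus>\<^bsub>M\<^esub> m" using \<open>m' \<in> M0 +>\<^bsub>M\<^esub> m\<close> by (auto simp: a_r_coset_def')
      obtain f g where fg: "f \<in> carrier F" "g \<in> carrier F" "n = cls f" "m = cls g" 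
        using n m M_carrier by (auto simp: M0_def)
      have "f + g \<in> carrier F" using F.m_closed[of f g] fg by simp
      then have "c \<odot>\<^bsub>M\<^esub> m' = c \<odot>\<^bsub>M\<^esub> n \<oplus>\<^bsub>M\<^esub> c \<odot>\<^bsub>M\<^esub> m"
        using n fg c by (simp del: carrier_free_Abelian_group_iff add: M_add M_smult act_closed frag_extend_add)
      moreover have "c \<odot>\<^bsub>M\<^esub> n \<in> M0" using n c by blast
      ultimately have "c \<odot>\<^bsub>M\<^esub> m' \<in> M0 +>\<^bsub>M\<^esub> (c \<odot>\<^bsub>M\<^esub> m)" by (auto simp: a_r_coset_def')
      then show ?thesis using coset_eq fac m by blast
    qed
    moreover have "m \<in> M0 +>\<^bsub>M\<^esub> m" using M.add.rcos_self[OF m sg] unfolding a_r_coset_def .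
    ultimately have "(\<Union>m'\<in>M0 +>\<^bsub>M\<^esub> m. M0 +>\<^bsub>M\<^esub> (c \<odot>\<^bsub>M\<^esub> m')) = M0 +>\<^bsub>M\<^esub> (c \<odot>\<^bsub>M\<^esub> m)" by blast
    then show ?thesis by (simp add: Hd_def quot_module_def Rad_eq)
  qed
  have car: "carrier (Hd A M) = (\<lambda>m. M0 +>\<^bsub>M\<^esub> m) ` carrier M"
    by (auto simp: Hd_def quot_module_def Rad_eq A_RCOSETS_def')
  have img: "f ` carrier M = {x} \<longleftrightarrow> (\<forall>m \<in> carrier M. f m = x)" for f :: "_ \<Rightarrow> (('a \<times> 't) \<Rightarrow>\<^sub>0 int) set set" and x
    using M.zero_closed by blast
  have z: "\<zero>\<^bsub>Hd A M\<^esub> = M0" by (simp add: Hd_def quot_module_def Rad_eq)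
  have "(\<lambda>s. c \<odot>\<^bsub>Hd A M\<^esub> s) ` carrier (Hd A M) = (\<lambda>m. M0 +>\<^bsub>M\<^esub> (c \<odot>\<^bsub>M\<^esub> m)) ` carrier M"
    unfolding car image_image by (rule image_cong) (simp_all add: sm)
  also have "\<dots> \<noteq> {M0} \<longleftrightarrow> (\<exists>m \<in> carrier M. c \<odot>\<^bsub>M\<^esub> m \<notin> M0)"
    using coset_M0[OF fac] by (simp add: img)
  also have "\<dots> \<longleftrightarrow> (\<exists>f \<in> carrier F. \<exists>a \<in> carrier A. Psi (act (a \<otimes> c) f) \<noteq> \<zero>\<^bsub>T\<^esub>)"
    unfolding M_carrier 
    using c by (auto simp: M_smult cls_in_M0 act_closed act_mult simp del: carrier_free_Abelian_group_iff)
  also have "\<dots> \<longleftrightarrow> (\<exists>p \<in> Ae \<times> carrier T. \<exists>a \<in> carrier A. Psi (act (a \<otimes> c) (frag_of p)) \<noteq> \<zero>\<^bsub>T\<^esub>)" (is "?L \<longleftrightarrow> ?R")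
  proof
    assume ?L
    then obtain f a where f: "f \<in> carrier F" "a \<in> carrier A" "Psi (act (a \<otimes> c) f) \<noteq> \<zero>\<^bsub>T\<^esub>" by blast
    show ?R
    proof (rule ccontr)
      assume nR: "\<not> ?R"
      have "Poly_Mapping.keys f \<subseteq> Ae \<times> carrier T" using f by simp
      then have "Psi (act (a \<otimes> c) f) = \<zero>\<^bsub>T\<^esub>"
      proof (induction f rule: free_Abelian_group_induct[consumes 1, case_names zero diff gen])
        case zero then show ?case by (simp add: Psi_0)
      next
        case (diff f g)
        then have "act (a \<otimes> c) f \<in> carrier F" "act (a \<otimes> c) g \<in> carrier F"
          using act_closed[of "a \<otimes> c"] f(2) c by auto
        then show ?case
          using diff by (simp add: frag_extend_diff Psi_diff a_minus_def del: carrier_free_Abelian_group_iff)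
      qed (use nR f in auto)
      then show False using f by blast
    qed
  next
    assume ?R then show ?L by (metis frag_of_in_free_Abelian_group)
  qed
  also have "\<dots> \<longleftrightarrow> (\<exists>a \<in> carrier A. \<exists>x \<in> Ae. \<exists>t \<in> carrier T. (e \<otimes> (a \<otimes> (c \<otimes> x))) \<odot>\<^bsub>T\<^esub> t \<noteq> \<zero>\<^bsub>T\<^esub>)"
    using c by (auto simp: Psi_of Ae_left m_assoc Ae_closed)
  also have "\<dots> \<longleftrightarrow> (\<exists>a \<in> carrier A. \<exists>x \<in> carrier A. \<exists>t \<in> carrier T. (e \<otimes> (a \<otimes> (c \<otimes> (x \<otimes> e)))) \<odot>\<^bsub>T\<^esub> t \<noteq> \<zero>\<^bsub>T\<^esub>)"
    by (simp add: left_ideal_of_def)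
  finally show ?thesis unfolding z .
qed

end

section \<open>Linear extension and algebras given on a basis\<close>

abbreviation scl :: "'r::field \<Rightarrow> ('a \<Rightarrow>\<^sub>0 'r) \<Rightarrow> ('a \<Rightarrow>\<^sub>0 'r)" where
  "scl c \<equiv> Poly_Mapping.map ((*) c)"

abbreviation lk :: "('a \<Rightarrow>\<^sub>0 'r::zero) \<Rightarrow> 'a \<Rightarrow> 'r" where
  "lk \<equiv> Poly_Mapping.lookup"

abbreviation "keys \<equiv> Poly_Mapping.keys"
abbreviation "single \<equiv> Poly_Mapping.single"

lemma lookup_scl [simp]: "lk (scl c p) x = c * lk p x"
  by (simp add: Poly_Mapping.map.rep_eq when_def)

lemma keys_scl: "keys (scl c p) \<subseteq> keys p"
  by (auto simp: in_keys_iff)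

interpretation pm: vector_space "scl :: 'r::field \<Rightarrow> ('a \<Rightarrow>\<^sub>0 'r) \<Rightarrow> ('a \<Rightarrow>\<^sub>0 'r)"
  by unfold_locales (auto intro!: poly_mapping_eqI simp: lookup_add algebra_simps)

lemma scl_single [simp]: "scl c (single x r) = single x (c * r)"
  by (rule poly_mapping_eqI) (simp add: lookup_single when_def)

lemma lookup_linear_ext:
  assumes "finite S" "keys a \<subseteq> S"
  shows "lk (linear_ext f a) y = (\<Sum>x\<in>S. lk a x * lk (f x) y)"
proof -
  have "lk (linear_ext f a) y = (\<Sum>x\<in>keys a. lk a x * lk (f x) y)"
    by (simp add: linear_ext_def lookup_sum)
  also have "\<dots> = (\<Sum>x\<in>S. lk a x * lk (f x) y)"
    by (rule sum.mono_neutral_left) (use assms in \<open>auto simp: in_keys_iff\<close>)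
  finally show ?thesis .
qed

lemma lookup_linear_ext_keys:
  "lk (linear_ext f a) y = (\<Sum>x\<in>keys a. lk a x * lk (f x) y)"
  by (rule lookup_linear_ext) auto

lemma linear_ext_zero [simp]: "linear_ext f 0 = 0"
  by (simp add: linear_ext_def)

lemma linear_ext_single [simp]: "linear_ext f (single x r) = scl r (f x)"
  by (rule poly_mapping_eqI) (simp add: lookup_linear_ext[of "{x}"])

lemma linear_ext_add [simp]: "linear_ext f (a + b) = linear_ext f a + linear_ext f b"
  by (rule poly_mapping_eqI)
    (simp add: lookup_add lookup_linear_ext[of "keys a \<union> keys b"]
      keys_add distrib_right sum.distrib)

lemma linear_ext_scl [simp]: "linear_ext f (scl c a) = scl c (linear_ext f a)"
  by (rule poly_mapping_eqI)
    (simp add: lookup_linear_ext[of "keys a"] keys_scl sum_distrib_left mult.assoc)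

lemma linear_ext_sum: "linear_ext f (\<Sum>i\<in>I. g i) = (\<Sum>i\<in>I. linear_ext f (g i))"
  by (induction I rule: infinite_finite_induct) auto

lemma linear_ext_fun_add: "linear_ext (\<lambda>x. f x + g x) a = linear_ext f a + linear_ext g a"
  by (rule poly_mapping_eqI)
    (simp add: lookup_add lookup_linear_ext_keys distrib_left sum.distrib)

lemma linear_ext_fun_scl: "linear_ext (\<lambda>x. scl c (f x)) a = scl c (linear_ext f a)"
  by (rule poly_mapping_eqI)
    (simp add: lookup_linear_ext_keys sum_distrib_left mult_ac)

lemma linear_ext_fun_zero [simp]: "linear_ext (\<lambda>x. 0) a = 0"
  by (rule poly_mapping_eqI) (simp add: lookup_linear_ext_keys)

lemma linear_ext_fun_sum: "linear_ext (\<lambda>x. \<Sum>i\<in>I. f i x) a = (\<Sum>i\<in>I. linear_ext (f i) a)"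
  by (induction I rule: infinite_finite_induct) (auto simp: linear_ext_fun_add)

lemma linear_ext_cong:
  assumes "\<And>x. x \<in> keys a \<Longrightarrow> f x = g x"
  shows "linear_ext f a = linear_ext g a"
  unfolding linear_ext_def using assms by (intro sum.cong) auto

lemma linear_ext_id [simp]: "linear_ext (\<lambda>x. single x 1) a = a"
proof (rule poly_mapping_eqI)
  fix y
  show "lk (linear_ext (\<lambda>x. single x 1) a) y = lk a y"
    by (simp add: lookup_linear_ext_keys lookup_single when_def in_keys_iff if_distrib cong: if_cong)
qed

lemma linear_ext_comp: "linear_ext f (linear_ext g a) = linear_ext (\<lambda>x. linear_ext f (g x)) a"
  unfolding linear_ext_def[of g a] linear_ext_def[of "\<lambda>x. linear_ext f (g x)" a]
  by (simp add: linear_ext_sum)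

lemma linear_ext_swap: "linear_ext (\<lambda>x. linear_ext (g x) b) a = linear_ext (\<lambda>y. linear_ext (\<lambda>x. g x y) a) b"
  by (rule poly_mapping_eqI)
    (simp add: lookup_linear_ext_keys sum_distrib_left sum.swap[of _ "keys b"] mult_ac)

lemma keys_linear_ext:
  assumes "\<And>x. x \<in> keys a \<Longrightarrow> keys (f x) \<subseteq> X"
  shows "keys (linear_ext f a) \<subseteq> X"
proof -
  have "keys (linear_ext f a) \<subseteq> (\<Union>x\<in>keys a. keys (scl (lk a x) (f x)))"
    unfolding linear_ext_def by (rule keys_sum)
  then show ?thesis using assms keys_scl by fast
qed

lemma expand_pm:
  assumes "finite S" "keys a \<subseteq> S"
  shows "a = (\<Sum>x\<in>S. single x (lk a x))"
  by (rule poly_mapping_eqI)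
    (use assms in \<open>auto simp: lookup_sum lookup_single when_def in_keys_iff\<close>)

lemma based_algebra_simps [simp]:
  "carrier (based_algebra X m u) = {a. keys a \<subseteq> X}"
  "a \<oplus>\<^bsub>based_algebra X m u\<^esub> b = a + b" "\<zero>\<^bsub>based_algebra X m u\<^esub> = 0" "\<one>\<^bsub>based_algebra X m u\<^esub> = u"
  "a \<otimes>\<^bsub>based_algebra X m u\<^esub> b = linear_ext (\<lambda>x. linear_ext (m x) b) a"
  by (simp_all add: based_algebra_def)

lemma keys_add_subset:
  "keys a \<subseteq> X \<Longrightarrow> keys b \<subseteq> X \<Longrightarrow> keys (a + b) \<subseteq> X"
  using keys_add[of a b] by blast

lemma keys_sum_subset:
  "(\<And>i. i \<in> I \<Longrightarrow> keys (g i) \<subseteq> X) \<Longrightarrow> keys (\<Sum>i\<in>I. g i) \<subseteq> X"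
  using keys_sum[of g I] by blast

text \<open>Products are bilinear extensions from the basis \<open>X\<close>, so that associativity and the unit laws
  have to be checked on basis elements only.\<close>

lemma ring_based_algebra:
  fixes m :: "'a \<Rightarrow> 'a \<Rightarrow> ('a \<Rightarrow>\<^sub>0 'r::field)"
  assumes closed: "\<And>x y. x \<in> X \<Longrightarrow> y \<in> X \<Longrightarrow> keys (m x y) \<subseteq> X"
    and unit_closed: "keys u \<subseteq> X"
    and assoc: "\<And>x y z. x \<in> X \<Longrightarrow> y \<in> X \<Longrightarrow> z \<in> X \<Longrightarrow>
      linear_ext (\<lambda>w. m w z) (m x y) = linear_ext (m x) (m y z)"
    and l_unit: "\<And>x. x \<in> X \<Longrightarrow> linear_ext (\<lambda>w. m w x) u = single x 1"
    and r_unit: "\<And>x. x \<in> X \<Longrightarrow> linear_ext (m x) u = single x 1"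
  shows "ring (based_algebra X m u)"
proof (rule ringI)
  let ?A = "based_algebra X m u"
  show "abelian_group ?A"
  proof (rule abelian_groupI)
    show "\<exists>y\<in>carrier ?A. y \<oplus>\<^bsub>?A\<^esub> x = \<zero>\<^bsub>?A\<^esub>" if "x \<in> carrier ?A" for x
      using that by (auto intro!: exI[of _ "- x"] simp: in_keys_iff)
  qed (auto simp: keys_add_subset add.assoc intro: add.commute dest!: subsetD[OF keys_add])
  show "monoid ?A"
  proof (rule monoidI)
    fix a b c assume abc: "a \<in> carrier ?A" "b \<in> carrier ?A" "c \<in> carrier ?A"
    have "linear_ext (\<lambda>w. linear_ext (m w) c) (m x y) = linear_ext (m x) (linear_ext (m y) c)"
      if "x \<in> X" "y \<in> X" for x y
      unfolding linear_ext_swap[of m c "m x y"] linear_ext_comp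
      using assoc[OF that] abc by (intro linear_ext_cong) auto
    then show "a \<otimes>\<^bsub>?A\<^esub> b \<otimes>\<^bsub>?A\<^esub> c = a \<otimes>\<^bsub>?A\<^esub> (b \<otimes>\<^bsub>?A\<^esub> c)"
      using abc by (auto simp: linear_ext_comp intro!: linear_ext_cong)
  next
    fix a assume "a \<in> carrier ?A"
    then show "\<one>\<^bsub>?A\<^esub> \<otimes>\<^bsub>?A\<^esub> a = a" "a \<otimes>\<^bsub>?A\<^esub> \<one>\<^bsub>?A\<^esub> = a"
      using linear_ext_cong[of a "\<lambda>y. linear_ext (\<lambda>x. m x y) u" "\<lambda>x. single x 1"]
        linear_ext_cong[of a "\<lambda>x. linear_ext (m x) u" "\<lambda>x. single x 1"] l_unit r_unit
      by (auto simp: linear_ext_swap[of m])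
  next
    fix a b assume "a \<in> carrier ?A" "b \<in> carrier ?A"
    then show "a \<otimes>\<^bsub>?A\<^esub> b \<in> carrier ?A"
      using closed by (simp, intro keys_linear_ext) blast
  qed (use unit_closed in auto)
qed (auto simp: linear_ext_fun_add)

section \<open>Traces\<close>

text \<open>A field as a ring record, by which vector spaces with a carrier become modules.\<close>

definition scalar_ring :: "'r::field ring" where
  "scalar_ring = \<lparr>carrier = UNIV, mult = (*), one = 1, ring.zero = 0, add = (+)\<rparr>"

lemma scalar_ring_simps [simp]:
  "carrier scalar_ring = UNIV" "x \<otimes>\<^bsub>scalar_ring\<^esub> y = x * y" "\<one>\<^bsub>scalar_ring\<^esub> = 1"
  "\<zero>\<^bsub>scalar_ring\<^esub> = 0" "x \<oplus>\<^bsub>scalar_ring\<^esub> y = x + y"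
  by (simp_all add: scalar_ring_def)

lemma cring_scalar_ring: "cring (scalar_ring :: 'r::field ring)"
proof (rule cringI)
  show "abelian_group (scalar_ring :: 'r ring)"
    by (rule abelian_groupI) (auto simp: algebra_simps intro: exI[of _ "- _"])
  show "comm_monoid (scalar_ring :: 'r ring)"
    by (rule comm_monoidI) (auto simp: algebra_simps)
qed (auto simp: algebra_simps)

locale scalar_module = Module.module scalar_ring V for V :: "('r::field, 't) module" (structure)
begin

abbreviation lc :: "'t set \<Rightarrow> ('t \<Rightarrow> 'r) \<Rightarrow> 't" where
  "lc B c \<equiv> (\<Oplus>\<^bsub>V\<^esub>b\<in>B. c b \<odot>\<^bsub>V\<^esub> b)"

lemma smul_in [simp, intro]: "v \<in> carrier V \<Longrightarrow> (r::'r) \<odot>\<^bsub>V\<^esub> v \<in> carrier V"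
  by (rule smult_closed) simp_all

lemma smul_simps [simp]:
  "v \<in> carrier V \<Longrightarrow> (0::'r) \<odot>\<^bsub>V\<^esub> v = \<zero>\<^bsub>V\<^esub>" "(r::'r) \<odot>\<^bsub>V\<^esub> \<zero>\<^bsub>V\<^esub> = \<zero>\<^bsub>V\<^esub>"
  "v \<in> carrier V \<Longrightarrow> (1::'r) \<odot>\<^bsub>V\<^esub> v = v"
  using smult_l_null[of v] smult_r_null[of r] smult_one[of v] by simp_all

lemma smul_add: "v \<in> carrier V \<Longrightarrow> ((r::'r) + s) \<odot>\<^bsub>V\<^esub> v = r \<odot>\<^bsub>V\<^esub> v \<oplus>\<^bsub>V\<^esub> s \<odot>\<^bsub>V\<^esub> v"
  using smult_l_distr[of r s v] by simp
lemma smul_mult: "v \<in> carrier V \<Longrightarrow> ((r::'r) * s) \<odot>\<^bsub>V\<^esub> v = r \<odot>\<^bsub>V\<^esub> (s \<odot>\<^bsub>V\<^esub> v)"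
  using smult_assoc1[of r s v] by simp
lemma smul_r: "v \<in> carrier V \<Longrightarrow> w \<in> carrier V \<Longrightarrow> (r::'r) \<odot>\<^bsub>V\<^esub> (v \<oplus>\<^bsub>V\<^esub> w) = r \<odot>\<^bsub>V\<^esub> v \<oplus>\<^bsub>V\<^esub> r \<odot>\<^bsub>V\<^esub> w"
  using smult_r_distr[of r v w] by simp

lemma lc_closed [simp]: "B \<subseteq> carrier V \<Longrightarrow> lc B c \<in> carrier V"
  by (rule M.finsum_closed) auto

lemma lc_add: "B \<subseteq> carrier V \<Longrightarrow> lc B (\<lambda>b. c b + d b) = lc B c \<oplus>\<^bsub>V\<^esub> lc B d"
  by (subst M.finsum_addf[symmetric]) (auto simp: smul_add intro!: M.finsum_cong')

lemma lc_smult: "B \<subseteq> carrier V \<Longrightarrow> lc B (\<lambda>b. r * c b) = r \<odot>\<^bsub>V\<^esub> lc B c"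
proof (induction B rule: infinite_finite_induct)
  case (insert b B)
  then show ?case by (simp add: smul_mult smul_r M.finsum_insert Pi_iff subset_iff)
qed (auto simp: M.finsum_infinite)

lemma lc_cong: "B \<subseteq> carrier V \<Longrightarrow> (\<And>b. b \<in> B \<Longrightarrow> c b = d b) \<Longrightarrow> lc B c = lc B d"
  by (rule M.finsum_cong') auto

lemma lc_insert: "finite B \<Longrightarrow> b \<notin> B \<Longrightarrow> insert b B \<subseteq> carrier V \<Longrightarrow> lc (insert b B) c = c b \<odot>\<^bsub>V\<^esub> b \<oplus>\<^bsub>V\<^esub> lc B c"
  by (rule M.finsum_insert) auto

lemma lc_zero: "B \<subseteq> carrier V \<Longrightarrow> lc B (\<lambda>_. 0) = \<zero>\<^bsub>V\<^esub>"
  by (induction B rule: infinite_finite_induct) (auto simp: lc_insert M.finsum_infinite)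

lemma lc_single:
  "finite B \<Longrightarrow> B \<subseteq> carrier V \<Longrightarrow> b \<in> B \<Longrightarrow> lc B (\<lambda>x. if x = b then 1 else 0) = b"
proof -
  assume B: "finite B" "B \<subseteq> carrier V" "b \<in> B"
  then have "lc (insert b (B - {b})) (\<lambda>x. if x = b then 1 else 0) = b \<oplus>\<^bsub>V\<^esub> lc (B - {b}) (\<lambda>x. if x = b then 1 else 0)"
    by (subst lc_insert) auto
  moreover have "lc (B - {b}) (\<lambda>x. if x = b then 1 else 0) = lc (B - {b}) (\<lambda>_. 0)"
    by (rule lc_cong) (use B in auto)
  moreover have "lc (B - {b}) (\<lambda>_. 0) = \<zero>\<^bsub>V\<^esub>" by (rule lc_zero) (use B in auto)
  moreover have "insert b (B - {b}) = B" using B by blast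
  ultimately show ?thesis using B by auto
qed

text \<open>A spanning set of least cardinality is a basis, since a linear relation that involves \<open>b\<close>
  makes \<open>b\<close> dispensable.\<close>

lemma fin_basis_exists:
  assumes "finite S" "S \<subseteq> carrier V" "\<And>v. v \<in> carrier V \<Longrightarrow> \<exists>c. v = lc S c"
  shows "\<exists>B. is_fin_basis V B"
proof -
  let ?P = "\<lambda>S. finite S \<and> S \<subseteq> carrier V \<and> (\<forall>v \<in> carrier V. \<exists>c. v = lc S c)"
  obtain B where B: "?P B" and min: "\<And>B'. ?P B' \<Longrightarrow> card B \<le> card B'"
    using ex_has_least_nat[of ?P S card] assms by blast
  have fin: "finite B" and sub: "B \<subseteq> carrier V" using B by auto
  have "c = c'" if c: "c \<in> extensional B" "c' \<in> extensional B" "lc B c = lc B c'" for c c'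
  proof (rule ccontr)
    assume "c \<noteq> c'"
    then obtain b where b: "b \<in> B" "c b \<noteq> c' b" using c by (meson extensionalityI)
    define d where "d x = c x - c' x" for x
    have cd: "lc B c = lc B c' \<oplus>\<^bsub>V\<^esub> lc B d"
      using lc_add[OF sub, of c' d] by (simp add: d_def)
    have d0: "lc B d = \<zero>\<^bsub>V\<^esub>"
    proof -
      have "lc B d = \<ominus>\<^bsub>V\<^esub> lc B c' \<oplus>\<^bsub>V\<^esub> (lc B c' \<oplus>\<^bsub>V\<^esub> lc B d)"
        using sub by (simp add: M.r_neg1)
      also have "\<dots> = \<zero>\<^bsub>V\<^esub>" unfolding cd[symmetric] c(3) using sub by (simp add: M.l_neg)
      finally show ?thesis .
    qed
    let ?B = "B - {b}"
    have "\<exists>k. v = lc ?B k" if v: "v \<in> carrier V" for v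
    proof -
      obtain k where k: "v = lc B k" using B v by blast
      \<comment> \<open>the multiple of the relation that removes \<open>b\<close> from the expansion of \<open>v\<close>\<close>
      define s where "s = - (k b / d b)"
      have "v = lc B (\<lambda>x. k x + s * d x)"
        using lc_add[OF sub, of k "\<lambda>x. s * d x"] lc_smult[OF sub, of s d] d0 k v by simp
      also have "\<dots> = lc (insert b ?B) (\<lambda>x. k x + s * d x)"
        using b by (simp add: insert_absorb)
      also have "\<dots> = (k b + s * d b) \<odot>\<^bsub>V\<^esub> b \<oplus>\<^bsub>V\<^esub> lc ?B (\<lambda>x. k x + s * d x)"
        by (rule lc_insert) (use fin sub b in auto)
      also have "k b + s * d b = 0" using b by (simp add: s_def d_def)
      also have "0 \<odot>\<^bsub>V\<^esub> b \<oplus>\<^bsub>V\<^esub> lc ?B (\<lambda>x. k x + s * d x) = lc ?B (\<lambda>x. k x + s * d x)"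
      proof -
        have "b \<in> carrier V" "?B \<subseteq> carrier V" using sub b by auto
        then show ?thesis by simp
      qed
      finally show ?thesis by (rule exI[of _ "\<lambda>x. k x + s * d x"])
    qed
    then have "card B \<le> card ?B" using fin sub by (intro min) auto
    then show False using fin b by (metis card_Diff1_less not_le)
  qed
  moreover have "\<exists>c. c \<in> extensional B \<and> v = lc B c" if v: "v \<in> carrier V" for v
  proof -
    obtain c where "v = lc B c" using B v by blast
    then show ?thesis 
      using lc_cong[OF sub, of "restrict c B" c] by (intro exI[of _ "restrict c B"]) auto
  qed
  ultimately have "is_fin_basis V B"
    unfolding is_fin_basis_def using fin sub by (intro conjI ballI ex_ex1I) auto
  then show ?thesis by blast
qed

end

locale fin_vspace = scalar_module V for V :: "('r::field, 't) module" (structure) +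
  assumes has_basis: "\<exists>B. is_fin_basis V B"
begin

text \<open>The basis in terms of which \<^const>\<open>trace_on\<close> is defined.\<close>

definition "Bs = (SOME B. is_fin_basis V B)"

lemma Bs: "is_fin_basis V Bs" "finite Bs" "Bs \<subseteq> carrier V"
proof -
  show "is_fin_basis V Bs" unfolding Bs_def using has_basis by (rule someI_ex)
  then show "finite Bs" "Bs \<subseteq> carrier V" by (auto simp: is_fin_basis_def)
qed

lemma coords: 
  assumes "v \<in> carrier V"
  shows "coords V Bs v \<in> extensional Bs" "lc Bs (coords V Bs v) = v"
proof -
  have "\<exists>!c. c \<in> extensional Bs \<and> v = lc Bs c" using Bs(1) assms by (auto simp: is_fin_basis_def)
  from theI'[OF this] show "coords V Bs v \<in> extensional Bs" "lc Bs (coords V Bs v) = v"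
    unfolding coords_def by auto
qed

lemma coords_lc: assumes "b \<in> Bs" shows "coords V Bs (lc Bs c) b = c b"
proof -
  have "\<exists>!d. d \<in> extensional Bs \<and> lc Bs c = lc Bs d"
    using Bs lc_closed[OF Bs(3), of c] unfolding is_fin_basis_def by blast
  moreover have "restrict c Bs \<in> extensional Bs \<and> lc Bs c = lc Bs (restrict c Bs)"
    using lc_cong[OF Bs(3), of c "restrict c Bs"] by simp
  moreover have "coords V Bs (lc Bs c) \<in> extensional Bs \<and> lc Bs c = lc Bs (coords V Bs (lc Bs c))"
    using coords[OF lc_closed[OF Bs(3), of c]] by simp
  ultimately have "coords V Bs (lc Bs c) = restrict c Bs" by blast
  then show ?thesis using assms by simp
qed

lemma coords_add:
  assumes "v \<in> carrier V" "w \<in> carrier V" "b \<in> Bs"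
  shows "coords V Bs (v \<oplus>\<^bsub>V\<^esub> w) b = coords V Bs v b + coords V Bs w b"
  using coords_lc[OF assms(3), of "\<lambda>b. coords V Bs v b + coords V Bs w b"] lc_add[OF Bs(3)] coords assms by simp

lemma coords_smult:
  assumes "v \<in> carrier V" "b \<in> Bs"
  shows "coords V Bs (r \<odot>\<^bsub>V\<^esub> v) b = r * coords V Bs v b"
  using coords_lc[OF assms(2), of "\<lambda>b. r * coords V Bs v b"] lc_smult[OF Bs(3)] coords assms by simp

lemma coords_basis: "b \<in> Bs \<Longrightarrow> coords V Bs b b = 1"
  using coords_lc[of b "\<lambda>x. if x = b then 1 else 0"] lc_single[OF Bs(2,3), of b] by simp

lemma coords_zero: "b \<in> Bs \<Longrightarrow> coords V Bs \<zero>\<^bsub>V\<^esub> b = 0"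
  using coords_lc[of b "\<lambda>_. 0"] lc_zero[OF Bs(3)] by simp

definition lin :: "('t \<Rightarrow> 't) \<Rightarrow> bool" where
  "lin f \<longleftrightarrow> f \<in> carrier V \<rightarrow> carrier V \<and> (\<forall>v \<in> carrier V. \<forall>w \<in> carrier V. f (v \<oplus>\<^bsub>V\<^esub> w) = f v \<oplus>\<^bsub>V\<^esub> f w) \<and>
    (\<forall>r. \<forall>v \<in> carrier V. f (r \<odot>\<^bsub>V\<^esub> v) = r \<odot>\<^bsub>V\<^esub> f v)"

lemma tr_def: "trace_on V f = (\<Sum>b\<in>Bs. coords V Bs (f b) b)"
  by (simp add: trace_on_def Let_def Bs_def)

lemma tr_cong: "(\<And>v. v \<in> carrier V \<Longrightarrow> f v = g v) \<Longrightarrow> trace_on V f = trace_on V g"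
  unfolding tr_def using Bs(3) by (intro sum.cong) auto

lemma tr_add: 
  "f \<in> carrier V \<rightarrow> carrier V \<Longrightarrow> g \<in> carrier V \<rightarrow> carrier V \<Longrightarrow>
    trace_on V (\<lambda>v. f v \<oplus>\<^bsub>V\<^esub> g v) = trace_on V f + trace_on V g"
  unfolding tr_def sum.distrib[symmetric] using Bs(3) by (intro sum.cong coords_add) auto

lemma tr_smult: "f \<in> carrier V \<rightarrow> carrier V \<Longrightarrow> trace_on V (\<lambda>v. r \<odot>\<^bsub>V\<^esub> f v) = r * trace_on V f"
  unfolding tr_def sum_distrib_left using Bs(3) by (intro sum.cong coords_smult) auto

lemma tr_zero: "trace_on V (\<lambda>v. \<zero>\<^bsub>V\<^esub>) = 0"
  unfolding tr_def by (intro sum.neutral) (auto simp: coords_zero)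

lemma tr_id: "trace_on V (\<lambda>v. v) = of_nat (card Bs)"
  unfolding tr_def by (simp add: coords_basis)

lemma card_Bs: "carrier V \<noteq> {\<zero>\<^bsub>V\<^esub>} \<Longrightarrow> card Bs \<noteq> 0"
proof
  assume V: "carrier V \<noteq> {\<zero>\<^bsub>V\<^esub>}" and "card Bs = 0"
  then have "Bs = {}" using Bs(2) by simp
  then have "v = \<zero>\<^bsub>V\<^esub>" if "v \<in> carrier V" for v using coords(2)[OF that] by simp
  then show False using V M.zero_closed by blast
qed

lemma coords_lin:
  assumes f: "lin f" and "v \<in> carrier V" "b \<in> Bs"
  shows "coords V Bs (f v) b = (\<Sum>x\<in>Bs. coords V Bs v x * coords V Bs (f x) b)"
proof -
  have "coords V Bs (f (lc S c)) b = (\<Sum>x\<in>S. c x * coords V Bs (f x) b)"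
    if "finite S" "S \<subseteq> carrier V" for S c
    using that
  proof (induction S)
    case empty
    have "f (0 \<odot>\<^bsub>V\<^esub> \<zero>\<^bsub>V\<^esub>) = 0 \<odot>\<^bsub>V\<^esub> f \<zero>\<^bsub>V\<^esub>" using f M.zero_closed unfolding lin_def by blast
    moreover have "f \<zero>\<^bsub>V\<^esub> \<in> carrier V" using f unfolding lin_def by blast
    ultimately have "f \<zero>\<^bsub>V\<^esub> = \<zero>\<^bsub>V\<^esub>" by simp
    then show ?case using assms by (simp add: coords_zero)
  next
    case (insert x S)
    have fx: "f x \<in> carrier V" "f (lc S c) \<in> carrier V"
      using f insert lc_closed[of S c] unfolding lin_def by blast+
    have "f (lc (insert x S) c) = c x \<odot>\<^bsub>V\<^esub> f x \<oplus>\<^bsub>V\<^esub> f (lc S c)"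
      using f insert lc_insert[of S x c] lc_closed[of S c] unfolding lin_def by auto
    then show ?case using insert fx assms by (simp add: coords_add coords_smult)
  qed
  from this[OF Bs(2,3), of "coords V Bs v"] show ?thesis using coords(2)[OF assms(2)] by simp
qed

lemma tr_comm:
  assumes f: "lin f" and g: "lin g"
  shows "trace_on V (\<lambda>v. f (g v)) = trace_on V (\<lambda>v. g (f v))"
proof -
  have c: "f b \<in> carrier V" "g b \<in> carrier V" if "b \<in> Bs" for b
    using f g that Bs(3) unfolding lin_def by blast+
  have "trace_on V (\<lambda>v. f (g v)) = (\<Sum>b\<in>Bs. \<Sum>x\<in>Bs. coords V Bs (g b) x * coords V Bs (f x) b)"
    unfolding tr_def by (intro sum.cong coords_lin[OF f] c) auto
  also have "\<dots> = (\<Sum>x\<in>Bs. \<Sum>b\<in>Bs. coords V Bs (f x) b * coords V Bs (g b) x)"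
    by (subst sum.swap) (simp add: mult.commute)
  also have "\<dots> = trace_on V (\<lambda>v. g (f v))"
    unfolding tr_def by (intro sum.cong coords_lin[OF g, symmetric] c) auto
  finally show ?thesis .
qed

end

section \<open>Characters and ideals of a group algebra\<close>

lemma change_scalars_simps [simp]:
  "carrier (change_scalars \<phi> T) = carrier T" "\<zero>\<^bsub>change_scalars \<phi> T\<^esub> = \<zero>\<^bsub>T\<^esub>"
  "x \<oplus>\<^bsub>change_scalars \<phi> T\<^esub> y = x \<oplus>\<^bsub>T\<^esub> y" "b \<odot>\<^bsub>change_scalars \<phi> T\<^esub> t = \<phi> b \<odot>\<^bsub>T\<^esub> t"
  by (simp_all add: change_scalars_def)

lemma abelian_group_change_scalars:
  assumes "abelian_group T"
  shows "abelian_group (change_scalars \<phi> T)"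
proof -
  interpret T: abelian_group T by (rule assms)
  show ?thesis
  proof (rule abelian_groupI)
    fix x assume "x \<in> carrier (change_scalars \<phi> T)"
    then show "\<exists>y\<in>carrier (change_scalars \<phi> T). y \<oplus>\<^bsub>change_scalars \<phi> T\<^esub> x = \<zero>\<^bsub>change_scalars \<phi> T\<^esub>"
      by (auto intro!: bexI[of _ "\<ominus>\<^bsub>T\<^esub> x"] simp: T.l_neg)
  qed (auto simp: T.a_assoc intro: T.a_comm)
qed

lemma group_algebra_simps [simp]:
  "carrier (group_algebra \<Gamma>) = {a. keys a \<subseteq> carrier \<Gamma>}"
  "a \<oplus>\<^bsub>group_algebra \<Gamma>\<^esub> b = a + b" "\<zero>\<^bsub>group_algebra \<Gamma>\<^esub> = 0"
  "\<one>\<^bsub>group_algebra \<Gamma>\<^esub> = single \<one>\<^bsub>\<Gamma>\<^esub> 1"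
  by (simp_all add: group_algebra_def)

lemma group_algebra_mult:
  "a \<otimes>\<^bsub>group_algebra \<Gamma>\<^esub> b = linear_ext (\<lambda>x. linear_ext (\<lambda>y. single (x \<otimes>\<^bsub>\<Gamma>\<^esub> y) 1) b) a"
  by (simp add: group_algebra_def)

lemma single_mult_single [simp]:
  "single x r \<otimes>\<^bsub>group_algebra \<Gamma>\<^esub> single y s = single (x \<otimes>\<^bsub>\<Gamma>\<^esub> y) (r * s)"
  by (simp add: group_algebra_mult)

lemma keys_single_subset: "x \<in> X \<Longrightarrow> keys (single x r) \<subseteq> X"
  by simp

locale simple_rep = group \<Gamma> for \<Gamma> :: "'q monoid" (structure) +
  fixes T :: "('q \<Rightarrow>\<^sub>0 'r::field_char_0, 't) module"
  assumes fin: "finite (carrier \<Gamma>)" and simple: "simple_module (group_algebra \<Gamma>) T"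
begin

abbreviation "RG \<equiv> group_algebra \<Gamma> :: ('q \<Rightarrow>\<^sub>0 'r) ring"
abbreviation "V \<equiv> change_scalars (single \<one>) T :: ('r, 't) module"
abbreviation bas :: "'q \<Rightarrow> ('q \<Rightarrow>\<^sub>0 'r)" where "bas x \<equiv> single x 1"

sublocale T: left_module RG T
  using simple by (simp add: simple_module_def)

lemma act_closed [simp]: "keys a \<subseteq> carrier \<Gamma> \<Longrightarrow> t \<in> carrier T \<Longrightarrow> a \<odot>\<^bsub>T\<^esub> t \<in> carrier T"
  using T.smult_closed by simp

lemma act_add: "keys a \<subseteq> carrier \<Gamma> \<Longrightarrow> keys b \<subseteq> carrier \<Gamma> \<Longrightarrow> t \<in> carrier T \<Longrightarrow>
    (a + b) \<odot>\<^bsub>T\<^esub> t = a \<odot>\<^bsub>T\<^esub> t \<oplus>\<^bsub>T\<^esub> b \<odot>\<^bsub>T\<^esub> t"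
  using T.smult_l_distr[of a b t] by simp

lemma act_mult: "keys a \<subseteq> carrier \<Gamma> \<Longrightarrow> keys b \<subseteq> carrier \<Gamma> \<Longrightarrow> t \<in> carrier T \<Longrightarrow>
    (a \<otimes>\<^bsub>RG\<^esub> b) \<odot>\<^bsub>T\<^esub> t = a \<odot>\<^bsub>T\<^esub> (b \<odot>\<^bsub>T\<^esub> t)"
  using T.smult_assoc[of a b t] by simp

lemma act_zero: "t \<in> carrier T \<Longrightarrow> 0 \<odot>\<^bsub>T\<^esub> t = \<zero>\<^bsub>T\<^esub>"
  using act_add[of 0 0 t] by (metis T.M.add.l_cancel_one' T.M.add.m_closed act_closed add.right_neutral empty_subsetI keys_zero)

lemma scalar_central:
  assumes "keys a \<subseteq> carrier \<Gamma>"
  shows "single \<one> r \<otimes>\<^bsub>RG\<^esub> a = scl r a" "a \<otimes>\<^bsub>RG\<^esub> single \<one> r = scl r a"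
proof -
  have "linear_ext (\<lambda>y. bas (\<one> \<otimes> y)) a = linear_ext bas a"
    by (rule linear_ext_cong) (use assms in auto)
  then show "single \<one> r \<otimes>\<^bsub>RG\<^esub> a = scl r a" by (simp add: group_algebra_mult)
  have "linear_ext (\<lambda>x. scl r (bas (x \<otimes> \<one>))) a = linear_ext (\<lambda>x. scl r (bas x)) a"
    by (rule linear_ext_cong) (use assms in auto)
  also have "\<dots> = scl r a" unfolding linear_ext_fun_scl by simp
  finally show "a \<otimes>\<^bsub>RG\<^esub> single \<one> r = scl r a" by (simp add: group_algebra_mult)
qed

lemma act_scl: "keys a \<subseteq> carrier \<Gamma> \<Longrightarrow> t \<in> carrier T \<Longrightarrow>
    scl r a \<odot>\<^bsub>T\<^esub> t = r \<odot>\<^bsub>V\<^esub> (a \<odot>\<^bsub>T\<^esub> t)"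
  using act_mult[of "single \<one> r" a t] scalar_central(1)[of a r] by simp

sublocale V: scalar_module V
proof (intro scalar_module.intro module.intro Module.module.intro cring_scalar_ring abelian_group_change_scalars T.M.abelian_group_axioms)
  show "module_axioms scalar_ring V"
  proof
    fix r s :: 'r and t u
    assume t: "t \<in> carrier V" and u: "u \<in> carrier V"
    show "(r \<oplus>\<^bsub>scalar_ring\<^esub> s) \<odot>\<^bsub>V\<^esub> t = r \<odot>\<^bsub>V\<^esub> t \<oplus>\<^bsub>V\<^esub> s \<odot>\<^bsub>V\<^esub> t"
      using t act_add[of "single \<one> r" "single \<one> s" t] by (simp add: single_add)
    show "(r \<otimes>\<^bsub>scalar_ring\<^esub> s) \<odot>\<^bsub>V\<^esub> t = r \<odot>\<^bsub>V\<^esub> (s \<odot>\<^bsub>V\<^esub> t)"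
      using t act_mult[of "single \<one> r" "single \<one> s" t] by simp
    show "r \<odot>\<^bsub>V\<^esub> (t \<oplus>\<^bsub>V\<^esub> u) = r \<odot>\<^bsub>V\<^esub> t \<oplus>\<^bsub>V\<^esub> r \<odot>\<^bsub>V\<^esub> u"
      using t u T.smult_r_distr[of "single \<one> r" t u] by simp
    show "\<one>\<^bsub>scalar_ring\<^esub> \<odot>\<^bsub>V\<^esub> t = t" using T.smult_one t by simp
  qed auto
qed

text \<open>The module is generated by any nonzero vector \<open>t\<close>, hence spanned over the field by the
  finitely many translates of \<open>t\<close> under the group.\<close>

lemma has_fin_basis: "\<exists>B. is_fin_basis V B"
proof -
  obtain t where t: "t \<in> carrier T" "t \<noteq> \<zero>\<^bsub>T\<^esub>"
    using simple T.M.zero_closed unfolding simple_module_def by blast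
  define S where "S = (\<lambda>x. bas x \<odot>\<^bsub>T\<^esub> t) ` carrier \<Gamma>"
  have S: "finite S" "S \<subseteq> carrier V" using fin t by (auto simp: S_def)
  define W where "W = {v \<in> carrier T. \<exists>c. v = V.lc S c}"
  have W_I: "v \<in> W" if "v \<in> carrier T" "v = V.lc S c" for v c
    unfolding W_def using that by (intro CollectI conjI exI[of _ c])
  have W_D: "v \<in> carrier T" if "v \<in> W" for v using that unfolding W_def by blast
  have W_add: "v \<oplus>\<^bsub>T\<^esub> w \<in> W" if vw: "v \<in> W" "w \<in> W" for v w
  proof -
    obtain c d where "v = V.lc S c" "w = V.lc S d" using vw unfolding W_def by auto
    then have "v \<oplus>\<^bsub>T\<^esub> w = V.lc S (\<lambda>b. c b + d b)" using V.lc_add[OF S(2), of c d] by simp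
    moreover have "v \<oplus>\<^bsub>T\<^esub> w \<in> carrier T" using W_D vw by auto
    ultimately show ?thesis by (rule W_I[rotated])
  qed
  have W_smult: "r \<odot>\<^bsub>V\<^esub> v \<in> W" if v: "v \<in> W" for r v
  proof -
    obtain c where "v = V.lc S c" using v unfolding W_def by auto
    then have "r \<odot>\<^bsub>V\<^esub> v = V.lc S (\<lambda>b. r * c b)" using V.lc_smult[OF S(2), of r c] by simp
    moreover have "r \<odot>\<^bsub>V\<^esub> v \<in> carrier T" using W_D[OF v] V.smul_in[of v r] by auto
    ultimately show ?thesis by (rule W_I[rotated])
  qed
  have W_zero: "\<zero>\<^bsub>T\<^esub> \<in> W" 
  proof (rule W_I[where c = "\<lambda>_. 0"])
    show "\<zero>\<^bsub>T\<^esub> \<in> carrier T" by (rule T.M.zero_closed)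
    show "\<zero>\<^bsub>T\<^esub> = V.lc S (\<lambda>_. 0)" unfolding V.lc_zero[OF S(2)] change_scalars_simps(2) ..
  qed
  have W_S: "s \<in> W" if "s \<in> S" for s
  proof -
    have "s = V.lc S (\<lambda>x. if x = s then 1 else 0)" using V.lc_single[OF S that] by simp
    moreover have "s \<in> carrier T" using that S by auto
    ultimately show ?thesis by (rule W_I[rotated])
  qed
  have "(\<Sum>x\<in>X. single x (c x)) \<odot>\<^bsub>T\<^esub> t \<in> W" if "finite X" "X \<subseteq> carrier \<Gamma>" for X c
    using that
  proof (induction X)
    case empty then show ?case using W_zero t act_zero by simp
  next
    case (insert x X)
    have "keys (\<Sum>x\<in>X. single x (c x)) \<subseteq> carrier \<Gamma>"
      using insert by (intro keys_sum_subset) auto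
    moreover have "single x (c x) \<odot>\<^bsub>T\<^esub> t = c x \<odot>\<^bsub>V\<^esub> (bas x \<odot>\<^bsub>T\<^esub> t)"
      using act_scl[of "bas x" t "c x"] insert t by simp
    moreover have "bas x \<odot>\<^bsub>T\<^esub> t \<in> W" using insert by (intro W_S) (auto simp: S_def)
    ultimately show ?case
      using insert t W_add W_smult by (simp add: act_add)
  qed
  then have inW: "a \<odot>\<^bsub>T\<^esub> t \<in> W" if "keys a \<subseteq> carrier \<Gamma>" for a
    using expand_pm[OF fin that] fin by (metis order_refl)
  define U where "U = (\<lambda>a. a \<odot>\<^bsub>T\<^esub> t) ` carrier RG"
  have "submodule U RG T"
  proof (rule T.submodule_criterion)
    show "U \<subseteq> carrier T" "U \<noteq> {}" using t by (auto simp: U_def intro!: exI[of _ 0])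
    fix u v assume "u \<in> U" "v \<in> U"
    then obtain a b where "a \<in> carrier RG" "u = a \<odot>\<^bsub>T\<^esub> t" "b \<in> carrier RG" "v = b \<odot>\<^bsub>T\<^esub> t"
      by (auto simp: U_def)
    then show "u \<oplus>\<^bsub>T\<^esub> v \<in> U"
      using t by (auto simp: U_def act_add[symmetric] keys_add_subset intro!: imageI)
  next
    fix a u assume a: "a \<in> carrier RG" "u \<in> U"
    then obtain b where b: "b \<in> carrier RG" "u = b \<odot>\<^bsub>T\<^esub> t" by (auto simp: U_def)
    have "a \<otimes>\<^bsub>RG\<^esub> b \<in> carrier RG" using a b by (intro T.R.m_closed)
    then show "a \<odot>\<^bsub>T\<^esub> u \<in> U"
      using a b t act_mult[of a b t] unfolding U_def by (metis (no_types, lifting) T.smult_assoc imageI)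
  qed
  moreover have "t \<in> U" using T.smult_one[OF t(1)] t unfolding U_def by (auto intro!: image_eqI[of _ _ "bas \<one>"])
  ultimately have "U = carrier T" using simple t(2) unfolding simple_module_def by blast
  have "\<exists>c. v = V.lc S c" if v: "v \<in> carrier V" for v
  proof -
    have "v \<in> U" using v \<open>U = carrier T\<close> by simp
    then obtain a where "keys a \<subseteq> carrier \<Gamma>" "v = a \<odot>\<^bsub>T\<^esub> t"
      unfolding U_def by auto
    then have "v \<in> W" using inW by blast
    then show ?thesis unfolding W_def mem_Collect_eq by (rule conjunct2)
  qed
  then show ?thesis by (rule V.fin_basis_exists[OF S])
qed

sublocale V: fin_vspace V
  by unfold_locales (rule has_fin_basis)

text \<open>The character, extended linearly to the group algebra.\<close>

definition chi :: "('q \<Rightarrow>\<^sub>0 'r) \<Rightarrow> 'r" where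
  "chi a = trace_on V (\<lambda>t. a \<odot>\<^bsub>T\<^esub> t)"

lemma lin_act: "keys a \<subseteq> carrier \<Gamma> \<Longrightarrow> V.lin (\<lambda>t. a \<odot>\<^bsub>T\<^esub> t)"
  unfolding V.lin_def
  using T.smult_r_distr[of a] act_mult[of a "single \<one> _"] act_mult[of "single \<one> _" a]
  by (auto simp: scalar_central)

lemma chi_add: "keys a \<subseteq> carrier \<Gamma> \<Longrightarrow> keys b \<subseteq> carrier \<Gamma> \<Longrightarrow> chi (a + b) = chi a + chi b"
  unfolding chi_def
  by (subst V.tr_add[symmetric]) (auto simp: act_add intro!: V.tr_cong)

lemma chi_scl: "keys a \<subseteq> carrier \<Gamma> \<Longrightarrow> chi (scl r a) = r * chi a"
  unfolding chi_def by (subst V.tr_smult[symmetric]) (auto simp: act_scl simp del: change_scalars_simps(4) intro!: V.tr_cong)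

lemma chi_null: "(\<And>t. t \<in> carrier T \<Longrightarrow> a \<odot>\<^bsub>T\<^esub> t = \<zero>\<^bsub>T\<^esub>) \<Longrightarrow> chi a = 0"
  unfolding chi_def using V.tr_zero V.tr_cong[of "\<lambda>t. a \<odot>\<^bsub>T\<^esub> t" "\<lambda>t. \<zero>\<^bsub>T\<^esub>"] by simp

lemma chi_zero: "chi 0 = 0"
  by (rule chi_null) (rule act_zero)

lemma chi_sum: "(\<And>i. i \<in> I \<Longrightarrow> keys (a i) \<subseteq> carrier \<Gamma>) \<Longrightarrow> chi (\<Sum>i\<in>I. a i) = (\<Sum>i\<in>I. chi (a i))"
  by (induction I rule: infinite_finite_induct) (auto simp: chi_zero chi_add keys_sum_subset)

lemma chi_comm:
  assumes "keys a \<subseteq> carrier \<Gamma>" "keys b \<subseteq> carrier \<Gamma>"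
  shows "chi (a \<otimes>\<^bsub>RG\<^esub> b) = chi (b \<otimes>\<^bsub>RG\<^esub> a)"
proof -
  have "chi (a \<otimes>\<^bsub>RG\<^esub> b) = trace_on V (\<lambda>t. a \<odot>\<^bsub>T\<^esub> (b \<odot>\<^bsub>T\<^esub> t))"
    unfolding chi_def by (rule V.tr_cong) (use assms act_mult in auto)
  also have "\<dots> = trace_on V (\<lambda>t. b \<odot>\<^bsub>T\<^esub> (a \<odot>\<^bsub>T\<^esub> t))"
    by (rule V.tr_comm) (use assms lin_act in auto)
  also have "\<dots> = chi (b \<otimes>\<^bsub>RG\<^esub> a)"
    unfolding chi_def by (rule V.tr_cong) (use assms act_mult in auto)
  finally show ?thesis .
qed

lemma chi_id: "(\<And>t. t \<in> carrier T \<Longrightarrow> a \<odot>\<^bsub>T\<^esub> t = t) \<Longrightarrow> chi a \<noteq> 0"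
proof -
  assume "\<And>t. t \<in> carrier T \<Longrightarrow> a \<odot>\<^bsub>T\<^esub> t = t"
  then have "chi a = of_nat (card V.Bs)"
    unfolding chi_def V.tr_id[symmetric] by (intro V.tr_cong) auto
  moreover have "card V.Bs \<noteq> 0"
    using V.card_Bs simple unfolding simple_module_def by simp
  ultimately show ?thesis by simp
qed

lemma bas_mult_mult:
  assumes "x \<in> carrier \<Gamma>" "y \<in> carrier \<Gamma>" "keys a \<subseteq> carrier \<Gamma>"
  shows "a \<otimes>\<^bsub>RG\<^esub> bas x \<otimes>\<^bsub>RG\<^esub> bas y = a \<otimes>\<^bsub>RG\<^esub> bas (x \<otimes> y)"
  using T.R.m_assoc[of a "bas x" "bas y"] assms by simp

text \<open>Maschke's argument. Averaging a linear projection \<open>p\<close> onto \<open>I\<close> over the group yields a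
  projection that commutes with right multiplication, and the image \<open>f\<close> of the identity under it
  satisfies \<open>fa = a\<close> for all \<open>a \<in> I\<close>.\<close>

lemma left_identity_of_ideal:
  assumes I: "pm.subspace I" and sub: "\<And>a. a \<in> I \<Longrightarrow> keys a \<subseteq> carrier \<Gamma>"
    and right: "\<And>a x. a \<in> I \<Longrightarrow> x \<in> carrier \<Gamma> \<Longrightarrow> a \<otimes>\<^bsub>RG\<^esub> bas x \<in> I"
  obtains f where "f \<in> I" "\<And>a. a \<in> I \<Longrightarrow> f \<otimes>\<^bsub>RG\<^esub> a = a"
proof -
  interpret pp: vector_space_pair "scl :: 'r \<Rightarrow> ('q \<Rightarrow>\<^sub>0 'r) \<Rightarrow> ('q \<Rightarrow>\<^sub>0 'r)" "scl :: 'r \<Rightarrow> ('q \<Rightarrow>\<^sub>0 'r) \<Rightarrow> ('q \<Rightarrow>\<^sub>0 'r)" ..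
  obtain p where p: "p ` UNIV \<subseteq> I" "Vector_Spaces.linear scl scl p" "\<forall>v\<in>I. p v = v"
    using pp.linear_exists_left_inverse_on[OF pm.linear_ident I] by (auto simp: inj_on_def)
  interpret p: Vector_Spaces.linear scl scl p by (rule p(2))
  define n where "n = (of_nat (card (carrier \<Gamma>)) :: 'r)"
  have n: "n \<noteq> 0" using fin by (auto simp: n_def)
  define f where "f = scl (1 / n) (\<Sum>x\<in>carrier \<Gamma>. p (bas x) \<otimes>\<^bsub>RG\<^esub> bas (inv x))"
  have pI: "p a \<in> I" for a using p(1) by blast
  have fI: "f \<in> I"
    unfolding f_def by (intro pm.subspace_scale[OF I] pm.subspace_sum[OF I] right pI inv_closed)
  have mult_add: "(a + b) \<otimes>\<^bsub>RG\<^esub> c = a \<otimes>\<^bsub>RG\<^esub> c + b \<otimes>\<^bsub>RG\<^esub> c" "scl r a \<otimes>\<^bsub>RG\<^esub> c = scl r (a \<otimes>\<^bsub>RG\<^esub> c)"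
     "(\<Sum>i\<in>J. h i) \<otimes>\<^bsub>RG\<^esub> c = (\<Sum>i\<in>J. h i \<otimes>\<^bsub>RG\<^esub> c)" for a b c r and h :: "'q \<Rightarrow> _" and J
    by (simp_all add: group_algebra_mult linear_ext_sum)
  have fk: "f \<otimes>\<^bsub>RG\<^esub> bas k = scl (1 / n) (\<Sum>x\<in>carrier \<Gamma>. p (bas (k \<otimes> x)) \<otimes>\<^bsub>RG\<^esub> bas (inv x))"
    if k: "k \<in> carrier \<Gamma>" for k
  proof -
    have "(\<Sum>x\<in>carrier \<Gamma>. p (bas x) \<otimes>\<^bsub>RG\<^esub> bas (inv x) \<otimes>\<^bsub>RG\<^esub> bas k)
      = (\<Sum>x\<in>carrier \<Gamma>. p (bas x) \<otimes>\<^bsub>RG\<^esub> bas (inv x \<otimes> k))"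
      using k sub[OF pI] by (intro sum.cong bas_mult_mult) auto
    also have "\<dots> = (\<Sum>x\<in>carrier \<Gamma>. p (bas (k \<otimes> x)) \<otimes>\<^bsub>RG\<^esub> bas (inv x))"
      by (rule sum.reindex_bij_witness[of _ "\<lambda>x. k \<otimes> x" "\<lambda>x. inv k \<otimes> x"])
        (use k in \<open>auto simp: m_assoc[symmetric] inv_mult_group\<close>)
    finally show ?thesis by (simp add: f_def mult_add)
  qed
  have "f \<otimes>\<^bsub>RG\<^esub> a = a" if a: "a \<in> I" for a
  proof -
    have ka: "keys a \<subseteq> carrier \<Gamma>" by (rule sub[OF a])
    have ex: "a = (\<Sum>k\<in>carrier \<Gamma>. scl (lk a k) (bas k))"
      using expand_pm[OF fin ka] by simp
    have mult_r: "b \<otimes>\<^bsub>RG\<^esub> (\<Sum>k\<in>carrier \<Gamma>. scl (c k) (bas k)) = (\<Sum>k\<in>carrier \<Gamma>. scl (c k) (b \<otimes>\<^bsub>RG\<^esub> bas k))" for b c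
      unfolding group_algebra_mult linear_ext_sum linear_ext_scl linear_ext_fun_sum linear_ext_fun_scl ..
    have "f \<otimes>\<^bsub>RG\<^esub> a = (\<Sum>k\<in>carrier \<Gamma>. scl (lk a k) (f \<otimes>\<^bsub>RG\<^esub> bas k))"
      by (subst ex) (rule mult_r)
    also have "\<dots> = scl (1 / n) (\<Sum>x\<in>carrier \<Gamma>. p (\<Sum>k\<in>carrier \<Gamma>. scl (lk a k) (bas (k \<otimes> x))) \<otimes>\<^bsub>RG\<^esub> bas (inv x))"
    proof -
      let ?q = "\<lambda>k x. p (bas (k \<otimes> x)) \<otimes>\<^bsub>RG\<^esub> bas (inv x)"
      have "(\<Sum>k\<in>carrier \<Gamma>. scl (lk a k) (f \<otimes>\<^bsub>RG\<^esub> bas k))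
        = (\<Sum>k\<in>carrier \<Gamma>. scl (1 / n) (\<Sum>x\<in>carrier \<Gamma>. scl (lk a k) (?q k x)))"
        by (rule sum.cong) (simp_all only: fk pm.scale_sum_right pm.scale_left_commute)
      also have "\<dots> = scl (1 / n) (\<Sum>x\<in>carrier \<Gamma>. \<Sum>k\<in>carrier \<Gamma>. scl (lk a k) (?q k x))"
        unfolding pm.scale_sum_right by (rule sum.swap)
      also have "(\<lambda>x. \<Sum>k\<in>carrier \<Gamma>. scl (lk a k) (?q k x))
        = (\<lambda>x. p (\<Sum>k\<in>carrier \<Gamma>. scl (lk a k) (bas (k \<otimes> x))) \<otimes>\<^bsub>RG\<^esub> bas (inv x))"
        by (simp only: p.sum p.scale mult_add)
      finally show ?thesis .
    qed
    also have "(\<lambda>x. \<Sum>k\<in>carrier \<Gamma>. scl (lk a k) (bas (k \<otimes> x))) = (\<lambda>x. a \<otimes>\<^bsub>RG\<^esub> bas x)"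
    proof
      fix x
      have "a \<otimes>\<^bsub>RG\<^esub> bas x = (\<Sum>k\<in>carrier \<Gamma>. scl (lk a k) (bas k)) \<otimes>\<^bsub>RG\<^esub> bas x"
        using ex by (rule arg_cong)
      then show "(\<Sum>k\<in>carrier \<Gamma>. scl (lk a k) (bas (k \<otimes> x))) = a \<otimes>\<^bsub>RG\<^esub> bas x"
        by (simp add: mult_add)
    qed
    also have "(\<Sum>x\<in>carrier \<Gamma>. p (a \<otimes>\<^bsub>RG\<^esub> bas x) \<otimes>\<^bsub>RG\<^esub> bas (inv x)) = (\<Sum>x\<in>carrier \<Gamma>. a)"
    proof (rule sum.cong)
      fix x assume x: "x \<in> carrier \<Gamma>"
      have "p (a \<otimes>\<^bsub>RG\<^esub> bas x) = a \<otimes>\<^bsub>RG\<^esub> bas x" using p(3) right[OF a x] by blast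
      then show "p (a \<otimes>\<^bsub>RG\<^esub> bas x) \<otimes>\<^bsub>RG\<^esub> bas (inv x) = a"
        using x ka bas_mult_mult[of x "inv x" a] scalar_central(2)[OF ka, of 1] by simp
    qed simp
    also have "\<dots> = scl n a"
      by (rule poly_mapping_eqI) (simp add: n_def lookup_sum)
    finally show ?thesis using n unfolding pm.scale_scale by simp
  qed
  then show thesis using fI that by blast
qed

text \<open>Let \<open>f\<close> be a left identity of the two-sided ideal \<open>I\<close> spanned by \<open>W\<close>. If \<open>W\<close> does not
  annihilate \<open>T\<close>, then \<open>f\<close> acts as the identity on \<open>T\<close>, and \<open>chi f\<close> is the dimension of \<open>T\<close>,
  which does not vanish in characteristic \<open>0\<close>. So \<open>chi\<close> cannot vanish on \<open>W\<close>.\<close>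

theorem character_detects_action:
  assumes sub: "\<And>v. v \<in> W \<Longrightarrow> keys v \<subseteq> carrier \<Gamma>"
    and left: "\<And>v x. v \<in> W \<Longrightarrow> x \<in> carrier \<Gamma> \<Longrightarrow> bas x \<otimes>\<^bsub>RG\<^esub> v \<in> W"
    and right: "\<And>v x. v \<in> W \<Longrightarrow> x \<in> carrier \<Gamma> \<Longrightarrow> v \<otimes>\<^bsub>RG\<^esub> bas x \<in> W"
  shows "(\<exists>v \<in> W. \<exists>t \<in> carrier T. v \<odot>\<^bsub>T\<^esub> t \<noteq> \<zero>\<^bsub>T\<^esub>) \<longleftrightarrow> (\<exists>v \<in> W. chi v \<noteq> 0)"
proof
  assume "\<exists>v \<in> W. chi v \<noteq> 0"
  then show "\<exists>v \<in> W. \<exists>t \<in> carrier T. v \<odot>\<^bsub>T\<^esub> t \<noteq> \<zero>\<^bsub>T\<^esub>" using chi_null by blast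
next
  assume "\<exists>v \<in> W. \<exists>t \<in> carrier T. v \<odot>\<^bsub>T\<^esub> t \<noteq> \<zero>\<^bsub>T\<^esub>"
  then obtain v t where v: "v \<in> W" and t: "t \<in> carrier T" and vt: "v \<odot>\<^bsub>T\<^esub> t \<noteq> \<zero>\<^bsub>T\<^esub>" by blast
  define I where "I = pm.span W"
  have I: "pm.subspace I" unfolding I_def by simp
  have subI: "keys a \<subseteq> carrier \<Gamma>" if "a \<in> I" for a
  proof -
    have "pm.subspace {a :: 'q \<Rightarrow>\<^sub>0 'r. keys a \<subseteq> carrier \<Gamma>}"
      by (rule pm.subspaceI) (simp_all add: keys_add_subset order_trans[OF keys_scl])
    then have "I \<subseteq> {a. keys a \<subseteq> carrier \<Gamma>}"
      unfolding I_def using sub by (intro pm.span_minimal) auto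
    then show ?thesis using that by blast
  qed
  have rightI: "a \<otimes>\<^bsub>RG\<^esub> bas x \<in> I" if a: "a \<in> I" and x: "x \<in> carrier \<Gamma>" for a x
  proof -
    have "pm.subspace {a. a \<otimes>\<^bsub>RG\<^esub> bas x \<in> I}"
      using pm.subspace_0[OF I] pm.subspace_add[OF I] pm.subspace_scale[OF I]
      by (intro pm.subspaceI) (auto simp: group_algebra_mult)
    then have "I \<subseteq> {a. a \<otimes>\<^bsub>RG\<^esub> bas x \<in> I}"
      unfolding I_def using right x by (intro pm.span_minimal) (auto intro: pm.span_base)
    then show ?thesis using a by blast
  qed
  obtain f where f: "f \<in> I" "\<And>a. a \<in> I \<Longrightarrow> f \<otimes>\<^bsub>RG\<^esub> a = a"
    using left_identity_of_ideal[OF I subI rightI] by blast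
  have kf: "keys f \<subseteq> carrier \<Gamma>" by (rule subI[OF f(1)])
  \<comment> \<open>The fixed space of \<open>f\<close> contains \<open>IT\<close>; asking for \<open>x u\<close> to be fixed for all \<open>x\<close> makes it a submodule.\<close>
  define U where "U = {u \<in> carrier T. \<forall>x \<in> carrier \<Gamma>. f \<odot>\<^bsub>T\<^esub> (bas x \<odot>\<^bsub>T\<^esub> u) = bas x \<odot>\<^bsub>T\<^esub> u}"
  have lin_f: "f \<odot>\<^bsub>T\<^esub> (u \<oplus>\<^bsub>T\<^esub> w) = f \<odot>\<^bsub>T\<^esub> u \<oplus>\<^bsub>T\<^esub> f \<odot>\<^bsub>T\<^esub> w" if "u \<in> carrier T" "w \<in> carrier T" for u w
    using T.smult_r_distr[of f u w] kf that by simp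
  have U_add: "u \<oplus>\<^bsub>T\<^esub> w \<in> U" if "u \<in> U" "w \<in> U" for u w
    using that T.smult_r_distr[of "bas _" u w] lin_f unfolding U_def by auto
  have U_scal: "single x r \<odot>\<^bsub>T\<^esub> u \<in> U" if u: "u \<in> U" and x: "x \<in> carrier \<Gamma>" for u x r
  proof -
    have uT: "u \<in> carrier T" using u by (simp add: U_def)
    have "f \<odot>\<^bsub>T\<^esub> (bas y \<odot>\<^bsub>T\<^esub> (single x r \<odot>\<^bsub>T\<^esub> u)) = bas y \<odot>\<^bsub>T\<^esub> (single x r \<odot>\<^bsub>T\<^esub> u)"
      if y: "y \<in> carrier \<Gamma>" for y
    proof -
      have "bas y \<odot>\<^bsub>T\<^esub> (single x r \<odot>\<^bsub>T\<^esub> u) = single (y \<otimes> x) r \<odot>\<^bsub>T\<^esub> u"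
        using act_mult[of "bas y" "single x r" u] x y uT by simp
      also have "\<dots> = single \<one> r \<odot>\<^bsub>T\<^esub> (bas (y \<otimes> x) \<odot>\<^bsub>T\<^esub> u)"
        using act_mult[of "single \<one> r" "bas (y \<otimes> x)" u] x y uT by simp
      finally have e: "bas y \<odot>\<^bsub>T\<^esub> (single x r \<odot>\<^bsub>T\<^esub> u) = single \<one> r \<odot>\<^bsub>T\<^esub> (bas (y \<otimes> x) \<odot>\<^bsub>T\<^esub> u)" .
      have "f \<odot>\<^bsub>T\<^esub> (single \<one> r \<odot>\<^bsub>T\<^esub> (bas (y \<otimes> x) \<odot>\<^bsub>T\<^esub> u)) = single \<one> r \<odot>\<^bsub>T\<^esub> (f \<odot>\<^bsub>T\<^esub> (bas (y \<otimes> x) \<odot>\<^bsub>T\<^esub> u))"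
        using lin_act[OF kf] uT x y unfolding V.lin_def by simp
      also have "f \<odot>\<^bsub>T\<^esub> (bas (y \<otimes> x) \<odot>\<^bsub>T\<^esub> u) = bas (y \<otimes> x) \<odot>\<^bsub>T\<^esub> u" using u x y by (simp add: U_def)
      finally show ?thesis unfolding e .
    qed
    then show ?thesis using uT x by (simp add: U_def)
  qed
  have U_zero: "\<zero>\<^bsub>T\<^esub> \<in> U"
  proof -
    have "a \<odot>\<^bsub>T\<^esub> \<zero>\<^bsub>T\<^esub> = \<zero>\<^bsub>T\<^esub>" if "keys a \<subseteq> carrier \<Gamma>" for a
      using lin_act[OF that] V.smul_simps(1)[of "a \<odot>\<^bsub>T\<^esub> \<zero>\<^bsub>T\<^esub>"] V.smul_simps(1)[of "\<zero>\<^bsub>T\<^esub>"] that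
      unfolding V.lin_def by (metis T.M.zero_closed act_closed change_scalars_simps(1,2))
    then show ?thesis using kf by (simp add: U_def)
  qed
  have U_sum: "(\<Sum>x\<in>X. single x (c x)) \<odot>\<^bsub>T\<^esub> u \<in> U" if "finite X" "X \<subseteq> carrier \<Gamma>" "u \<in> U" for X c u
    using that
  proof (induction X)
    case empty
    then have "u \<in> carrier T" by (simp add: U_def)
    then show ?case using U_zero act_zero by simp
  next
    case (insert x X)
    have "u \<in> carrier T" using insert by (simp add: U_def)
    moreover have "keys (\<Sum>x\<in>X. single x (c x)) \<subseteq> carrier \<Gamma>"
      using insert by (intro keys_sum_subset) auto
    ultimately show ?case
      using insert U_add[OF U_scal[of u x "c x"]] by (simp add: act_add)
  qed
  have U_act: "a \<odot>\<^bsub>T\<^esub> u \<in> U" if "keys a \<subseteq> carrier \<Gamma>" "u \<in> U" for a u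
    using U_sum[OF fin order_refl that(2), of "lk a"] expand_pm[OF fin that(1)] by simp
  have "submodule U RG T"
  proof (rule T.submodule_criterion)
    show "U \<subseteq> carrier T" "U \<noteq> {}" using U_zero by (auto simp: U_def)
  qed (use U_add U_act in auto)
  moreover have "v \<odot>\<^bsub>T\<^esub> t \<in> U"
  proof -
    have "f \<odot>\<^bsub>T\<^esub> (bas x \<odot>\<^bsub>T\<^esub> (v \<odot>\<^bsub>T\<^esub> t)) = bas x \<odot>\<^bsub>T\<^esub> (v \<odot>\<^bsub>T\<^esub> t)" if x: "x \<in> carrier \<Gamma>" for x
    proof -
      have xv: "bas x \<otimes>\<^bsub>RG\<^esub> v \<in> I" unfolding I_def by (intro pm.span_base left v x)
      have "f \<odot>\<^bsub>T\<^esub> ((bas x \<otimes>\<^bsub>RG\<^esub> v) \<odot>\<^bsub>T\<^esub> t) = (bas x \<otimes>\<^bsub>RG\<^esub> v) \<odot>\<^bsub>T\<^esub> t"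
        using act_mult[OF kf subI[OF xv] t] f(2)[OF xv] by simp
      then show ?thesis using act_mult[of "bas x" v t] sub[OF v] x t by simp
    qed
    then show ?thesis using sub[OF v] t by (simp add: U_def)
  qed
  ultimately have "U = carrier T" using simple vt unfolding simple_module_def by blast
  have "f \<odot>\<^bsub>T\<^esub> u = u" if u: "u \<in> carrier T" for u
  proof -
    have "f \<odot>\<^bsub>T\<^esub> (bas \<one> \<odot>\<^bsub>T\<^esub> u) = bas \<one> \<odot>\<^bsub>T\<^esub> u"
      using u \<open>U = carrier T\<close> unfolding U_def by blast
    then show ?thesis using T.smult_one[OF u] by simp
  qed
  then have cf: "chi f \<noteq> 0" by (rule chi_id)
  show "\<exists>v \<in> W. chi v \<noteq> 0"
  proof (rule ccontr)
    assume "\<not> (\<exists>v \<in> W. chi v \<noteq> 0)"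
    let ?Z = "{a. keys a \<subseteq> carrier \<Gamma> \<and> chi a = 0}"
    have "pm.subspace ?Z"
    proof (rule pm.subspaceI)
      show "scl c x \<in> ?Z" if "x \<in> ?Z" for c x
        using that keys_scl[of c x] chi_scl[of x c] by auto
      show "x + y \<in> ?Z" if "x \<in> ?Z" "y \<in> ?Z" for x y
        using that by (simp add: chi_add keys_add_subset)
    qed (simp add: chi_zero)
    then have "I \<subseteq> ?Z"
      unfolding I_def using sub \<open>\<not> (\<exists>v \<in> W. chi v \<noteq> 0)\<close> by (intro pm.span_minimal) auto
    then have "chi f = 0" using f(1) by blast
    then show False using cf by blast
  qed
qed

end

section \<open>Sections and Goursat's lemma\<close>

lemma iso_cong_carrier:
  assumes "group A" "f \<in> iso A B" "\<And>x. x \<in> carrier A \<Longrightarrow> f x = g x"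
  shows "g \<in> iso A B"
proof -
  interpret A: group A by fact
  have "bij_betw g (carrier A) (carrier B)"
    using assms(2,3) bij_betw_cong[of "carrier A" f g] by (auto simp: iso_def)
  moreover have "g \<in> hom A B"
  proof (rule homI)
    fix x y assume x: "x \<in> carrier A" and y: "y \<in> carrier A"
    have f: "f \<in> hom A B" using assms(2) by (simp add: iso_def)
    show "g x \<in> carrier B" using hom_in_carrier[OF f x] assms(3)[OF x] by simp
    show "g (x \<otimes>\<^bsub>A\<^esub> y) = g x \<otimes>\<^bsub>B\<^esub> g y"
      using hom_mult[OF f x y] assms(3)[OF x] assms(3)[OF y] assms(3)[OF A.m_closed[OF x y]] by simp
  qed
  ultimately show ?thesis by (simp add: iso_def)
qed

locale group_section = group G for G (structure) +
  fixes P K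
  assumes is_sec: "is_section G P K"
begin

lemma P_sub: "subgroup P G" and K_norm: "K \<lhd> G\<lparr>carrier := P\<rparr>"
  using is_sec by (auto simp: is_section_def)

lemma K_subP: "subgroup K (G\<lparr>carrier := P\<rparr>)"
  using K_norm by (rule normal_imp_subgroup)

lemma K_sub: "subgroup K G"
  by (rule incl_subgroup[OF P_sub K_subP])

lemma KP: "k \<in> K \<Longrightarrow> k \<in> P"
  using subgroup.subset[OF K_subP] by auto

lemma PG: "x \<in> P \<Longrightarrow> x \<in> carrier G"
  using subgroup.subset[OF P_sub] by auto

lemma PK_closed [simp]: "\<one> \<in> P" "\<one> \<in> K" "x \<in> P \<Longrightarrow> y \<in> P \<Longrightarrow> x \<otimes> y \<in> P" "x \<in> P \<Longrightarrow> inv x \<in> P"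
   "x \<in> K \<Longrightarrow> y \<in> K \<Longrightarrow> x \<otimes> y \<in> K" "x \<in> K \<Longrightarrow> inv x \<in> K"
  using P_sub K_sub by (auto intro: subgroup.one_closed subgroup.m_closed subgroup.m_inv_closed)

lemma coset_eq: "x \<in> P \<Longrightarrow> y \<in> P \<Longrightarrow> K #> x = K #> y \<longleftrightarrow> x \<otimes> inv y \<in> K"
  using rcos_self[OF _ K_sub, of x] repr_independence[OF _ _ K_sub, of x y] PG
    subgroup.rcos_module[OF K_sub is_group, of y x] by metis

lemma coset_one: "K #> \<one> = K"
  using coset_mult_one subgroup.subset[OF K_sub] by blast

lemma coset_K: "x \<in> P \<Longrightarrow> K #> x = K \<longleftrightarrow> x \<in> K"
  using coset_eq[of x \<one>] coset_one PG by simp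

lemma car: "carrier (subquot G P K) = (\<lambda>x. K #> x) ` P"
  by (simp add: carrier_FactGroup)

lemma in_car [simp]: "x \<in> P \<Longrightarrow> K #> x \<in> carrier (subquot G P K)"
  by (auto simp: car)

lemma mult_Q: "x \<in> P \<Longrightarrow> y \<in> P \<Longrightarrow> (K #> x) \<otimes>\<^bsub>subquot G P K\<^esub> (K #> y) = K #> (x \<otimes> y)"
  using normal.rcos_sum[OF K_norm, of x y] by simp

lemma group_Q: "group (subquot G P K)"
  by (rule normal.factorgroup_is_group[OF K_norm])

lemma conj_K: "x \<in> P \<Longrightarrow> k \<in> K \<Longrightarrow> x \<otimes> k \<otimes> inv x \<in> K"
  using normal.inv_op_closed2[OF K_norm, of x k] m_inv_consistent[OF P_sub, of x] by simp

lemma coset_mult_K: "x \<in> P \<Longrightarrow> k \<in> K \<Longrightarrow> K #> (x \<otimes> k) = K #> x" "x \<in> P \<Longrightarrow> k \<in> K \<Longrightarrow> K #> (k \<otimes> x) = K #> x"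
  using conj_K coset_eq KP PG by (auto simp: m_assoc)

lemma mem_coset: "x \<in> P \<Longrightarrow> y \<in> K #> x \<longleftrightarrow> y \<in> P \<and> K #> y = K #> x"
  using coset_eq[of y x] subgroup.rcos_module[OF K_sub is_group, of x y] PG KP
    subgroup.elemrcos_carrier[OF K_sub is_group, of x y]
  by (metis K_sub rcos_self subgroup.rcos_module_imp r_coset_def PK_closed(3) inv_solve_right)

end

locale section_iso = s1: group_section G P K + s2: group_section H D C
  for G :: "'g monoid" and P K and H :: "'h monoid" and D C +
  fixes \<eta> :: "'h set \<Rightarrow> 'g set"
  assumes iso: "\<eta> \<in> iso (subquot H D C) (subquot G P K)"
begin

abbreviation "L \<equiv> goursat G P K \<eta> H D C"

lemma mem_L: "(g, h) \<in> L \<longleftrightarrow> g \<in> P \<and> h \<in> D \<and> \<eta> (C #>\<^bsub>H\<^esub> h) = K #>\<^bsub>G\<^esub> g"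
  by (auto simp: goursat_def)

lemma bij: "bij_betw \<eta> (carrier (subquot H D C)) (carrier (subquot G P K))"
  using iso by (simp add: iso_def)

lemma ex_l: "h \<in> D \<Longrightarrow> \<exists>g\<in>P. \<eta> (C #>\<^bsub>H\<^esub> h) = K #>\<^bsub>G\<^esub> g"
  using bij_betwE[OF bij] s2.in_car[of h] s1.car by fastforce

lemma ex_r: assumes "g \<in> P" shows "\<exists>h\<in>D. \<eta> (C #>\<^bsub>H\<^esub> h) = K #>\<^bsub>G\<^esub> g"
proof -
  have "K #>\<^bsub>G\<^esub> g \<in> \<eta> ` carrier (subquot H D C)"
    using bij_betw_imp_surj_on[OF bij] s1.in_car[OF assms] by simp
  then show ?thesis unfolding s2.car by auto
qed

lemma inj: "h \<in> D \<Longrightarrow> h' \<in> D \<Longrightarrow> \<eta> (C #>\<^bsub>H\<^esub> h) = \<eta> (C #>\<^bsub>H\<^esub> h') \<Longrightarrow> C #>\<^bsub>H\<^esub> h = C #>\<^bsub>H\<^esub> h'"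
  using bij_betw_imp_inj_on[OF bij] s2.in_car by (meson inj_onD)

lemma eta_one: "\<eta> C = K"
proof -
  interpret group_hom "subquot H D C" "subquot G P K" \<eta>
    using iso s1.group_Q s2.group_Q by (simp add: group_hom_def group_hom_axioms_def iso_def)
  show ?thesis using hom_one by simp
qed

lemma fst_L: "fst ` L = P"
proof
  show "fst ` L \<subseteq> P" by (auto simp: mem_L)
  show "P \<subseteq> fst ` L"
  proof
    fix g assume "g \<in> P"
    then obtain h where "(g, h) \<in> L" using ex_r unfolding mem_L by blast
    then show "g \<in> fst ` L" by (rule image_eqI[rotated]) simp
  qed
qed

lemma snd_L: "snd ` L = D"
proof
  show "snd ` L \<subseteq> D" by (auto simp: mem_L)
  show "D \<subseteq> snd ` L"
  proof
    fix h assume "h \<in> D"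
    then obtain g where "(g, h) \<in> L" using ex_l unfolding mem_L by blast
    then show "h \<in> snd ` L" by (rule image_eqI[rotated]) simp
  qed
qed

lemma k1_L: "k1 H L = K"
  using s2.coset_one eta_one s1.coset_K s1.KP by (auto simp: k1_def mem_L)

lemma k2_L: "k2 G L = C"
proof -
  have "h \<in> C" if "h \<in> D" "\<eta> (C #>\<^bsub>H\<^esub> h) = K" for h
    using inj[OF that(1), of "\<one>\<^bsub>H\<^esub>"] that eta_one s2.coset_one s2.coset_K by simp
  moreover have "\<eta> (C #>\<^bsub>H\<^esub> h) = K" if "h \<in> C" for h
    using that eta_one s2.coset_K[OF s2.KP[OF that]] by metis
  ultimately show ?thesis
    using s1.coset_one s2.KP by (auto simp: k2_def mem_L)
qed

lemma q_group_L: "q_group G H L = subquot G P K"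
  by (simp add: q_group_def fst_L k1_L)

lemma eta_restrict: "restrict \<eta> (carrier (subquot H D C)) \<in> iso (subquot H D C) (subquot G P K)"
  by (rule iso_cong_carrier[OF s2.group_Q iso]) simp

end

text \<open>The subgroup depends only on the values of the isomorphism on cosets, so that isomorphisms may
  be replaced by their extensional restrictions.\<close>

lemma goursat_cong:
  assumes "group_section H D C" "\<And>X. X \<in> carrier (subquot H D C) \<Longrightarrow> \<eta> X = \<eta>' X"
  shows "goursat G P K \<eta> H D C = goursat G P K \<eta>' H D C"
proof -
  have "\<eta> (C #>\<^bsub>H\<^esub> h) = \<eta>' (C #>\<^bsub>H\<^esub> h)" if "h \<in> D" for h
    using assms(2) group_section.in_car[OF assms(1) that] by blast
  then show ?thesis unfolding goursat_def by (intro Collect_cong prod.case_cong refl) blast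
qed

lemma (in section_iso) goursat_restrict: "goursat G P K (restrict \<eta> (carrier (subquot H D C))) H D C = L"
  by (rule goursat_cong[OF s2.group_section_axioms]) (rule restrict_apply')

lemma goursat_inj:
  assumes "section_iso G P K H D C \<eta>" "section_iso G P K H D C \<eta>'"
    and eq: "goursat G P K \<eta> H D C = goursat G P K \<eta>' H D C" and X: "X \<in> carrier (subquot H D C)"
  shows "\<eta> X = \<eta>' X"
proof -
  interpret a: section_iso G P K H D C \<eta> by fact
  interpret b: section_iso G P K H D C \<eta>' by fact
  obtain h where h: "h \<in> D" "X = C #>\<^bsub>H\<^esub> h" using X a.s2.car by auto
  obtain g where "g \<in> P" "\<eta> X = K #>\<^bsub>G\<^esub> g" using a.ex_l h by blast
  then show ?thesis using h eq a.mem_L b.mem_L by metis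
qed

lemma fst_in_image_iff: "g \<in> fst ` L \<longleftrightarrow> (\<exists>h. (g, h) \<in> L)"
  and snd_in_image_iff: "h \<in> snd ` L \<longleftrightarrow> (\<exists>g. (g, h) \<in> L)"
  by force+

text \<open>Goursat's lemma. Two elements \<open>(g, h)\<close> and \<open>(g', h')\<close> of \<open>L\<close> have first components in the same
  coset of \<open>k\<^sub>1(L)\<close> if and only if their second components lie in the same coset of \<open>k\<^sub>2(L)\<close>;
  thus \<open>L\<close> induces a bijection of cosets.\<close>

lemma goursat_subgroup_decomp:
  assumes G: "group G" and H: "group H" and L: "subgroup L (G \<times>\<times> H)"
  obtains \<eta> where "section_iso G (fst ` L) (k1 H L) H (snd ` L) (k2 G L) \<eta>"
    "L = goursat G (fst ` L) (k1 H L) \<eta> H (snd ` L) (k2 G L)"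
proof -
  interpret G: group G by fact
  interpret H: group H by fact
  define B A D C where "B = fst ` L" and "A = k1 H L" and "D = snd ` L" and "C = k2 G L"
  have B_iff: "g \<in> B \<longleftrightarrow> (\<exists>h. (g, h) \<in> L)" for g unfolding B_def by (rule fst_in_image_iff)
  have D_iff: "h \<in> D \<longleftrightarrow> (\<exists>g. (g, h) \<in> L)" for h unfolding D_def by (rule snd_in_image_iff)
  have A_iff: "g \<in> A \<longleftrightarrow> (g, \<one>\<^bsub>H\<^esub>) \<in> L" for g by (simp add: A_def k1_def)
  have C_iff: "h \<in> C \<longleftrightarrow> (\<one>\<^bsub>G\<^esub>, h) \<in> L" for h by (simp add: C_def k2_def)
  note defs = B_iff D_iff A_iff C_iff
  have LG: "g \<in> carrier G" "h \<in> carrier H" if "(g, h) \<in> L" for g h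
    using subgroup.subset[OF L] that by (auto simp: DirProd_def)
  have one: "(\<one>\<^bsub>G\<^esub>, \<one>\<^bsub>H\<^esub>) \<in> L" using subgroup.one_closed[OF L] by simp
  have mult: "(g \<otimes>\<^bsub>G\<^esub> g', h \<otimes>\<^bsub>H\<^esub> h') \<in> L" if "(g, h) \<in> L" "(g', h') \<in> L" for g h g' h'
    using subgroup.m_closed[OF L that] by simp
  have inv: "(inv\<^bsub>G\<^esub> g, inv\<^bsub>H\<^esub> h) \<in> L" if "(g, h) \<in> L" for g h
    using subgroup.m_inv_closed[OF L that] inv_DirProd[OF G H LG[OF that]] by simp
  have Bs: "subgroup B G"
  proof (rule G.subgroupI)
    show "B \<subseteq> carrier G" using LG(1) by (auto simp: B_iff)
    show "B \<noteq> {}" using one B_iff by blast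
    show "inv\<^bsub>G\<^esub> g \<in> B" if "g \<in> B" for g using inv that unfolding B_iff by blast
    show "g \<otimes>\<^bsub>G\<^esub> g' \<in> B" if "g \<in> B" "g' \<in> B" for g g' using mult that unfolding B_iff by blast
  qed
  have Ds: "subgroup D H"
  proof (rule H.subgroupI)
    show "D \<subseteq> carrier H" using LG(2) by (auto simp: D_iff)
    show "D \<noteq> {}" using one D_iff by blast
    show "inv\<^bsub>H\<^esub> g \<in> D" if "g \<in> D" for g using inv that unfolding D_iff by blast
    show "g \<otimes>\<^bsub>H\<^esub> g' \<in> D" if "g \<in> D" "g' \<in> D" for g g' using mult that unfolding D_iff by blast
  qed
  have As: "subgroup A G"
  proof (rule G.subgroupI)
    show "A \<subseteq> carrier G" using LG by (auto simp: defs)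
    show "A \<noteq> {}" using one by (auto simp: defs)
    show "inv\<^bsub>G\<^esub> a \<in> A" if "a \<in> A" for a using inv[of a "\<one>\<^bsub>H\<^esub>"] that by (auto simp: defs)
    show "a \<otimes>\<^bsub>G\<^esub> b \<in> A" if "a \<in> A" "b \<in> A" for a b
      using mult[of a "\<one>\<^bsub>H\<^esub>" b "\<one>\<^bsub>H\<^esub>"] that by (auto simp: defs)
  qed
  have Cs: "subgroup C H"
  proof (rule H.subgroupI)
    show "C \<subseteq> carrier H" using LG by (auto simp: defs)
    show "C \<noteq> {}" using one by (auto simp: defs)
    show "inv\<^bsub>H\<^esub> a \<in> C" if "a \<in> C" for a using inv[of "\<one>\<^bsub>G\<^esub>" a] that by (auto simp: defs)
    show "a \<otimes>\<^bsub>H\<^esub> b \<in> C" if "a \<in> C" "b \<in> C" for a b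
      using mult[of "\<one>\<^bsub>G\<^esub>" a "\<one>\<^bsub>G\<^esub>" b] that by (auto simp: defs)
  qed
  have AB: "A \<subseteq> B" "C \<subseteq> D" by (auto simp: defs)
  interpret GB: group "G\<lparr>carrier := B\<rparr>" using Bs G.subgroup_imp_group by blast
  interpret HD: group "H\<lparr>carrier := D\<rparr>" using Ds H.subgroup_imp_group by blast
  have nA: "A \<lhd> G\<lparr>carrier := B\<rparr>"
  proof (rule GB.normal_invI)
    show "subgroup A (G\<lparr>carrier := B\<rparr>)" using G.subgroup_incl[OF As Bs AB(1)] .
    fix x a assume "x \<in> carrier (G\<lparr>carrier := B\<rparr>)" and a: "a \<in> A"
    then obtain h where xh: "(x, h) \<in> L" by (auto simp: defs)
    have *: "(x \<otimes>\<^bsub>G\<^esub> a \<otimes>\<^bsub>G\<^esub> inv\<^bsub>G\<^esub> x, h \<otimes>\<^bsub>H\<^esub> \<one>\<^bsub>H\<^esub> \<otimes>\<^bsub>H\<^esub> inv\<^bsub>H\<^esub> h) \<in> L"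
      using a xh by (intro mult inv) (auto simp: defs)
    then show "x \<otimes>\<^bsub>G\<lparr>carrier := B\<rparr>\<^esub> a \<otimes>\<^bsub>G\<lparr>carrier := B\<rparr>\<^esub> inv\<^bsub>G\<lparr>carrier := B\<rparr>\<^esub> x \<in> A"
    proof -
      have "inv\<^bsub>G\<lparr>carrier := B\<rparr>\<^esub> x = inv\<^bsub>G\<^esub> x"
        using G.m_inv_consistent[OF Bs] B_iff xh by blast
      then show ?thesis using LG[OF xh] * by (simp add: A_iff)
    qed
  qed
  have nC: "C \<lhd> H\<lparr>carrier := D\<rparr>"
  proof (rule HD.normal_invI)
    show "subgroup C (H\<lparr>carrier := D\<rparr>)" using H.subgroup_incl[OF Cs Ds AB(2)] .
    fix x a assume "x \<in> carrier (H\<lparr>carrier := D\<rparr>)" and a: "a \<in> C"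
    then obtain g where xh: "(g, x) \<in> L" by (auto simp: defs)
    have *: "(g \<otimes>\<^bsub>G\<^esub> \<one>\<^bsub>G\<^esub> \<otimes>\<^bsub>G\<^esub> inv\<^bsub>G\<^esub> g, x \<otimes>\<^bsub>H\<^esub> a \<otimes>\<^bsub>H\<^esub> inv\<^bsub>H\<^esub> x) \<in> L"
      using a xh by (intro mult inv) (auto simp: defs)
    then show "x \<otimes>\<^bsub>H\<lparr>carrier := D\<rparr>\<^esub> a \<otimes>\<^bsub>H\<lparr>carrier := D\<rparr>\<^esub> inv\<^bsub>H\<lparr>carrier := D\<rparr>\<^esub> x \<in> C"
    proof -
      have "inv\<^bsub>H\<lparr>carrier := D\<rparr>\<^esub> x = inv\<^bsub>H\<^esub> x"
        using H.m_inv_consistent[OF Ds] D_iff xh by blast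
      then show ?thesis using LG[OF xh] * by (simp add: C_iff)
    qed
  qed
  interpret s1: group_section G B A by unfold_locales (simp add: is_section_def Bs nA)
  interpret s2: group_section H D C by unfold_locales (simp add: is_section_def Ds nC)
  have key: "A #>\<^bsub>G\<^esub> g = A #>\<^bsub>G\<^esub> g' \<longleftrightarrow> C #>\<^bsub>H\<^esub> h = C #>\<^bsub>H\<^esub> h'" if L1: "(g, h) \<in> L" and L2: "(g', h') \<in> L" for g h g' h'
  proof -
    have m: "(g \<otimes>\<^bsub>G\<^esub> inv\<^bsub>G\<^esub> g', h \<otimes>\<^bsub>H\<^esub> inv\<^bsub>H\<^esub> h') \<in> L" by (intro mult inv L1 L2)
    have i1: "(g \<otimes>\<^bsub>G\<^esub> inv\<^bsub>G\<^esub> g', \<one>\<^bsub>H\<^esub>) \<in> L" if "(\<one>\<^bsub>G\<^esub>, h \<otimes>\<^bsub>H\<^esub> inv\<^bsub>H\<^esub> h') \<in> L"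
      using mult[OF m inv[OF that]] LG[OF m] LG[OF that] by simp
    have i2: "(\<one>\<^bsub>G\<^esub>, h \<otimes>\<^bsub>H\<^esub> inv\<^bsub>H\<^esub> h') \<in> L" if "(g \<otimes>\<^bsub>G\<^esub> inv\<^bsub>G\<^esub> g', \<one>\<^bsub>H\<^esub>) \<in> L"
      using mult[OF inv[OF that] m] LG[OF m] LG[OF that] by simp
    have "g \<in> B" "g' \<in> B" "h \<in> D" "h' \<in> D" using L1 L2 by (auto simp: defs)
    then show ?thesis
      using i1 i2 by (simp add: s1.coset_eq s2.coset_eq) (auto simp: defs)
  qed
  \<comment> \<open>The image of a coset under the relation \<open>L\<close> is again a coset, so no representatives are chosen.\<close>
  define \<eta> where "\<eta> X = {g. \<exists>h \<in> X. (g, h) \<in> L}" for X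
  have eta: "\<eta> (C #>\<^bsub>H\<^esub> h) = A #>\<^bsub>G\<^esub> g" if L1: "(g, h) \<in> L" for g h
  proof -
    have gh: "g \<in> B" "h \<in> D" using L1 by (auto simp: defs)
    show ?thesis
    proof (intro equalityI subsetI)
      fix x assume "x \<in> \<eta> (C #>\<^bsub>H\<^esub> h)"
      then obtain h' where h': "h' \<in> C #>\<^bsub>H\<^esub> h" "(x, h') \<in> L" by (auto simp: \<eta>_def)
      then have "C #>\<^bsub>H\<^esub> h' = C #>\<^bsub>H\<^esub> h" using s2.mem_coset[OF gh(2)] by blast
      then have "A #>\<^bsub>G\<^esub> x = A #>\<^bsub>G\<^esub> g" using key[OF h'(2) L1] by blast
      moreover have "x \<in> B" using h' by (auto simp: defs)
      ultimately show "x \<in> A #>\<^bsub>G\<^esub> g" using s1.mem_coset[OF gh(1)] by blast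
    next
      fix x assume x: "x \<in> A #>\<^bsub>G\<^esub> g"
      then obtain a where a: "a \<in> A" "x = a \<otimes>\<^bsub>G\<^esub> g" by (auto simp: r_coset_def)
      have "(a \<otimes>\<^bsub>G\<^esub> g, \<one>\<^bsub>H\<^esub> \<otimes>\<^bsub>H\<^esub> h) \<in> L" using a L1 by (intro mult) (auto simp: defs)
      then have "(x, h) \<in> L" using a LG[OF L1] by simp
      moreover have "h \<in> C #>\<^bsub>H\<^esub> h" using s2.mem_coset[OF gh(2)] gh by blast
      ultimately show "x \<in> \<eta> (C #>\<^bsub>H\<^esub> h)" by (auto simp: \<eta>_def)
    qed
  qed
  have D_L: "\<exists>g. (g, h) \<in> L \<and> g \<in> B" if "h \<in> D" for h using that by (auto simp: defs)
  have B_L: "\<exists>h. (g, h) \<in> L \<and> h \<in> D" if "g \<in> B" for g using that by (auto simp: defs)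
  have LBD: "g \<in> B" "h \<in> D" if "(g, h) \<in> L" for g h using that by (auto simp: defs)
  have "\<eta> \<in> iso (subquot H D C) (subquot G B A)"
  proof (rule isoI)
    show "\<eta> \<in> hom (subquot H D C) (subquot G B A)"
    proof (rule homI)
      fix X assume "X \<in> carrier (subquot H D C)"
      then obtain h where h: "h \<in> D" "X = C #>\<^bsub>H\<^esub> h" unfolding s2.car by blast
      obtain g where g: "(g, h) \<in> L" "g \<in> B" using D_L[OF h(1)] by blast
      then show "\<eta> X \<in> carrier (subquot G B A)" using eta h s1.in_car by metis
      fix Y assume "Y \<in> carrier (subquot H D C)"
      then obtain h' where h': "h' \<in> D" "Y = C #>\<^bsub>H\<^esub> h'" unfolding s2.car by blast
      obtain g' where g': "(g', h') \<in> L" "g' \<in> B" using D_L[OF h'(1)] by blast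
      show "\<eta> (X \<otimes>\<^bsub>subquot H D C\<^esub> Y) = \<eta> X \<otimes>\<^bsub>subquot G B A\<^esub> \<eta> Y"
        unfolding h h' s2.mult_Q[OF h(1) h'(1)] eta[OF g(1)] eta[OF g'(1)] s1.mult_Q[OF g(2) g'(2)]
        by (rule eta[OF mult[OF g(1) g'(1)]])
    qed
    show "bij_betw \<eta> (carrier (subquot H D C)) (carrier (subquot G B A))"
    proof (rule bij_betw_imageI)
      show "inj_on \<eta> (carrier (subquot H D C))"
      proof (rule inj_onI)
        fix X Y assume "X \<in> carrier (subquot H D C)" "Y \<in> carrier (subquot H D C)" and e: "\<eta> X = \<eta> Y"
        then obtain h h' where h: "h \<in> D" "X = C #>\<^bsub>H\<^esub> h" "h' \<in> D" "Y = C #>\<^bsub>H\<^esub> h'" unfolding s2.car by blast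
        then obtain g g' where g: "(g, h) \<in> L" "(g', h') \<in> L" using D_L by blast
        then show "X = Y" using e key[OF g] eta h by simp
      qed
      show "\<eta> ` carrier (subquot H D C) = carrier (subquot G B A)"
      proof (intro equalityI subsetI)
        fix X assume "X \<in> \<eta> ` carrier (subquot H D C)"
        then obtain h where h: "h \<in> D" "X = \<eta> (C #>\<^bsub>H\<^esub> h)" unfolding s2.car by blast
        then show "X \<in> carrier (subquot G B A)" using D_L[OF h(1)] eta s1.in_car by metis
      next
        fix X assume "X \<in> carrier (subquot G B A)"
        then obtain g where g: "g \<in> B" "X = A #>\<^bsub>G\<^esub> g" unfolding s1.car by blast
        then obtain h where "(g, h) \<in> L" "h \<in> D" using B_L by blast
        then show "X \<in> \<eta> ` carrier (subquot H D C)" using eta g s2.in_car by (metis imageI)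
      qed
    qed
  qed
  then have si: "section_iso G B A H D C \<eta>"
    by unfold_locales
  have "L = goursat G B A \<eta> H D C"
  proof (intro equalityI subsetI)
    fix p assume "p \<in> L" then show "p \<in> goursat G B A \<eta> H D C"
      using eta LBD by (cases p) (auto simp: goursat_def)
  next
    fix p assume "p \<in> goursat G B A \<eta> H D C"
    then obtain g h where p: "p = (g, h)" "g \<in> B" "h \<in> D" "\<eta> (C #>\<^bsub>H\<^esub> h) = A #>\<^bsub>G\<^esub> g" by (auto simp: goursat_def)
    obtain g' where g': "(g', h) \<in> L" "g' \<in> B" using D_L[OF p(3)] by blast
    then have "A #>\<^bsub>G\<^esub> g = A #>\<^bsub>G\<^esub> g'" using eta p by metis
    then have "g \<otimes>\<^bsub>G\<^esub> inv\<^bsub>G\<^esub> g' \<in> A" using s1.coset_eq p g' by blast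
    then have "(g \<otimes>\<^bsub>G\<^esub> inv\<^bsub>G\<^esub> g' \<otimes>\<^bsub>G\<^esub> g', \<one>\<^bsub>H\<^esub> \<otimes>\<^bsub>H\<^esub> h) \<in> L" using g' by (intro mult) (auto simp: defs)
    then show "p \<in> L" using p g' LG[OF g'(1)] s1.PG by (simp add: G.m_assoc)
  qed
  then show thesis using si that unfolding B_def A_def C_def D_def by blast
qed

section \<open>Composition of subgroups of direct products\<close>

lemma section_iso_comp:
  assumes "section_iso G P K H D C \<sigma>" "section_iso H D C J Q N \<rho>"
  shows "section_iso G P K J Q N (\<sigma> \<circ> \<rho>)"
proof -
  interpret a: section_iso G P K H D C \<sigma> by fact
  interpret b: section_iso H D C J Q N \<rho> by fact
  show ?thesis
    by unfold_locales (rule iso_set_trans[OF b.iso a.iso])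
qed

lemma section_iso_inv:
  assumes "section_iso G P K H D C \<sigma>"
  shows "section_iso H D C G P K (inv_into (carrier (subquot H D C)) \<sigma>)"
proof -
  interpret s: section_iso G P K H D C \<sigma> by fact
  show ?thesis
    by unfold_locales (rule group.iso_set_sym[OF s.s2.group_Q s.iso])
qed

lemma goursat_comp:
  assumes "section_iso G P K H D C \<sigma>" "section_iso H D C J Q N \<rho>"
  shows "goursat G P K \<sigma> H D C O goursat H D C \<rho> J Q N = goursat G P K (\<sigma> \<circ> \<rho>) J Q N"
proof -
  interpret a: section_iso G P K H D C \<sigma> by fact
  interpret b: section_iso H D C J Q N \<rho> by fact
  have "(g, j) \<in> a.L O b.L \<longleftrightarrow> (g, j) \<in> goursat G P K (\<sigma> \<circ> \<rho>) J Q N" for g j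
    using b.ex_l[of j] unfolding relcomp_unfold goursat_def by (auto; metis)
  then show ?thesis by auto
qed

lemma section_iso_id: "group_section G P K \<Longrightarrow> section_iso G P K G P K id"
  by (intro section_iso.intro section_iso_axioms.intro) (auto simp: id_def iso_set_refl)

lemma e_sec_left: "section_iso G P K H D C \<sigma> \<Longrightarrow> e_sec G P K O goursat G P K \<sigma> H D C = goursat G P K \<sigma> H D C"
  unfolding e_sec_def using goursat_comp[OF section_iso_id] section_iso.axioms(1) by fastforce

lemma e_sec_right: "section_iso G P K H D C \<sigma> \<Longrightarrow> goursat G P K \<sigma> H D C O e_sec H D C = goursat G P K \<sigma> H D C"
  unfolding e_sec_def using goursat_comp[OF _ section_iso_id] section_iso.axioms(2) by fastforce

text \<open>Two sections are linked if and only if every coset of either of them meets \<open>B \<inter> D\<close>, and the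
  two normal subgroups have the same intersection with \<open>B \<inter> D\<close>. Composites of relations produce
  linkedness in this form.\<close>

lemma linked_iff:
  assumes "group_section H B A" "group_section H D C"
  shows "linked H B A D C \<longleftrightarrow> (\<forall>x \<in> B \<inter> D. x \<in> A \<longleftrightarrow> x \<in> C) \<and>
    (\<forall>y \<in> B. \<exists>x \<in> B \<inter> D. A #>\<^bsub>H\<^esub> x = A #>\<^bsub>H\<^esub> y) \<and> (\<forall>y \<in> D. \<exists>x \<in> B \<inter> D. C #>\<^bsub>H\<^esub> x = C #>\<^bsub>H\<^esub> y)"
proof -
  have aux: "X <#>\<^bsub>H\<^esub> A = B \<longleftrightarrow> (\<forall>y \<in> B. \<exists>x \<in> X. A #>\<^bsub>H\<^esub> x = A #>\<^bsub>H\<^esub> y)"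
    if s: "group_section H B A" and XB: "X \<subseteq> B" for A B X
  proof -
    interpret s: group_section H B A by fact
    have "X <#>\<^bsub>H\<^esub> A \<subseteq> B" using XB s.KP by (auto simp: set_mult_def)
    moreover have "y \<in> X <#>\<^bsub>H\<^esub> A \<longleftrightarrow> (\<exists>x \<in> X. A #>\<^bsub>H\<^esub> x = A #>\<^bsub>H\<^esub> y)" if y: "y \<in> B" for y
    proof
      assume "y \<in> X <#>\<^bsub>H\<^esub> A"
      then obtain x a where "x \<in> X" "a \<in> A" "y = x \<otimes>\<^bsub>H\<^esub> a" by (auto simp: set_mult_def)
      then show "\<exists>x \<in> X. A #>\<^bsub>H\<^esub> x = A #>\<^bsub>H\<^esub> y" using s.coset_mult_K(1)[of x a] XB by blast
    next
      assume "\<exists>x \<in> X. A #>\<^bsub>H\<^esub> x = A #>\<^bsub>H\<^esub> y"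
      then obtain x where x: "x \<in> X" "A #>\<^bsub>H\<^esub> y = A #>\<^bsub>H\<^esub> x" by metis
      then have "x \<in> B" using XB by blast
      then have a: "y \<otimes>\<^bsub>H\<^esub> inv\<^bsub>H\<^esub> x \<in> A" using s.coset_eq[of y x] x y by blast
      have "inv\<^bsub>H\<^esub> x \<otimes>\<^bsub>H\<^esub> (y \<otimes>\<^bsub>H\<^esub> inv\<^bsub>H\<^esub> x) \<otimes>\<^bsub>H\<^esub> inv\<^bsub>H\<^esub> (inv\<^bsub>H\<^esub> x) \<in> A"
        by (rule s.conj_K) (use \<open>x \<in> B\<close> a in auto)
      also have "inv\<^bsub>H\<^esub> x \<otimes>\<^bsub>H\<^esub> (y \<otimes>\<^bsub>H\<^esub> inv\<^bsub>H\<^esub> x) \<otimes>\<^bsub>H\<^esub> inv\<^bsub>H\<^esub> (inv\<^bsub>H\<^esub> x) = inv\<^bsub>H\<^esub> x \<otimes>\<^bsub>H\<^esub> y"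
        using \<open>x \<in> B\<close> y s.PG by (simp add: s.m_assoc)
      finally have "inv\<^bsub>H\<^esub> x \<otimes>\<^bsub>H\<^esub> y \<in> A" .
      moreover have "y = x \<otimes>\<^bsub>H\<^esub> (inv\<^bsub>H\<^esub> x \<otimes>\<^bsub>H\<^esub> y)" using \<open>x \<in> B\<close> y s.PG by (simp add: s.m_assoc[symmetric])
      ultimately show "y \<in> X <#>\<^bsub>H\<^esub> A" using x(1) unfolding set_mult_def by blast
    qed
    ultimately show ?thesis by blast
  qed
  have "B \<inter> C = A \<inter> D \<longleftrightarrow> (\<forall>x \<in> B \<inter> D. x \<in> A \<longleftrightarrow> x \<in> C)"
    using group_section.KP[OF assms(1)] group_section.KP[OF assms(2)] by blast
  then show ?thesis
    unfolding linked_def using aux[OF assms(1), of "B \<inter> D"] aux[OF assms(2), of "B \<inter> D"] by simp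
qed

text \<open>The isomorphism \<open>\<beta>\<close> is obtained by representing cosets of \<open>C\<close> by elements of \<open>B \<inter> D\<close>; it is
  unique because such representatives exist in each coset.\<close>

lemma linked_beta:
  assumes B: "group_section H B A" and D: "group_section H D C" and l: "linked H B A D C"
  shows "section_iso H B A H D C (beta H B A D C)"
    and "\<And>x. x \<in> B \<Longrightarrow> x \<in> D \<Longrightarrow> beta H B A D C (C #>\<^bsub>H\<^esub> x) = A #>\<^bsub>H\<^esub> x"
proof -
  interpret b: group_section H B A by fact
  interpret d: group_section H D C by fact
  have l1: "x \<in> A \<longleftrightarrow> x \<in> C" if "x \<in> B" "x \<in> D" for x using l that unfolding linked_iff[OF B D] by blast
  have l2: "\<exists>x. x \<in> B \<and> x \<in> D \<and> A #>\<^bsub>H\<^esub> x = A #>\<^bsub>H\<^esub> y" if "y \<in> B" for y using l that unfolding linked_iff[OF B D] by blast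
  have l3: "\<exists>x. x \<in> B \<and> x \<in> D \<and> C #>\<^bsub>H\<^esub> x = C #>\<^bsub>H\<^esub> y" if "y \<in> D" for y using l that unfolding linked_iff[OF B D] by blast
  have key: "A #>\<^bsub>H\<^esub> x = A #>\<^bsub>H\<^esub> y \<longleftrightarrow> C #>\<^bsub>H\<^esub> x = C #>\<^bsub>H\<^esub> y" if "x \<in> B" "x \<in> D" "y \<in> B" "y \<in> D" for x y
    using that l1[of "x \<otimes>\<^bsub>H\<^esub> inv\<^bsub>H\<^esub> y"] by (simp add: b.coset_eq d.coset_eq)
  have car: "\<exists>x. x \<in> B \<and> x \<in> D \<and> X = C #>\<^bsub>H\<^esub> x" if X: "X \<in> carrier (subquot H D C)" for X
    using X l3 unfolding d.car by (metis imageE)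
  define f where "f = restrict (\<lambda>X. A #>\<^bsub>H\<^esub> (SOME x. x \<in> B \<and> x \<in> D \<and> X = C #>\<^bsub>H\<^esub> x)) (carrier (subquot H D C))"
  have f: "f (C #>\<^bsub>H\<^esub> x) = A #>\<^bsub>H\<^esub> x" if x: "x \<in> B" "x \<in> D" for x
  proof -
    have "\<exists>y. y \<in> B \<and> y \<in> D \<and> C #>\<^bsub>H\<^esub> x = C #>\<^bsub>H\<^esub> y" using x by blast
    from someI_ex[OF this] show ?thesis
      unfolding f_def restrict_apply'[OF d.in_car[OF x(2)]] using key x by metis
  qed
  have f_iso: "f \<in> iso (subquot H D C) (subquot H B A)"
  proof (rule isoI)
    show "f \<in> hom (subquot H D C) (subquot H B A)"
    proof (rule homI)
      fix X assume "X \<in> carrier (subquot H D C)"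
      then obtain x where x: "x \<in> B" "x \<in> D" "X = C #>\<^bsub>H\<^esub> x" using car by blast
      then show "f X \<in> carrier (subquot H B A)" using f b.in_car by metis
      fix Y assume "Y \<in> carrier (subquot H D C)"
      then obtain y where y: "y \<in> B" "y \<in> D" "Y = C #>\<^bsub>H\<^esub> y" using car by blast
      show "f (X \<otimes>\<^bsub>subquot H D C\<^esub> Y) = f X \<otimes>\<^bsub>subquot H B A\<^esub> f Y"
        unfolding x(3) y(3) d.mult_Q[OF x(2) y(2)] f[OF x(1,2)] f[OF y(1,2)] b.mult_Q[OF x(1) y(1)]
        by (rule f) (use x y in auto)
    qed
    show "bij_betw f (carrier (subquot H D C)) (carrier (subquot H B A))"
    proof (rule bij_betw_imageI)
      show "inj_on f (carrier (subquot H D C))"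
      proof (rule inj_onI)
        fix X Y assume X: "X \<in> carrier (subquot H D C)" and Y: "Y \<in> carrier (subquot H D C)" and e: "f X = f Y"
        obtain x where x: "x \<in> B" "x \<in> D" "X = C #>\<^bsub>H\<^esub> x" using car[OF X] by blast
        obtain y where y: "y \<in> B" "y \<in> D" "Y = C #>\<^bsub>H\<^esub> y" using car[OF Y] by blast
        have "A #>\<^bsub>H\<^esub> x = A #>\<^bsub>H\<^esub> y" using e f[OF x(1,2)] f[OF y(1,2)] x(3) y(3) by simp
        then show "X = Y" using key[OF x(1,2) y(1,2)] x(3) y(3) by simp
      qed
      show "f ` carrier (subquot H D C) = carrier (subquot H B A)"
      proof (intro equalityI subsetI)
        fix X assume "X \<in> f ` carrier (subquot H D C)"
        then obtain Y where Y: "Y \<in> carrier (subquot H D C)" "X = f Y" by blast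
        obtain y where y: "y \<in> B" "y \<in> D" "Y = C #>\<^bsub>H\<^esub> y" using car[OF Y(1)] by blast
        show "X \<in> carrier (subquot H B A)" unfolding Y(2) y(3) f[OF y(1,2)] by (rule b.in_car[OF y(1)])
      next
        fix X assume "X \<in> carrier (subquot H B A)"
        then obtain y where y: "y \<in> B" "X = A #>\<^bsub>H\<^esub> y" unfolding b.car by blast
        then obtain x where x: "x \<in> B" "x \<in> D" "A #>\<^bsub>H\<^esub> x = A #>\<^bsub>H\<^esub> y" using l2 by blast
        show "X \<in> f ` carrier (subquot H D C)"
          by (rule image_eqI[OF _ d.in_car[OF x(2)]]) (simp only: f[OF x(1,2)] x(3) y(2))
      qed
    qed
  qed
  have "f \<in> extensional (carrier (subquot H D C))" by (simp add: f_def)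
  then have P: "f \<in> iso (subquot H D C) (subquot H B A) \<and> f \<in> extensional (carrier (subquot H D C)) \<and>
     (\<forall>x \<in> B \<inter> D. f (C #>\<^bsub>H\<^esub> x) = A #>\<^bsub>H\<^esub> x)" using f_iso f by blast
  have "beta H B A D C = f"
    unfolding beta_def
  proof (rule the_equality, rule P)
    fix g assume g: "g \<in> iso (subquot H D C) (subquot H B A) \<and> g \<in> extensional (carrier (subquot H D C)) \<and>
     (\<forall>x \<in> B \<inter> D. g (C #>\<^bsub>H\<^esub> x) = A #>\<^bsub>H\<^esub> x)"
    show "g = f"
    proof (rule extensionalityI)
      show "g \<in> extensional (carrier (subquot H D C))" using g by blast
      show "f \<in> extensional (carrier (subquot H D C))" using P by blast
      show "g X = f X" if X: "X \<in> carrier (subquot H D C)" for X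
      proof -
        obtain x where "x \<in> B" "x \<in> D" "X = C #>\<^bsub>H\<^esub> x" using car[OF X] by blast
        then show ?thesis using g f by simp
      qed
    qed
  qed
  then show "section_iso H B A H D C (beta H B A D C)"
    "\<And>x. x \<in> B \<Longrightarrow> x \<in> D \<Longrightarrow> beta H B A D C (C #>\<^bsub>H\<^esub> x) = A #>\<^bsub>H\<^esub> x"
    using f_iso f B D by (simp_all add: section_iso_def section_iso_axioms_def)
qed

text \<open>Pairs of the composite pass through a common element of \<open>B \<inter> D\<close>, and linkedness provides one
  in each coset.\<close>

lemma goursat_comp_linked:
  assumes a: "section_iso G P K H B A \<sigma>" and b: "section_iso H D C J Q N \<rho>" and l: "linked H B A D C"
  shows "goursat G P K \<sigma> H B A O goursat H D C \<rho> J Q N = goursat G P K (\<sigma> \<circ> beta H B A D C \<circ> \<rho>) J Q N"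
    and "section_iso G P K J Q N (\<sigma> \<circ> beta H B A D C \<circ> \<rho>)"
proof -
  interpret a: section_iso G P K H B A \<sigma> by fact
  interpret b: section_iso H D C J Q N \<rho> by fact
  note BD = a.s2.group_section_axioms b.s1.group_section_axioms
  have l3: "\<exists>x. x \<in> B \<and> x \<in> D \<and> C #>\<^bsub>H\<^esub> x = C #>\<^bsub>H\<^esub> y" if "y \<in> D" for y using l that unfolding linked_iff[OF BD] by blast
  note beta = linked_beta(2)[OF BD l]
  have "(g, j) \<in> a.L O b.L \<longleftrightarrow> (g, j) \<in> goursat G P K (\<sigma> \<circ> beta H B A D C \<circ> \<rho>) J Q N" for g j
  proof
    assume "(g, j) \<in> a.L O b.L"
    then obtain x where "(g, x) \<in> a.L" "(x, j) \<in> b.L" by blast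
    then show "(g, j) \<in> goursat G P K (\<sigma> \<circ> beta H B A D C \<circ> \<rho>) J Q N"
      using beta by (simp add: goursat_def)
  next
    assume gj: "(g, j) \<in> goursat G P K (\<sigma> \<circ> beta H B A D C \<circ> \<rho>) J Q N"
    then have "j \<in> Q" by (simp add: goursat_def)
    then obtain y where y: "y \<in> D" "\<rho> (N #>\<^bsub>J\<^esub> j) = C #>\<^bsub>H\<^esub> y" using b.ex_l by blast
    obtain x where x: "x \<in> B" "x \<in> D" "C #>\<^bsub>H\<^esub> x = C #>\<^bsub>H\<^esub> y" using l3[OF y(1)] by blast
    have "(g, x) \<in> a.L" "(x, j) \<in> b.L" using gj x y beta[OF x(1,2)] by (simp_all add: goursat_def)
    then show "(g, j) \<in> a.L O b.L" by blast
  qed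
  then show "a.L O b.L = goursat G P K (\<sigma> \<circ> beta H B A D C \<circ> \<rho>) J Q N" by auto
  show "section_iso G P K J Q N (\<sigma> \<circ> beta H B A D C \<circ> \<rho>)"
    by (rule section_iso_comp[OF section_iso_comp[OF a linked_beta(1)[OF BD l]] b])
qed

text \<open>Conversely, if the composite of two isomorphisms between quotients still is an isomorphism
  between the outer quotients, then no coset of the inner sections is lost, so that each of them
  meets \<open>B \<inter> D\<close>.\<close>

lemma linked_of_comp:
  assumes a: "section_iso G P K H B A \<sigma>" and b: "section_iso H D C J Q N \<rho>" and c: "section_iso G P K J Q N \<alpha>"
    and eq: "goursat G P K \<sigma> H B A O goursat H D C \<rho> J Q N = goursat G P K \<alpha> J Q N"
  shows "linked H B A D C"
proof -
  interpret a: section_iso G P K H B A \<sigma> by fact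
  interpret b: section_iso H D C J Q N \<rho> by fact
  interpret c: section_iso G P K J Q N \<alpha> by fact
  show ?thesis
    unfolding linked_iff[OF a.s2.group_section_axioms b.s1.group_section_axioms]
  proof (intro conjI ballI)
    fix y assume y: "y \<in> B"
    obtain g where g: "g \<in> P" "\<sigma> (A #>\<^bsub>H\<^esub> y) = K #>\<^bsub>G\<^esub> g" using a.ex_l[OF y] by blast
    obtain j where "j \<in> Q" "\<alpha> (N #>\<^bsub>J\<^esub> j) = K #>\<^bsub>G\<^esub> g" using c.ex_r[OF g(1)] by blast
    then have "(g, j) \<in> a.L O b.L" unfolding eq c.mem_L using g by blast
    then obtain x where "(g, x) \<in> a.L" "(x, j) \<in> b.L" by blast
    then have "x \<in> B \<inter> D" "A #>\<^bsub>H\<^esub> x = A #>\<^bsub>H\<^esub> y"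
      unfolding a.mem_L b.mem_L using a.inj[of x y] y g by auto
    then show "\<exists>x\<in>B \<inter> D. A #>\<^bsub>H\<^esub> x = A #>\<^bsub>H\<^esub> y" by blast
  next
    fix y assume y: "y \<in> D"
    obtain j where j: "j \<in> Q" "\<rho> (N #>\<^bsub>J\<^esub> j) = C #>\<^bsub>H\<^esub> y" using b.ex_r[OF y] by blast
    obtain g where "g \<in> P" "\<alpha> (N #>\<^bsub>J\<^esub> j) = K #>\<^bsub>G\<^esub> g" using c.ex_l[OF j(1)] by blast
    then have "(g, j) \<in> a.L O b.L" unfolding eq c.mem_L using j by blast
    then obtain x where "(g, x) \<in> a.L" "(x, j) \<in> b.L" by blast
    then have "x \<in> B \<inter> D" "C #>\<^bsub>H\<^esub> x = C #>\<^bsub>H\<^esub> y"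
      unfolding a.mem_L b.mem_L using j by auto
    then show "\<exists>x\<in>B \<inter> D. C #>\<^bsub>H\<^esub> x = C #>\<^bsub>H\<^esub> y" by blast
  next
    fix x assume x: "x \<in> B \<inter> D"
    show "x \<in> A \<longleftrightarrow> x \<in> C"
    proof
      assume xA: "x \<in> A"
      obtain j where j: "j \<in> Q" "\<rho> (N #>\<^bsub>J\<^esub> j) = C #>\<^bsub>H\<^esub> x" using b.ex_r x by blast
      have "\<sigma> (A #>\<^bsub>H\<^esub> x) = K" using xA a.s2.coset_K[of x] x a.eta_one by simp
      then have "(\<one>\<^bsub>G\<^esub>, x) \<in> a.L" using x a.s1.coset_one by (simp add: a.mem_L)
      moreover have "(x, j) \<in> b.L" using x j by (simp add: b.mem_L)
      ultimately have "(\<one>\<^bsub>G\<^esub>, j) \<in> c.L" unfolding eq[symmetric] by blast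
      then have "j \<in> k2 G c.L" by (simp add: k2_def)
      then have "N #>\<^bsub>J\<^esub> j = N" using c.k2_L b.s2.coset_K j by simp
      then show "x \<in> C" using j x b.eta_one b.s1.coset_K[of x] by simp
    next
      assume xC: "x \<in> C"
      obtain g where g: "g \<in> P" "\<sigma> (A #>\<^bsub>H\<^esub> x) = K #>\<^bsub>G\<^esub> g" using a.ex_l x by blast
      have "\<rho> N = C #>\<^bsub>H\<^esub> x" using xC b.s1.coset_K[of x] x b.eta_one by simp
      then have "(x, \<one>\<^bsub>J\<^esub>) \<in> b.L" using x b.s2.coset_one by (simp add: b.mem_L)
      moreover have "(g, x) \<in> a.L" using x g by (simp add: a.mem_L)
      ultimately have "(g, \<one>\<^bsub>J\<^esub>) \<in> c.L" unfolding eq[symmetric] by blast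
      then have "g \<in> k1 J c.L" by (simp add: k1_def)
      then have "K #>\<^bsub>G\<^esub> g = K" using c.k1_L a.s1.coset_K g by simp
      then have "x \<in> k2 G a.L" using x g a.s1.coset_one by (simp add: k2_def a.mem_L)
      then show "x \<in> A" using a.k2_L by simp
    qed
  qed
qed

lemma conj_section:
  assumes s: "group_section H D C" and h: "h \<in> carrier H"
  shows "group_section H (conj_set H h D) (conj_set H h C)"
    and "section_iso H (conj_set H h D) (conj_set H h C) H D C (conj_set H h)"
    and "\<And>x. x \<in> D \<Longrightarrow> conj_set H h (C #>\<^bsub>H\<^esub> x) = conj_set H h C #>\<^bsub>H\<^esub> (h \<otimes>\<^bsub>H\<^esub> x \<otimes>\<^bsub>H\<^esub> inv\<^bsub>H\<^esub> h)"
proof -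
  interpret s: group_section H D C by fact
  define c where "c x = h \<otimes>\<^bsub>H\<^esub> x \<otimes>\<^bsub>H\<^esub> inv\<^bsub>H\<^esub> h" for x
  have cs: "conj_set H h U = c ` U" for U by (simp add: conj_set_def c_def[abs_def])
  have c_mult: "c (x \<otimes>\<^bsub>H\<^esub> y) = c x \<otimes>\<^bsub>H\<^esub> c y" if "x \<in> carrier H" "y \<in> carrier H" for x y
  proof -
    have "inv\<^bsub>H\<^esub> h \<otimes>\<^bsub>H\<^esub> (h \<otimes>\<^bsub>H\<^esub> (y \<otimes>\<^bsub>H\<^esub> inv\<^bsub>H\<^esub> h)) = y \<otimes>\<^bsub>H\<^esub> inv\<^bsub>H\<^esub> h"
      using that h by (simp add: s.m_assoc[symmetric])
    then show ?thesis unfolding c_def using that h by (simp add: s.m_assoc)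
  qed
  have c_closed: "c x \<in> carrier H" if "x \<in> carrier H" for x using that h by (simp add: c_def)
  have c_hom: "group_hom H H c"
    by unfold_locales (auto simp: hom_def c_closed c_mult)
  interpret c: group_hom H H c by fact
  have c_inj: "inj_on c (carrier H)"
    by (rule inj_onI) (use h in \<open>simp add: c_def\<close>)
  have subD: "subgroup (c ` D) H" by (rule c.subgroup_img_is_subgroup[OF s.P_sub])
  have "c \<in> iso (H\<lparr>carrier := D\<rparr>) (H\<lparr>carrier := c ` D\<rparr>)"
  proof (rule isoI)
    show "c \<in> hom (H\<lparr>carrier := D\<rparr>) (H\<lparr>carrier := c ` D\<rparr>)"
      by (rule homI) (simp_all add: c_mult s.PG)
    show "bij_betw c (carrier (H\<lparr>carrier := D\<rparr>)) (carrier (H\<lparr>carrier := c ` D\<rparr>))"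
      using inj_on_subset[OF c_inj subgroup.subset[OF s.P_sub]] by (simp add: inj_on_imp_bij_betw)
  qed
  from iso_normal_subgroup[OF this s.subgroup_imp_group[OF s.P_sub] s.subgroup_imp_group[OF subD] s.K_norm]
  have nC: "c ` C \<lhd> H\<lparr>carrier := c ` D\<rparr>" .
  show "group_section H (conj_set H h D) (conj_set H h C)"
    unfolding cs by unfold_locales (simp add: is_section_def subD nC)
  then interpret d: group_section H "c ` D" "c ` C" unfolding cs .
  have coset: "c ` (C #>\<^bsub>H\<^esub> x) = c ` C #>\<^bsub>H\<^esub> c x" if "x \<in> D" for x
    unfolding r_coset_def using that c_mult s.PG s.KP by (auto simp: image_UN)
  then show "\<And>x. x \<in> D \<Longrightarrow> conj_set H h (C #>\<^bsub>H\<^esub> x) = conj_set H h C #>\<^bsub>H\<^esub> (h \<otimes>\<^bsub>H\<^esub> x \<otimes>\<^bsub>H\<^esub> inv\<^bsub>H\<^esub> h)"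
    unfolding cs c_def .
  have "(\<lambda>X. c ` X) \<in> iso (subquot H D C) (subquot H (c ` D) (c ` C))"
  proof (rule isoI)
    show "(\<lambda>X. c ` X) \<in> hom (subquot H D C) (subquot H (c ` D) (c ` C))"
    proof (rule homI)
      fix X assume "X \<in> carrier (subquot H D C)"
      then obtain x where x: "x \<in> D" "X = C #>\<^bsub>H\<^esub> x" unfolding s.car by blast
      then show "c ` X \<in> carrier (subquot H (c ` D) (c ` C))" using coset d.in_car by (metis imageI)
      fix Y assume "Y \<in> carrier (subquot H D C)"
      then obtain y where y: "y \<in> D" "Y = C #>\<^bsub>H\<^esub> y" unfolding s.car by blast
      show "c ` (X \<otimes>\<^bsub>subquot H D C\<^esub> Y) = c ` X \<otimes>\<^bsub>subquot H (c ` D) (c ` C)\<^esub> c ` Y"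
        unfolding x(2) y(2) s.mult_Q[OF x(1) y(1)] coset[OF x(1)] coset[OF y(1)] d.mult_Q[OF imageI[OF x(1)] imageI[OF y(1)]]
        coset[OF s.PK_closed(3)[OF x(1) y(1)]] using c_mult x y s.PG by simp
    qed
    show "bij_betw (\<lambda>X. c ` X) (carrier (subquot H D C)) (carrier (subquot H (c ` D) (c ` C)))"
    proof (rule bij_betw_imageI)
      show "inj_on (\<lambda>X. c ` X) (carrier (subquot H D C))"
      proof (rule inj_onI)
        fix X Y assume XY: "X \<in> carrier (subquot H D C)" "Y \<in> carrier (subquot H D C)" "c ` X = c ` Y"
        have "X \<subseteq> carrier H" "Y \<subseteq> carrier H"
          using XY(1,2) s.mem_coset s.PG unfolding s.car by blast+
        then show "X = Y" using XY(3) inj_on_image_eq_iff[OF c_inj] by blast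
      qed
      show "(\<lambda>X. c ` X) ` carrier (subquot H D C) = carrier (subquot H (c ` D) (c ` C))"
        unfolding s.car d.car image_image by (rule image_cong) (simp_all add: coset)
    qed
  qed
  then show "section_iso H (conj_set H h D) (conj_set H h C) H D C (conj_set H h)"
    unfolding cs cs[abs_def] by unfold_locales
qed

lemma Delta_comp_goursat:
  assumes b: "section_iso H D C J Q N \<rho>" and h: "h \<in> carrier H"
  shows "Delta H h O goursat H D C \<rho> J Q N = goursat H (conj_set H h D) (conj_set H h C) (conj_set H h \<circ> \<rho>) J Q N"
    and "section_iso H (conj_set H h D) (conj_set H h C) J Q N (conj_set H h \<circ> \<rho>)"
proof -
  interpret b: section_iso H D C J Q N \<rho> by fact
  note c = conj_section[OF b.s1.group_section_axioms h]
  interpret c: section_iso H "conj_set H h D" "conj_set H h C" H D C "conj_set H h" by (rule c(2))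
  have "(g, j) \<in> Delta H h O b.L \<longleftrightarrow> (g, j) \<in> goursat H (conj_set H h D) (conj_set H h C) (conj_set H h \<circ> \<rho>) J Q N" for g j
  proof
    assume "(g, j) \<in> Delta H h O b.L"
    then obtain x where x: "g = h \<otimes>\<^bsub>H\<^esub> x \<otimes>\<^bsub>H\<^esub> inv\<^bsub>H\<^esub> h" "(x, j) \<in> b.L" by (auto simp: Delta_def)
    then show "(g, j) \<in> goursat H (conj_set H h D) (conj_set H h C) (conj_set H h \<circ> \<rho>) J Q N"
      using c(3) by (auto simp: goursat_def conj_set_def)
  next
    assume gj: "(g, j) \<in> goursat H (conj_set H h D) (conj_set H h C) (conj_set H h \<circ> \<rho>) J Q N"
    then obtain x where x: "x \<in> D" "g = h \<otimes>\<^bsub>H\<^esub> x \<otimes>\<^bsub>H\<^esub> inv\<^bsub>H\<^esub> h" and j: "j \<in> Q"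
      by (auto simp: goursat_def conj_set_def)
    obtain y where y: "y \<in> D" "\<rho> (N #>\<^bsub>J\<^esub> j) = C #>\<^bsub>H\<^esub> y" using b.ex_l[OF j] by blast
    have "conj_set H h (C #>\<^bsub>H\<^esub> y) = conj_set H h (C #>\<^bsub>H\<^esub> x)"
      using gj y c(3)[OF x(1)] x(2) by (simp add: goursat_def)
    then have "C #>\<^bsub>H\<^esub> y = C #>\<^bsub>H\<^esub> x" by (rule c.inj[OF y(1) x(1)])
    then have "(x, j) \<in> b.L" using x y j by (simp add: b.mem_L)
    moreover have "(g, x) \<in> Delta H h" using x b.s1.PG by (auto simp: Delta_def)
    ultimately show "(g, j) \<in> Delta H h O b.L" by blast
  qed
  then show "Delta H h O b.L = goursat H (conj_set H h D) (conj_set H h C) (conj_set H h \<circ> \<rho>) J Q N" by auto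
  show "section_iso H (conj_set H h D) (conj_set H h C) J Q N (conj_set H h \<circ> \<rho>)"
    by (rule section_iso_comp[OF c(2) b])
qed

text \<open>Since \<open>(P, K, id, P, K)\<close> has first projection \<open>P\<close> and contains \<open>K \<times> 1\<close>, absorbing it on the
  left confines \<open>p\<^sub>1(X)\<close> to \<open>P\<close> and forces \<open>k\<^sub>1(X)\<close> to contain \<open>K\<close>.\<close>

lemma left_stable:
  assumes "group_section G P K" "(\<one>\<^bsub>G\<^esub>, \<one>\<^bsub>H\<^esub>) \<in> X" "e_sec G P K O X = X"
  shows "fst ` X \<subseteq> P" "K \<subseteq> k1 H X"
proof -
  interpret i: section_iso G P K G P K id by (rule section_iso_id[OF assms(1)])
  note X = assms(2,3)[unfolded e_sec_def]
  show "fst ` X \<subseteq> P"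
  proof
    fix g assume "g \<in> fst ` X"
    then obtain h where "(g, h) \<in> i.L O X" using X(2) unfolding fst_in_image_iff by blast
    then show "g \<in> P" using i.mem_L by blast
  qed
  show "K \<subseteq> k1 H X"
  proof
    fix g assume "g \<in> K"
    then have "(g, \<one>\<^bsub>G\<^esub>) \<in> i.L" using i.k1_L by (auto simp: k1_def)
    then have "(g, \<one>\<^bsub>H\<^esub>) \<in> i.L O X" using X(1) by blast
    then show "g \<in> k1 H X" using X(2) by (simp add: k1_def)
  qed
qed

lemma right_stable:
  assumes "group_section G P K" "(\<one>\<^bsub>H\<^esub>, \<one>\<^bsub>G\<^esub>) \<in> X" "X O e_sec G P K = X"
  shows "snd ` X \<subseteq> P" "K \<subseteq> k2 H X"
proof -
  interpret i: section_iso G P K G P K id by (rule section_iso_id[OF assms(1)])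
  note X = assms(2,3)[unfolded e_sec_def]
  show "snd ` X \<subseteq> P"
  proof
    fix g assume "g \<in> snd ` X"
    then obtain h where "(h, g) \<in> X O i.L" using X(2) unfolding snd_in_image_iff by blast
    then show "g \<in> P" using i.mem_L by blast
  qed
  show "K \<subseteq> k2 H X"
  proof
    fix g assume "g \<in> K"
    then have "(\<one>\<^bsub>G\<^esub>, g) \<in> i.L" using i.k2_L by (auto simp: k2_def)
    then have "(\<one>\<^bsub>H\<^esub>, g) \<in> X O i.L" using X(1) by blast
    then show "g \<in> k2 H X" using X(2) by (simp add: k2_def)
  qed
qed

text \<open>Composition can only shrink \<open>p\<^sub>1\<close> and enlarge \<open>k\<^sub>1\<close>, while \<open>X\<close> already satisfies \<open>p\<^sub>1(X) \<subseteq> P\<close>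
  and \<open>K \<subseteq> k\<^sub>1(X)\<close>. So if the composite has the outer sections \<open>(P, K)\<close> and \<open>(Q, N)\<close>, then these
  are the outer sections of \<open>X\<close> and \<open>Y\<close>.\<close>

lemma invertible_composite_ends:
  assumes s: "section_iso G P K J Q N \<alpha>" and eq: "X O Y = goursat G P K \<alpha> J Q N"
    and X: "(\<one>\<^bsub>G\<^esub>, \<one>\<^bsub>H\<^esub>) \<in> X" "e_sec G P K O X = X" and Y: "(\<one>\<^bsub>H\<^esub>, \<one>\<^bsub>J\<^esub>) \<in> Y" "Y O e_sec J Q N = Y"
  shows "fst ` X = P" "k1 H X = K" "snd ` Y = Q" "k2 H Y = N"
proof -
  interpret s: section_iso G P K J Q N \<alpha> by fact
  note l = left_stable[OF s.s1.group_section_axioms X] and r = right_stable[OF s.s2.group_section_axioms Y]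
  show "fst ` X = P"
  proof (rule equalityI[OF l(1)], rule subsetI)
    fix g assume "g \<in> P"
    then have "g \<in> fst ` (X O Y)" using s.fst_L eq by simp
    then show "g \<in> fst ` X" unfolding fst_in_image_iff by blast
  qed
  show "snd ` Y = Q"
  proof (rule equalityI[OF r(1)], rule subsetI)
    fix g assume "g \<in> Q"
    then have "g \<in> snd ` (X O Y)" using s.snd_L eq by simp
    then show "g \<in> snd ` Y" unfolding snd_in_image_iff by blast
  qed
  show "k1 H X = K"
  proof (rule equalityI[OF subsetI l(2)])
    fix g assume "g \<in> k1 H X"
    then have "(g, \<one>\<^bsub>J\<^esub>) \<in> X O Y" using Y(1) by (auto simp: k1_def)
    then show "g \<in> K" using s.k1_L unfolding eq by (auto simp: k1_def)
  qed
  show "k2 H Y = N"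
  proof (rule equalityI[OF subsetI r(2)])
    fix g assume "g \<in> k2 H Y"
    then have "(\<one>\<^bsub>G\<^esub>, g) \<in> X O Y" using X(1) by (auto simp: k2_def)
    then show "g \<in> N" using s.k2_L unfolding eq by (auto simp: k2_def)
  qed
qed

text \<open>The quotients have the same order, but \<open>|P'| \<le> |P|\<close> and \<open>|K| \<le> |K'|\<close>.\<close>

lemma nested_sections_eq:
  assumes a: "section_iso G P K G P' K' \<sigma>" and fin: "finite (carrier G)" and sub: "P' \<subseteq> P" "K \<subseteq> K'"
  shows "P' = P" "K' = K"
proof -
  interpret a: section_iso G P K G P' K' \<sigma> by fact
  have lag: "card (carrier (subquot G P K)) * card K = card P" if "group_section G P K" for P K
  proof -
    interpret q: group_section G P K by fact
    have "card (rcosets\<^bsub>G\<lparr>carrier := P\<rparr>\<^esub> K) * card K = order (G\<lparr>carrier := P\<rparr>)"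
      by (rule group.lagrange[OF a.s1.subgroup_imp_group[OF q.P_sub] q.K_subP])
    then show ?thesis by (simp add: FactGroup_def order_def)
  qed
  have fP: "finite P" "finite P'" "finite K" "finite K'"
    using fin a.s1.PG a.s2.PG a.s1.KP a.s2.KP by (meson finite_subset subsetI)+
  have n: "card (carrier (subquot G P K)) = card (carrier (subquot G P' K'))"
    using bij_betw_same_card[OF a.bij] by simp
  have "P' \<noteq> {}" "K \<noteq> {}" using a.s2.PK_closed(1) a.s1.PK_closed(2) by blast+
  then have pos: "card P' > 0" "card K > 0" using fP by (simp_all add: card_gt_0_iff)
  have le: "card P' \<le> card P" "card K \<le> card K'" using sub fP by (auto intro: card_mono)
  define n where "n = card (carrier (subquot G P K))"
  have eq: "n * card K = card P" "n * card K' = card P'"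
    using lag[OF a.s1.group_section_axioms] lag[OF a.s2.group_section_axioms] n unfolding n_def by simp_all
  have "n > 0" using eq pos by (metis gr0I mult_0 less_irrefl)
  have "card K' \<le> card K" using eq le \<open>n > 0\<close> by (metis mult_le_cancel1)
  then have K: "card K' = card K" using le by simp
  then show "K' = K" using sub fP card_subset_eq by metis
  have "card P' = card P" using eq K by simp
  then show "P' = P" using sub fP card_subset_eq by metis
qed

section \<open>The twisted algebra\<close>

lemma card_eq_mult_fibres:
  assumes "finite Z" "\<And>y. y \<in> f ` Z \<Longrightarrow> card {z \<in> Z. f z = y} = c"
  shows "card Z = card (f ` Z) * c"
proof -
  have "card Z = (\<Sum>z\<in>Z. 1)" by simp
  also have "\<dots> = (\<Sum>y\<in>f ` Z. \<Sum>z\<in>{z. z \<in> Z \<and> f z = y}. 1)"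
    by (rule sum.image_gen[OF assms(1)])
  also have "\<dots> = (\<Sum>y\<in>f ` Z. c)" using assms(2) by (intro sum.cong) auto
  finally show ?thesis by simp
qed

text \<open>The identity behind the associativity of the twisted product. Both sides count the pairs \<open>(h,
  k) \<in> M\<close> with \<open>(1, h) \<in> L\<close> and \<open>(k, 1) \<in> N\<close>: the fibres of the projection to \<open>k\<close> are cosets of
  \<open>k\<^sub>2(L) \<inter> k\<^sub>1(M)\<close>, those of the projection to \<open>h\<close> are cosets of \<open>k\<^sub>2(M) \<inter> k\<^sub>1(N)\<close>.\<close>

lemma card_cocycle:
  assumes G: "group G" and H: "group H" and K: "group K" and J: "group J"
    and fin: "finite (carrier H)" "finite (carrier K)"
    and L: "subgroup L (G \<times>\<times> H)" and M: "subgroup M (H \<times>\<times> K)" and N: "subgroup N (K \<times>\<times> J)"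
  shows "card (k2 G L \<inter> k1 K M) * card (k2 G (L O M) \<inter> k1 J N)
       = card (k2 H M \<inter> k1 J N) * card (k2 G L \<inter> k1 J (M O N))"
proof -
  interpret G: group G by fact
  interpret H: group H by fact
  interpret K: group K by fact
  interpret J: group J by fact
  have LG: "g \<in> carrier G" "h \<in> carrier H" if "(g, h) \<in> L" for g h
    using subgroup.subset[OF L] that by (auto simp: DirProd_def)
  have MG: "g \<in> carrier H" "h \<in> carrier K" if "(g, h) \<in> M" for g h
    using subgroup.subset[OF M] that by (auto simp: DirProd_def)
  have NG: "g \<in> carrier K" "h \<in> carrier J" if "(g, h) \<in> N" for g h
    using subgroup.subset[OF N] that by (auto simp: DirProd_def)
  have L_mult: "(\<one>\<^bsub>G\<^esub>, h \<otimes>\<^bsub>H\<^esub> h') \<in> L" if "(\<one>\<^bsub>G\<^esub>, h) \<in> L" "(\<one>\<^bsub>G\<^esub>, h') \<in> L" for h h'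
    using subgroup.m_closed[OF L that] by simp
  have L_inv: "(\<one>\<^bsub>G\<^esub>, inv\<^bsub>H\<^esub> h) \<in> L" if "(\<one>\<^bsub>G\<^esub>, h) \<in> L" for h
    using subgroup.m_inv_closed[OF L that] inv_DirProd[OF G H LG[OF that]] by simp
  have N_mult: "(h \<otimes>\<^bsub>K\<^esub> h', \<one>\<^bsub>J\<^esub>) \<in> N" if "(h, \<one>\<^bsub>J\<^esub>) \<in> N" "(h', \<one>\<^bsub>J\<^esub>) \<in> N" for h h'
    using subgroup.m_closed[OF N that] by simp
  have N_inv: "(inv\<^bsub>K\<^esub> h, \<one>\<^bsub>J\<^esub>) \<in> N" if "(h, \<one>\<^bsub>J\<^esub>) \<in> N" for h
    using subgroup.m_inv_closed[OF N that] inv_DirProd[OF K J NG[OF that]] by simp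
  have M_mult: "(h \<otimes>\<^bsub>H\<^esub> h', k \<otimes>\<^bsub>K\<^esub> k') \<in> M" if "(h, k) \<in> M" "(h', k') \<in> M" for h h' k k'
    using subgroup.m_closed[OF M that] by simp
  have M_inv: "(inv\<^bsub>H\<^esub> h, inv\<^bsub>K\<^esub> k) \<in> M" if "(h, k) \<in> M" for h k
    using subgroup.m_inv_closed[OF M that] inv_DirProd[OF H K MG[OF that]] by simp
  define Z where "Z = {(h, k). (h, k) \<in> M \<and> (\<one>\<^bsub>G\<^esub>, h) \<in> L \<and> (k, \<one>\<^bsub>J\<^esub>) \<in> N}"
  have finZ: "finite Z"
    by (rule finite_subset[of _ "carrier H \<times> carrier K"]) (use MG fin in \<open>auto simp: Z_def\<close>)
  have "snd ` Z = k2 G (L O M) \<inter> k1 J N"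
    unfolding Z_def k1_def k2_def by (force simp: image_iff)
  moreover have "card {z \<in> Z. snd z = k} = card (k2 G L \<inter> k1 K M)" if k: "k \<in> snd ` Z" for k
  proof -
    obtain h0 where h0: "(h0, k) \<in> M" "(\<one>\<^bsub>G\<^esub>, h0) \<in> L" "(k, \<one>\<^bsub>J\<^esub>) \<in> N" using k by (auto simp: Z_def)
    note c = MG[OF h0(1)]
    have "bij_betw (\<lambda>h. (h0 \<otimes>\<^bsub>H\<^esub> h, k)) (k2 G L \<inter> k1 K M) {z \<in> Z. snd z = k}"
    proof (rule bij_betw_byWitness[of _ "\<lambda>z. inv\<^bsub>H\<^esub> h0 \<otimes>\<^bsub>H\<^esub> fst z"])
      show "\<forall>h\<in>k2 G L \<inter> k1 K M. inv\<^bsub>H\<^esub> h0 \<otimes>\<^bsub>H\<^esub> fst (h0 \<otimes>\<^bsub>H\<^esub> h, k) = h"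
        using c MG by (auto simp: k1_def H.m_assoc[symmetric])
      show "\<forall>z\<in>{z \<in> Z. snd z = k}. (h0 \<otimes>\<^bsub>H\<^esub> (inv\<^bsub>H\<^esub> h0 \<otimes>\<^bsub>H\<^esub> fst z), k) = z"
        using c MG by (auto simp: Z_def H.m_assoc[symmetric])
      show "(\<lambda>h. (h0 \<otimes>\<^bsub>H\<^esub> h, k)) ` (k2 G L \<inter> k1 K M) \<subseteq> {z \<in> Z. snd z = k}"
        using h0 L_mult[OF h0(2)] M_mult[OF h0(1)] c K.r_one by (fastforce simp: Z_def k1_def k2_def)
      show "(\<lambda>z. inv\<^bsub>H\<^esub> h0 \<otimes>\<^bsub>H\<^esub> fst z) ` {z \<in> Z. snd z = k} \<subseteq> k2 G L \<inter> k1 K M"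
        using L_mult[OF L_inv[OF h0(2)]] M_mult[OF M_inv[OF h0(1)], of _ k] c K.l_inv by (auto simp: Z_def k1_def k2_def)
    qed
    then show ?thesis by (simp add: bij_betw_same_card)
  qed
  ultimately have 1: "card Z = card (k2 G (L O M) \<inter> k1 J N) * card (k2 G L \<inter> k1 K M)"
    using card_eq_mult_fibres[OF finZ, of snd] by metis
  have "fst ` Z = k2 G L \<inter> k1 J (M O N)"
    unfolding Z_def k1_def k2_def by (force simp: image_iff)
  moreover have "card {z \<in> Z. fst z = h} = card (k2 H M \<inter> k1 J N)" if h: "h \<in> fst ` Z" for h
  proof -
    obtain k0 where k0: "(h, k0) \<in> M" "(\<one>\<^bsub>G\<^esub>, h) \<in> L" "(k0, \<one>\<^bsub>J\<^esub>) \<in> N" using h by (auto simp: Z_def)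
    note c = MG[OF k0(1)]
    have "bij_betw (\<lambda>k. (h, k0 \<otimes>\<^bsub>K\<^esub> k)) (k2 H M \<inter> k1 J N) {z \<in> Z. fst z = h}"
    proof (rule bij_betw_byWitness[of _ "\<lambda>z. inv\<^bsub>K\<^esub> k0 \<otimes>\<^bsub>K\<^esub> snd z"])
      show "\<forall>k\<in>k2 H M \<inter> k1 J N. inv\<^bsub>K\<^esub> k0 \<otimes>\<^bsub>K\<^esub> snd (h, k0 \<otimes>\<^bsub>K\<^esub> k) = k"
        using c MG by (auto simp: k2_def K.m_assoc[symmetric])
      show "\<forall>z\<in>{z \<in> Z. fst z = h}. (h, k0 \<otimes>\<^bsub>K\<^esub> (inv\<^bsub>K\<^esub> k0 \<otimes>\<^bsub>K\<^esub> snd z)) = z"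
        using c MG by (auto simp: Z_def K.m_assoc[symmetric])
      show "(\<lambda>k. (h, k0 \<otimes>\<^bsub>K\<^esub> k)) ` (k2 H M \<inter> k1 J N) \<subseteq> {z \<in> Z. fst z = h}"
        using k0 N_mult[OF k0(3)] M_mult[OF k0(1)] c H.r_one by (fastforce simp: Z_def k1_def k2_def)
      show "(\<lambda>z. inv\<^bsub>K\<^esub> k0 \<otimes>\<^bsub>K\<^esub> snd z) ` {z \<in> Z. fst z = h} \<subseteq> k2 H M \<inter> k1 J N"
        using N_mult[OF N_inv[OF k0(3)]] M_mult[OF M_inv[OF k0(1)], of h] c H.l_inv by (auto simp: Z_def k1_def k2_def)
    qed
    then show ?thesis by (simp add: bij_betw_same_card)
  qed
  ultimately have 2: "card Z = card (k2 G L \<inter> k1 J (M O N)) * card (k2 H M \<inter> k1 J N)"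
    using card_eq_mult_fibres[OF finZ, of fst] by metis
  show ?thesis using 1 2 by (simp add: mult.commute)
qed

lemma arrow_prod_simps:
  "arrow_prod (G, L, H) (H, M, K) = single (G, L O M, K)
            (of_nat (card (k2 G L \<inter> k1 K M)) / of_nat (card (carrier H)))"
  "H \<noteq> H' \<Longrightarrow> arrow_prod (G, L, H) (H', M, K) = 0"
  by (simp_all add: arrow_prod_def)

locale group_subcat =
  fixes \<G> :: "'g monoid set" and \<C> :: "'g group_cat"
  assumes rep: "represents_finite_groups \<G>" and subcat: "subcategory \<C> (subgroup_cat \<G>)"
    and fin_cat: "finite_cat \<C>"
begin

lemma Obj_group: "G \<in> Obj \<C> \<Longrightarrow> group G" "G \<in> Obj \<C> \<Longrightarrow> finite (carrier G)"
  using rep subcat by (auto simp: represents_finite_groups_def subcategory_def subgroup_cat_def)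

lemma Mor_subgroup: "G \<in> Obj \<C> \<Longrightarrow> H \<in> Obj \<C> \<Longrightarrow> L \<in> Mor \<C> G H \<Longrightarrow> subgroup L (G \<times>\<times> H)"
  using subcat by (auto simp: subcategory_def subgroup_cat_def)

lemma Mor_comp: "G \<in> Obj \<C> \<Longrightarrow> H \<in> Obj \<C> \<Longrightarrow> K \<in> Obj \<C> \<Longrightarrow> L \<in> Mor \<C> G H \<Longrightarrow> M \<in> Mor \<C> H K \<Longrightarrow> L O M \<in> Mor \<C> G K"
  using subcat unfolding subcategory_def by blast

lemma Mor_Id: "G \<in> Obj \<C> \<Longrightarrow> Id_on (carrier G) \<in> Mor \<C> G G"
  using subcat unfolding subcategory_def by blast

lemma in_arrows: "(G, L, H) \<in> arrows \<C> \<longleftrightarrow> G \<in> Obj \<C> \<and> H \<in> Obj \<C> \<and> L \<in> Mor \<C> G H"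
  by (simp add: arrows_def)

lemma Mor_one: "G \<in> Obj \<C> \<Longrightarrow> H \<in> Obj \<C> \<Longrightarrow> L \<in> Mor \<C> G H \<Longrightarrow> (\<one>\<^bsub>G\<^esub>, \<one>\<^bsub>H\<^esub>) \<in> L"
  using subgroup.one_closed[OF Mor_subgroup, of G H L] by simp

lemma Mor_sub: "G \<in> Obj \<C> \<Longrightarrow> H \<in> Obj \<C> \<Longrightarrow> L \<in> Mor \<C> G H \<Longrightarrow> L \<subseteq> carrier G \<times> carrier H"
  using subgroup.subset[OF Mor_subgroup, of G H L] by (simp add: DirProd_def)

lemma fin_arrows: "finite (arrows \<C>)" using fin_cat by (simp add: finite_cat_def)

lemma fin_Obj: "finite (Obj \<C>)"
proof -
  have "Obj \<C> \<subseteq> fst ` arrows \<C>"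
  proof
    fix G assume "G \<in> Obj \<C>"
    then have "(G, Id_on (carrier G), G) \<in> arrows \<C>" by (simp add: in_arrows Mor_Id)
    then show "G \<in> fst ` arrows \<C>" by (rule image_eqI[rotated]) simp
  qed
  then show ?thesis using fin_arrows by (meson finite_imageI finite_subset)
qed

lemma card_pos: "G \<in> Obj \<C> \<Longrightarrow> card (carrier G) \<noteq> 0"
proof -
  assume G: "G \<in> Obj \<C>"
  interpret group G by (rule Obj_group[OF G])
  have "carrier G \<noteq> {}" using one_closed by blast
  then show ?thesis using Obj_group(2)[OF G] by simp
qed

lemma k_one:
  assumes "G \<in> Obj \<C>" "H \<in> Obj \<C>" "L \<in> Mor \<C> G H"
  shows "\<one>\<^bsub>H\<^esub> \<in> k2 G L" "\<one>\<^bsub>G\<^esub> \<in> k1 H L" "k2 G L \<subseteq> carrier H" "k1 H L \<subseteq> carrier G"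
  using Mor_one[OF assms] Mor_sub[OF assms] by (auto simp: k1_def k2_def)

definition "Aunit = (\<Sum>G \<in> Obj \<C>. single (G, Id_on (carrier G), G) (of_nat (card (carrier G))) :: 'g arrow \<Rightarrow>\<^sub>0 'r::field_char_0)"

lemma twisted_algebra_eq: "twisted_algebra \<C> = based_algebra (arrows \<C>) arrow_prod Aunit"
  by (simp add: twisted_algebra_def Aunit_def)

lemma arrow_prod_keys: "x \<in> arrows \<C> \<Longrightarrow> y \<in> arrows \<C> \<Longrightarrow> keys (arrow_prod x y) \<subseteq> arrows \<C>"
  by (cases x; cases y) (auto simp: arrow_prod_def in_arrows Mor_comp split: if_splits)

theorem ring_twisted_algebra: "ring (twisted_algebra \<C> :: ('g arrow \<Rightarrow>\<^sub>0 'r::field_char_0) ring)"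
  unfolding twisted_algebra_eq
proof (rule ring_based_algebra)
  fix x y :: "'g arrow" assume "x \<in> arrows \<C>" "y \<in> arrows \<C>"
  then show "keys (arrow_prod x y :: 'g arrow \<Rightarrow>\<^sub>0 'r) \<subseteq> arrows \<C>" by (rule arrow_prod_keys)
next
  show "keys (Aunit :: 'g arrow \<Rightarrow>\<^sub>0 'r) \<subseteq> arrows \<C>"
    unfolding Aunit_def by (rule keys_sum_subset) (auto simp: in_arrows Mor_Id)
next
  fix x y z :: "'g arrow" assume xyz: "x \<in> arrows \<C>" "y \<in> arrows \<C>" "z \<in> arrows \<C>"
  obtain G L H where x: "x = (G, L, H)" by (cases x)
  obtain H' M K where y: "y = (H', M, K)" by (cases y)
  obtain K' N J where z: "z = (K', N, J)" by (cases z)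
  have o: "G \<in> Obj \<C>" "H \<in> Obj \<C>" "H' \<in> Obj \<C>" "K \<in> Obj \<C>" "J \<in> Obj \<C>" "K' \<in> Obj \<C>" "L \<in> Mor \<C> G H" "M \<in> Mor \<C> H' K" "N \<in> Mor \<C> K' J"
    using xyz by (simp_all add: x y z in_arrows)
  show "linear_ext (\<lambda>w. arrow_prod w z) (arrow_prod x y) = linear_ext (arrow_prod x) (arrow_prod y z :: 'g arrow \<Rightarrow>\<^sub>0 'r)"
  proof (cases "H = H' \<and> K = K'")
    case True
    have "card (k2 G L \<inter> k1 K M) * card (k2 G (L O M) \<inter> k1 J N)
       = card (k2 H M \<inter> k1 J N) * card (k2 G L \<inter> k1 J (M O N))"
      by (rule card_cocycle) (use o True in \<open>simp_all add: Obj_group Mor_subgroup\<close>)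
    then have "(of_nat (card (k2 G L \<inter> k1 K M)) * of_nat (card (k2 G (L O M) \<inter> k1 J N)) :: 'r)
       = of_nat (card (k2 H M \<inter> k1 J N)) * of_nat (card (k2 G L \<inter> k1 J (M O N)))"
      by (metis of_nat_mult)
    then show ?thesis
      using True by (simp add: x y z arrow_prod_simps O_assoc) (simp add: field_simps)
  next
    case False
    then show ?thesis by (auto simp: x y z arrow_prod_def)
  qed
next
  fix x :: "'g arrow" assume xA: "x \<in> arrows \<C>"
  obtain G L H where x: "x = (G, L, H)" by (cases x)
  have o: "G \<in> Obj \<C>" "H \<in> Obj \<C>" "L \<in> Mor \<C> G H" using xA by (simp_all add: x in_arrows)
  note k = k_one[OF o]
  have kid: "k2 J (Id_on (carrier J)) = {\<one>\<^bsub>J\<^esub>}" "k1 J (Id_on (carrier J)) = {\<one>\<^bsub>J\<^esub>}" if "J \<in> Obj \<C>" for J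
    using monoid.one_closed[OF group.is_monoid[OF Obj_group(1)[OF that]]] by (auto simp: k1_def k2_def)
  have ints: "{\<one>\<^bsub>G\<^esub>} \<inter> k1 H L = {\<one>\<^bsub>G\<^esub>}" "k2 G L \<inter> {\<one>\<^bsub>H\<^esub>} = {\<one>\<^bsub>H\<^esub>}" using k by auto
  have comp: "Id_on (carrier G) O L = L" "L O Id_on (carrier H) = L" using Mor_sub[OF o] by auto
  have "linear_ext (\<lambda>w. arrow_prod w x) Aunit
      = (\<Sum>J \<in> Obj \<C>. scl (of_nat (card (carrier J))) (arrow_prod (J, Id_on (carrier J), J) x) :: 'g arrow \<Rightarrow>\<^sub>0 'r)"
    unfolding Aunit_def linear_ext_sum by simp
  also have "\<dots> = (\<Sum>J \<in> Obj \<C>. if J = G then single x 1 else 0)"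
    by (rule sum.cong) (auto simp: x arrow_prod_simps kid ints comp card_pos o)
  finally show "linear_ext (\<lambda>w. arrow_prod w x) Aunit = (single x 1 :: 'g arrow \<Rightarrow>\<^sub>0 'r)"
    using fin_Obj o by simp
  have "linear_ext (arrow_prod x) Aunit
      = (\<Sum>J \<in> Obj \<C>. scl (of_nat (card (carrier J))) (arrow_prod x (J, Id_on (carrier J), J)) :: 'g arrow \<Rightarrow>\<^sub>0 'r)"
    unfolding Aunit_def linear_ext_sum by simp
  also have "\<dots> = (\<Sum>J \<in> Obj \<C>. if J = H then single x 1 else 0)"
    by (rule sum.cong) (auto simp: x arrow_prod_simps kid ints comp card_pos o)
  finally show "linear_ext (arrow_prod x) Aunit = (single x 1 :: 'g arrow \<Rightarrow>\<^sub>0 'r)"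
    using fin_Obj o by simp
qed

end

section \<open>The corner ring at a section\<close>

lemma corner_carrier_iff:
  assumes "ring A" "e \<in> carrier A" "e \<otimes>\<^bsub>A\<^esub> e = e"
  shows "x \<in> carrier (corner_ring A e) \<longleftrightarrow> x \<in> carrier A \<and> e \<otimes>\<^bsub>A\<^esub> x = x \<and> x \<otimes>\<^bsub>A\<^esub> e = x"
proof -
  interpret ring A by fact
  have "e \<otimes>\<^bsub>A\<^esub> (e \<otimes>\<^bsub>A\<^esub> a) = e \<otimes>\<^bsub>A\<^esub> a" if "a \<in> carrier A" for a
    using assms(2,3) that by (simp add: m_assoc[symmetric])
  then have "e \<otimes>\<^bsub>A\<^esub> x = x \<and> x \<otimes>\<^bsub>A\<^esub> e = x" if "a \<in> carrier A" "x = e \<otimes>\<^bsub>A\<^esub> a \<otimes>\<^bsub>A\<^esub> e" for a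
    using assms(2,3) that by (simp add: m_assoc)
  moreover have "x = e \<otimes>\<^bsub>A\<^esub> x \<otimes>\<^bsub>A\<^esub> e" if "e \<otimes>\<^bsub>A\<^esub> x = x" "x \<otimes>\<^bsub>A\<^esub> e = x"
    using that by simp
  ultimately show ?thesis
    using assms(2) unfolding corner_ring_def by (auto intro: image_eqI[where x = x])
qed

lemma ring_corner_ring:
  assumes "ring A" "e \<in> carrier A" "e \<otimes>\<^bsub>A\<^esub> e = e"
  shows "ring (corner_ring A e)"
proof -
  interpret A: ring A by fact
  note c = corner_carrier_iff[OF assms]
  have s: "x \<oplus>\<^bsub>corner_ring A e\<^esub> y = x \<oplus>\<^bsub>A\<^esub> y" "x \<otimes>\<^bsub>corner_ring A e\<^esub> y = x \<otimes>\<^bsub>A\<^esub> y"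
    "\<one>\<^bsub>corner_ring A e\<^esub> = e" "\<zero>\<^bsub>corner_ring A e\<^esub> = \<zero>\<^bsub>A\<^esub>" for x y
    by (simp_all add: corner_ring_def)
  show ?thesis
  proof (rule ringI)
    show "abelian_group (corner_ring A e)"
    proof (rule abelian_groupI)
      fix x assume x: "x \<in> carrier (corner_ring A e)"
      then have "\<ominus>\<^bsub>A\<^esub> x \<in> carrier (corner_ring A e)"
        using assms(2) by (simp add: c A.r_minus A.l_minus)
      moreover have "\<ominus>\<^bsub>A\<^esub> x \<oplus>\<^bsub>A\<^esub> x = \<zero>\<^bsub>A\<^esub>" using x by (simp add: c A.l_neg)
      ultimately show "\<exists>y\<in>carrier (corner_ring A e). y \<oplus>\<^bsub>corner_ring A e\<^esub> x = \<zero>\<^bsub>corner_ring A e\<^esub>"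
        unfolding s by blast
    qed (use assms(2) in \<open>auto simp: s c A.l_distr A.r_distr A.a_ac\<close>)
    show "monoid (corner_ring A e)"
    proof (rule monoidI)
      fix x y assume "x \<in> carrier (corner_ring A e)" "y \<in> carrier (corner_ring A e)"
      then show "x \<otimes>\<^bsub>corner_ring A e\<^esub> y \<in> carrier (corner_ring A e)"
        using assms(2) unfolding s c by (metis A.m_assoc A.m_closed)
    qed (use assms(2,3) in \<open>auto simp: s c A.m_assoc\<close>)
  qed (auto simp: s c A.l_distr A.r_distr)
qed

text \<open>Left translation by an element of \<open>S\<close> is an injection of \<open>S\<close> into itself, hence a permutation
  of \<open>S\<close>; so \<open>S\<close> contains the identity and all inverses.\<close>

lemma finite_subset_subgroupI:
  fixes G (structure)
  assumes G: "group G" and S: "finite S" "S \<subseteq> carrier G" "S \<noteq> {}"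
    and mult: "\<And>x y. x \<in> S \<Longrightarrow> y \<in> S \<Longrightarrow> x \<otimes>\<^bsub>G\<^esub> y \<in> S"
  shows "subgroup S G"
proof -
  interpret group G by fact
  have surj: "(\<lambda>y. x \<otimes>\<^bsub>G\<^esub> y) ` S = S" if x: "x \<in> S" for x
  proof (rule endo_inj_surj[OF S(1)])
    show "(\<lambda>y. x \<otimes>\<^bsub>G\<^esub> y) ` S \<subseteq> S" using mult x by blast
    show "inj_on (\<lambda>y. x \<otimes>\<^bsub>G\<^esub> y) S"
    proof (rule inj_onI)
      fix y z assume yz: "y \<in> S" "z \<in> S" "x \<otimes>\<^bsub>G\<^esub> y = x \<otimes>\<^bsub>G\<^esub> z"
      have "x \<in> carrier G" "y \<in> carrier G" "z \<in> carrier G" using x yz S(2) by blast+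
      then show "y = z" using yz(3) by simp
    qed
  qed
  have one: "\<one> \<in> S"
  proof -
    obtain x where x: "x \<in> S" using S(3) by blast
    then have "x \<in> (\<lambda>y. x \<otimes> y) ` S" using surj by simp
    then obtain y where y: "y \<in> S" "x \<otimes> y = x" by force
    have "x \<in> carrier G" "y \<in> carrier G" using x y S(2) by blast+
    then have "y = \<one>" using y(2) Units_l_cancel[of x y \<one>] by (simp add: Units_eq)
    then show ?thesis using y by blast
  qed
  show ?thesis
  proof (rule subgroupI)
    fix x assume x: "x \<in> S"
    then have "\<one> \<in> (\<lambda>y. x \<otimes> y) ` S" using surj one by simp
    then obtain y where y: "y \<in> S" "x \<otimes> y = \<one>" by force
    have "x \<in> carrier G" "y \<in> carrier G" using x y S(2) by blast+
    then have "inv x = y" using y(2) Units_l_cancel[of x y "inv x"] by (simp add: Units_eq)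
    then show "inv x \<in> S" using y by simp
  qed (use S mult in auto)
qed

locale twisted_rep = group_subcat \<G> \<C> for \<G> :: "'g monoid set" and \<C> :: "'g group_cat" +
  fixes G :: "'g monoid" and P K :: "'g set" and T :: "(('g set \<Rightarrow> 'g set) \<Rightarrow>\<^sub>0 'r::field_char_0, 't) module"
  assumes star: "condition_star \<C>" and conj_cl: "conj_closed \<C>" and G: "G \<in> Obj \<C>"
    and sect: "is_section G P K" and e_Mor: "e_sec G P K \<in> Mor \<C> G G"
    and simple_T: "simple_module (group_algebra (AutC \<C> G P K)) T"
begin

abbreviation "\<Gamma> \<equiv> AutC \<C> G P K"
abbreviation "A \<equiv> twisted_algebra \<C> :: ('g arrow \<Rightarrow>\<^sub>0 'r) ring"
abbreviation A_mult_infix (infixl \<open>\<bullet>\<close> 70) where "a \<bullet> b \<equiv> a \<otimes>\<^bsub>A\<^esub> b"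
abbreviation "E \<equiv> e_sec G P K"
abbreviation "n \<equiv> card (rcosets\<^bsub>G\<^esub> K)"
abbreviation "e \<equiv> e_idem G P K :: 'g arrow \<Rightarrow>\<^sub>0 'r"
abbreviation "Q \<equiv> subquot G P K"
abbreviation "aut_goursat \<alpha> \<equiv> goursat G P K \<alpha> G P K"
abbreviation "arr \<alpha> \<equiv> (G, aut_goursat \<alpha>, G)"
abbreviation \<pi> :: "('g arrow \<Rightarrow>\<^sub>0 'r) \<Rightarrow> (('g set \<Rightarrow> 'g set) \<Rightarrow>\<^sub>0 'r)" where "\<pi> \<equiv> corner_proj \<C> G P K"

interpretation group G by (rule Obj_group[OF G])

sublocale s: group_section G P K
  by unfold_locales (rule sect)

sublocale A: ring A by (rule ring_twisted_algebra)

lemma finG: "finite (carrier G)" by (rule Obj_group(2)[OF G])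

lemma n_eq: "n * card K = card (carrier G)"
  using lagrange[OF s.K_sub] by (simp add: order_def)

lemma nK_pos: "n \<noteq> 0" "card K \<noteq> 0"
  using n_eq card_pos[OF G] by (metis mult_is_0)+

lemma n_div: "of_nat (card K) / (of_nat (card (carrier G)) :: 'r) = 1 / of_nat n"
  unfolding n_eq[symmetric] using nK_pos by simp

lemma \<Gamma>_iff: "\<alpha> \<in> carrier \<Gamma> \<longleftrightarrow> section_iso G P K G P K \<alpha> \<and> \<alpha> \<in> extensional (carrier Q) \<and> aut_goursat \<alpha> \<in> Mor \<C> G G"
  using s.group_section_axioms unfolding section_iso_def section_iso_axioms_def iso_def
  by (auto simp: AutC_def auto_def Bij_def)

lemma \<Gamma>_restrict:
  assumes "section_iso G P K G P K \<sigma>" "aut_goursat \<sigma> \<in> Mor \<C> G G"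
  shows "restrict \<sigma> (carrier Q) \<in> carrier \<Gamma>" "aut_goursat (restrict \<sigma> (carrier Q)) = aut_goursat \<sigma>"
proof -
  interpret i: section_iso G P K G P K \<sigma> by fact
  show "aut_goursat (restrict \<sigma> (carrier Q)) = aut_goursat \<sigma>" by (rule i.goursat_restrict)
  then show "restrict \<sigma> (carrier Q) \<in> carrier \<Gamma>"
    unfolding \<Gamma>_iff using assms(2) i.eta_restrict s.group_section_axioms by (simp add: section_iso_def section_iso_axioms_def)
qed

lemma \<Gamma>_mult: "\<alpha> \<in> carrier \<Gamma> \<Longrightarrow> \<beta> \<in> carrier \<Gamma> \<Longrightarrow> \<alpha> \<otimes>\<^bsub>\<Gamma>\<^esub> \<beta> = compose (carrier Q) \<alpha> \<beta>"
  by (auto simp: AutC_def AutoGroup_def BijGroup_def auto_def)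

lemma aut_goursat_mult: assumes "\<alpha> \<in> carrier \<Gamma>" "\<beta> \<in> carrier \<Gamma>" shows "aut_goursat \<alpha> O aut_goursat \<beta> = aut_goursat (\<alpha> \<otimes>\<^bsub>\<Gamma>\<^esub> \<beta>)"
proof -
  have "aut_goursat \<alpha> O aut_goursat \<beta> = aut_goursat (\<alpha> \<circ> \<beta>)" using assms goursat_comp \<Gamma>_iff by blast
  also have "\<dots> = aut_goursat (\<alpha> \<otimes>\<^bsub>\<Gamma>\<^esub> \<beta>)"
    unfolding \<Gamma>_mult[OF assms] by (rule goursat_cong[OF s.group_section_axioms]) (simp only: compose_eq o_apply)
  finally show ?thesis .
qed

lemma \<Gamma>_finite: "finite (carrier \<Gamma>)"
proof (rule finite_subset)
  show "carrier \<Gamma> \<subseteq> carrier Q \<rightarrow>\<^sub>E carrier Q"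
    by (auto simp: AutC_def auto_def Bij_def bij_betw_def PiE_def)
  have "finite (carrier Q)" unfolding s.car using finite_subset[of P "carrier G"] s.PG finG by auto
  then show "finite (carrier Q \<rightarrow>\<^sub>E carrier Q)" by (intro finite_PiE) auto
qed

lemma \<Gamma>_one: "(\<lambda>x\<in>carrier Q. x) \<in> carrier \<Gamma>" "aut_goursat (\<lambda>x\<in>carrier Q. x) = E" "\<one>\<^bsub>\<Gamma>\<^esub> = (\<lambda>x\<in>carrier Q. x)"
proof -
  have i: "section_iso G P K G P K id" by (rule section_iso_id[OF s.group_section_axioms])
  have "restrict id (carrier Q) = (\<lambda>x\<in>carrier Q. x)" by (simp add: id_def)
  then show "(\<lambda>x\<in>carrier Q. x) \<in> carrier \<Gamma>" "aut_goursat (\<lambda>x\<in>carrier Q. x) = E"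
    using \<Gamma>_restrict[OF i] e_Mor by (simp_all add: e_sec_def)
  show "\<one>\<^bsub>\<Gamma>\<^esub> = (\<lambda>x\<in>carrier Q. x)" by (simp add: AutC_def AutoGroup_def BijGroup_def)
qed

lemma group_\<Gamma>: "group \<Gamma>"
proof -
  have gA: "group (AutoGroup Q)" by (rule group.AutoGroup[OF s.group_Q])
  have \<Gamma>_eq: "\<Gamma> = (AutoGroup Q)\<lparr>carrier := carrier \<Gamma>\<rparr>" by (simp add: AutC_def)
  have "subgroup (carrier \<Gamma>) (AutoGroup Q)"
  proof (rule finite_subset_subgroupI[OF gA \<Gamma>_finite])
    show "carrier \<Gamma> \<subseteq> carrier (AutoGroup Q)" by (auto simp: AutC_def AutoGroup_def)
    show "carrier \<Gamma> \<noteq> {}" using \<Gamma>_one(1) by blast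
    fix \<alpha> \<beta> assume ab: "\<alpha> \<in> carrier \<Gamma>" "\<beta> \<in> carrier \<Gamma>"
    have m: "\<alpha> \<otimes>\<^bsub>AutoGroup Q\<^esub> \<beta> = restrict (\<alpha> \<circ> \<beta>) (carrier Q)"
      using \<Gamma>_mult[OF ab] by (simp add: AutC_def compose_def restrict_def comp_def)
    have "aut_goursat (\<alpha> \<circ> \<beta>) = aut_goursat \<alpha> O aut_goursat \<beta>" using goursat_comp ab \<Gamma>_iff by metis
    then have "aut_goursat (\<alpha> \<circ> \<beta>) \<in> Mor \<C> G G" using Mor_comp[OF G G G] ab \<Gamma>_iff by metis
    then show "\<alpha> \<otimes>\<^bsub>AutoGroup Q\<^esub> \<beta> \<in> carrier \<Gamma>"
      unfolding m using section_iso_comp ab \<Gamma>_iff by (intro \<Gamma>_restrict(1)) blast+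
  qed
  then show ?thesis using group.subgroup_imp_group[OF gA] \<Gamma>_eq by metis
qed

sublocale T: simple_rep \<Gamma> T
  by (intro simple_rep.intro simple_rep_axioms.intro group_\<Gamma> \<Gamma>_finite simple_T)

lemma arr_inj: assumes "\<alpha> \<in> carrier \<Gamma>" "\<beta> \<in> carrier \<Gamma>" "aut_goursat \<alpha> = aut_goursat \<beta>" shows "\<alpha> = \<beta>"
proof (rule extensionalityI)
  show "\<alpha> \<in> extensional (carrier Q)" "\<beta> \<in> extensional (carrier Q)" using assms \<Gamma>_iff by blast+
  show "\<alpha> X = \<beta> X" if "X \<in> carrier Q" for X
    using goursat_inj[OF _ _ assms(3) that] assms(1,2) \<Gamma>_iff by blast
qed

lemma arr_arrow: "\<alpha> \<in> carrier \<Gamma> \<Longrightarrow> arr \<alpha> \<in> arrows \<C>"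
  using \<Gamma>_iff G by (simp add: in_arrows)

lemma lookup_\<pi>: "lk (\<pi> a) \<alpha> = (if \<alpha> \<in> carrier \<Gamma> then lk a (arr \<alpha>) / of_nat n else 0)"
  using \<Gamma>_finite by (simp add: corner_proj_def lookup_sum lookup_single when_def)

lemma \<pi>_add: "\<pi> (a + b) = \<pi> a + \<pi> b" and \<pi>_scl: "\<pi> (scl c a) = scl c (\<pi> a)" and \<pi>_zero: "\<pi> 0 = 0"
  by (rule poly_mapping_eqI; simp add: lookup_\<pi> lookup_add add_divide_distrib)+

lemma \<pi>_sum: "\<pi> (\<Sum>i\<in>I. a i) = (\<Sum>i\<in>I. \<pi> (a i))"
  by (induction I rule: infinite_finite_induct) (auto simp: \<pi>_add \<pi>_zero)

lemma \<pi>_linear_ext: "\<pi> (linear_ext f a) = linear_ext (\<lambda>x. \<pi> (f x)) a"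
  unfolding linear_ext_def \<pi>_sum \<pi>_scl ..

lemma \<pi>_arr: "\<alpha> \<in> carrier \<Gamma> \<Longrightarrow> \<pi> (single (arr \<alpha>) r) = single \<alpha> (r / of_nat n)"
  by (rule poly_mapping_eqI) (auto simp: lookup_\<pi> lookup_single when_def dest: arr_inj)

lemma \<pi>_other: "(\<And>\<alpha>. \<alpha> \<in> carrier \<Gamma> \<Longrightarrow> x \<noteq> arr \<alpha>) \<Longrightarrow> \<pi> (single x r) = 0"
  by (rule poly_mapping_eqI) (auto simp: lookup_\<pi> lookup_single when_def)

lemma keys_\<pi>: "keys (\<pi> a) \<subseteq> carrier \<Gamma>"
  by (auto simp: in_keys_iff lookup_\<pi> split: if_splits)

text \<open>The morphisms that form a basis of \<open>eAe\<close>.\<close>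

definition "corner_arrows = {(G', X, H). G' = G \<and> H = G \<and> X \<in> Mor \<C> G G \<and> E O X = X \<and> X O E = X}"

lemma arr_corner_arrows: "\<alpha> \<in> carrier \<Gamma> \<Longrightarrow> arr \<alpha> \<in> corner_arrows"
proof -
  assume "\<alpha> \<in> carrier \<Gamma>"
  then have "section_iso G P K G P K \<alpha>" "aut_goursat \<alpha> \<in> Mor \<C> G G" using \<Gamma>_iff by blast+
  then show ?thesis using e_sec_left[of G P K G P K \<alpha>] e_sec_right[of G P K G P K \<alpha>] by (simp add: corner_arrows_def)
qed

text \<open>If a product of two basis elements of \<open>eAe\<close> lies in \<open>\<Gamma>\<^sub>e\<close>, then so do both factors: their
  outer sections are \<open>(P, K)\<close>, and their inner sections are nested in \<open>(P, K)\<close> with an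
  isomorphic quotient. In other words, \<open>RJ\<^sub>e\<close> is an ideal, and \<open>\<pi>\<close> is multiplicative.\<close>

lemma invertible_factors:
  assumes X: "(G, X, G) \<in> corner_arrows" and Y: "(G, Y, G) \<in> corner_arrows" and \<gamma>: "\<gamma> \<in> carrier \<Gamma>" "X O Y = aut_goursat \<gamma>"
  shows "\<exists>\<alpha> \<in> carrier \<Gamma>. X = aut_goursat \<alpha>" "\<exists>\<alpha> \<in> carrier \<Gamma>. Y = aut_goursat \<alpha>"
proof -
  have X': "X \<in> Mor \<C> G G" "E O X = X" "X O E = X" and Y': "Y \<in> Mor \<C> G G" "E O Y = Y" "Y O E = Y"
    using X Y by (auto simp: corner_arrows_def)
  have s\<gamma>: "section_iso G P K G P K \<gamma>" using \<gamma> \<Gamma>_iff by blast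
  note ends = invertible_composite_ends[OF s\<gamma> \<gamma>(2) Mor_one[OF G G X'(1)] X'(2) Mor_one[OF G G Y'(1)] Y'(3)]
  obtain \<sigma> where \<sigma>: "section_iso G P K G (snd ` X) (k2 G X) \<sigma>" "X = goursat G P K \<sigma> G (snd ` X) (k2 G X)"
    using goursat_subgroup_decomp[OF is_group is_group Mor_subgroup[OF G G X'(1)]] unfolding ends by metis
  have "snd ` X = P" "k2 G X = K"
    using nested_sections_eq[OF \<sigma>(1) finG] right_stable[OF s.group_section_axioms Mor_one[OF G G X'(1)] X'(3)] by blast+
  then have "section_iso G P K G P K \<sigma>" "X = aut_goursat \<sigma>" using \<sigma> by simp_all
  then show "\<exists>\<alpha> \<in> carrier \<Gamma>. X = aut_goursat \<alpha>" using \<Gamma>_restrict X'(1) by metis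
  obtain \<rho> where \<rho>: "section_iso G (fst ` Y) (k1 G Y) G P K \<rho>" "Y = goursat G (fst ` Y) (k1 G Y) \<rho> G P K"
    using goursat_subgroup_decomp[OF is_group is_group Mor_subgroup[OF G G Y'(1)]] unfolding ends by metis
  have "fst ` Y = P" "k1 G Y = K"
    using nested_sections_eq[OF section_iso_inv[OF \<rho>(1)] finG] left_stable[OF s.group_section_axioms Mor_one[OF G G Y'(1)] Y'(2)] by blast+
  then have "section_iso G P K G P K \<rho>" "Y = aut_goursat \<rho>" using \<rho> by simp_all
  then show "\<exists>\<alpha> \<in> carrier \<Gamma>. Y = aut_goursat \<alpha>" using \<Gamma>_restrict Y'(1) by metis
qed

lemma k_aut_goursat:
  assumes "\<alpha> \<in> carrier \<Gamma>"
  shows "k1 G (aut_goursat \<alpha>) = K" "k2 G (aut_goursat \<alpha>) = K"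
proof -
  interpret i: section_iso G P K G P K \<alpha> using assms unfolding \<Gamma>_iff by blast
  show "k1 G (aut_goursat \<alpha>) = K" "k2 G (aut_goursat \<alpha>) = K" by (rule i.k1_L, rule i.k2_L)
qed

lemma \<pi>_mult_basis:
  assumes x: "x \<in> corner_arrows" and y: "y \<in> corner_arrows"
  shows "\<pi> (arrow_prod x y) = \<pi> (single x 1) \<otimes>\<^bsub>T.RG\<^esub> \<pi> (single y 1)"
proof -
  obtain X Y where xy: "x = (G, X, G)" "y = (G, Y, G)" using x y by (auto simp: corner_arrows_def)
  show ?thesis
  proof (cases "\<exists>\<alpha> \<in> carrier \<Gamma>. \<exists>\<beta> \<in> carrier \<Gamma>. X = aut_goursat \<alpha> \<and> Y = aut_goursat \<beta>")
    case True
    then obtain \<alpha> \<beta> where ab: "\<alpha> \<in> carrier \<Gamma>" "\<beta> \<in> carrier \<Gamma>" "X = aut_goursat \<alpha>" "Y = aut_goursat \<beta>" by blast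
    have "arrow_prod x y = single (arr (\<alpha> \<otimes>\<^bsub>\<Gamma>\<^esub> \<beta>)) (1 / of_nat n :: 'r)"
      using ab by (simp add: xy arrow_prod_simps aut_goursat_mult k_aut_goursat n_div)
    then have "\<pi> (arrow_prod x y) = single (\<alpha> \<otimes>\<^bsub>\<Gamma>\<^esub> \<beta>) (1 / of_nat n / of_nat n)"
      using \<pi>_arr[OF T.m_closed[OF ab(1,2)], of "1 / of_nat n"] by simp
    moreover have "\<pi> (single x 1) = single \<alpha> (1 / of_nat n)"
      unfolding xy ab(3) by (rule \<pi>_arr[OF ab(1)])
    moreover have "\<pi> (single y 1) = single \<beta> (1 / of_nat n)"
      unfolding xy ab(4) by (rule \<pi>_arr[OF ab(2)])
    ultimately show ?thesis by simp
  next
    case False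
    have "X O Y \<noteq> aut_goursat \<gamma>" if "\<gamma> \<in> carrier \<Gamma>" for \<gamma>
      using invertible_factors[OF x[unfolded xy] y[unfolded xy] that] False by meson
    then have 0: "\<pi> (arrow_prod x y) = 0"
      unfolding xy arrow_prod_simps by (intro \<pi>_other) simp
    show ?thesis
    proof (cases "\<exists>\<alpha> \<in> carrier \<Gamma>. X = aut_goursat \<alpha>")
      case True
      then have "Y \<noteq> aut_goursat \<beta>" if "\<beta> \<in> carrier \<Gamma>" for \<beta> using False that by blast
      then have "\<pi> (single y 1) = 0" unfolding xy by (intro \<pi>_other) simp
      then show ?thesis unfolding 0 by (simp add: group_algebra_mult)
    next
      case False
      then have "X \<noteq> aut_goursat \<beta>" if "\<beta> \<in> carrier \<Gamma>" for \<beta> using that by blast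
      then have "\<pi> (single x 1) = 0" unfolding xy by (intro \<pi>_other) simp
      then show ?thesis unfolding 0 by (simp add: group_algebra_mult)
    qed
  qed
qed

lemma A_mult: "a \<bullet> b = linear_ext (\<lambda>x. linear_ext (arrow_prod x) b) a"
  by (simp add: twisted_algebra_eq)

lemma A_carrier [simp]: "a \<in> carrier A \<longleftrightarrow> keys a \<subseteq> arrows \<C>"
  by (simp add: twisted_algebra_eq)

lemma A_add [simp]: "a \<oplus>\<^bsub>A\<^esub> b = a + b"
  by (simp add: twisted_algebra_eq)

lemma \<pi>_mult:
  assumes "keys a \<subseteq> corner_arrows" "keys b \<subseteq> corner_arrows"
  shows "\<pi> (a \<bullet> b) = \<pi> a \<otimes>\<^bsub>T.RG\<^esub> \<pi> b"
proof -
  let ?p = "\<lambda>x. \<pi> (single x 1)"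
  have p: "\<pi> c = linear_ext ?p c" for c
    using \<pi>_linear_ext[of "\<lambda>x. single x 1" c] by simp
  have "\<pi> (a \<bullet> b) = linear_ext (\<lambda>x. linear_ext (\<lambda>y. \<pi> (arrow_prod x y)) b) a"
    unfolding A_mult \<pi>_linear_ext ..
  also have "\<dots> = linear_ext (\<lambda>x. linear_ext (\<lambda>y. ?p x \<otimes>\<^bsub>T.RG\<^esub> ?p y) b) a"
    by (intro linear_ext_cong \<pi>_mult_basis) (use assms in auto)
  also have "\<dots> = \<pi> a \<otimes>\<^bsub>T.RG\<^esub> \<pi> b"
    unfolding p[of a] p[of b] group_algebra_mult linear_ext_comp
    by (intro linear_ext_cong linear_ext_swap)
  finally show ?thesis .
qed

lemma k2_E: "k2 G E = K" "k1 G E = K"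
  using k_aut_goursat[OF \<Gamma>_one(1)] \<Gamma>_one(2) by simp_all

lemma e_eq: "e = single (G, E, G) (of_nat n)"
  by (simp add: e_idem_def)

lemma e_carrier: "e \<in> carrier A"
  using G e_Mor by (simp add: e_eq in_arrows)

lemma single_mult: "single x r \<bullet> single y q = scl (r * q) (arrow_prod x y)"
  by (simp add: A_mult)

text \<open>The factor \<open>[G:K]\<close> in \<open>e\<close> cancels the coefficient \<open>|K|/|G|\<close> of the twisted product, so that
  \<open>e\<close> fixes every morphism that absorbs \<open>(P, K, id, P, K)\<close>.\<close>

lemma e_left:
  assumes "H \<in> Obj \<C>" "X \<in> Mor \<C> G H"
  shows "\<exists>r. e \<bullet> single (G, X, H) q = single (G, E O X, H) r"
    and "E O X = X \<Longrightarrow> e \<bullet> single (G, X, H) q = single (G, X, H) q"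
proof -
  show "\<exists>r. e \<bullet> single (G, X, H) q = single (G, E O X, H) r"
    unfolding e_eq single_mult arrow_prod_simps by auto
  assume X: "E O X = X"
  have "K \<inter> k1 H X = K" using left_stable(2)[OF s.group_section_axioms Mor_one[OF G assms] X] by blast
  then show "e \<bullet> single (G, X, H) q = single (G, X, H) q"
    using nK_pos by (simp add: e_eq single_mult arrow_prod_simps X k2_E n_div)
qed

lemma e_right:
  assumes "H \<in> Obj \<C>" "X \<in> Mor \<C> H G"
  shows "\<exists>r. single (H, X, G) q \<bullet> e = single (H, X O E, G) r"
    and "X O E = X \<Longrightarrow> single (H, X, G) q \<bullet> e = single (H, X, G) q"
proof -
  show "\<exists>r. single (H, X, G) q \<bullet> e = single (H, X O E, G) r"
    unfolding e_eq single_mult arrow_prod_simps by auto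
  assume X: "X O E = X"
  have "k2 H X \<inter> K = K" using right_stable(2)[OF s.group_section_axioms Mor_one[OF assms(1) G assms(2)] X] by blast
  then show "single (H, X, G) q \<bullet> e = single (H, X, G) q"
    using nK_pos by (simp add: e_eq single_mult arrow_prod_simps X k2_E n_div)
qed

lemma E_idem: "E O E = E"
  using e_sec_left[OF section_iso_id[OF s.group_section_axioms]] by (simp add: e_sec_def)

lemma e_idem: "e \<bullet> e = e"
  using e_left(2)[OF G e_Mor E_idem] by (simp add: e_eq)

text \<open>The morphisms that form bases of \<open>eA\<close> and of \<open>Ae\<close>.\<close>

definition "left_arrows = {(G', X, H). G' = G \<and> H \<in> Obj \<C> \<and> X \<in> Mor \<C> G H \<and> E O X = X}"
definition "right_arrows = {(H, X, G'). G' = G \<and> H \<in> Obj \<C> \<and> X \<in> Mor \<C> H G \<and> X O E = X}"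

lemma keys_e_left:
  assumes "keys a \<subseteq> arrows \<C>" shows "keys (e \<bullet> a) \<subseteq> left_arrows"
proof -
  have "e \<bullet> a = linear_ext (\<lambda>x. e \<bullet> single x 1) a"
    unfolding A_mult linear_ext_single by (subst linear_ext_swap) simp
  also have "keys \<dots> \<subseteq> left_arrows"
  proof (rule keys_linear_ext)
    fix x assume "x \<in> keys a"
    then have xA: "x \<in> arrows \<C>" using assms by blast
    obtain G' X H where x: "x = (G', X, H)" by (cases x)
    show "keys (e \<bullet> single x 1) \<subseteq> left_arrows"
    proof (cases "G' = G")
      case True
      then have X: "H \<in> Obj \<C>" "X \<in> Mor \<C> G H" using xA x by (simp_all add: in_arrows)
      then have "(G, E O X, H) \<in> left_arrows"
        using Mor_comp[OF G G X(1) e_Mor X(2)] E_idem by (simp add: left_arrows_def O_assoc[symmetric])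
      then show ?thesis using e_left(1)[OF X, of 1] x True keys_single_subset by metis
    next
      case False
      then show ?thesis by (simp add: x e_eq single_mult arrow_prod_simps)
    qed
  qed
  finally show ?thesis .
qed

lemma keys_e_right:
  assumes "keys a \<subseteq> arrows \<C>" shows "keys (a \<bullet> e) \<subseteq> right_arrows"
proof -
  have "a \<bullet> e = linear_ext (\<lambda>x. single x 1 \<bullet> e) a"
    unfolding A_mult linear_ext_single by simp
  also have "keys \<dots> \<subseteq> right_arrows"
  proof (rule keys_linear_ext)
    fix x assume "x \<in> keys a"
    then have xA: "x \<in> arrows \<C>" using assms by blast
    obtain H X G' where x: "x = (H, X, G')" by (cases x)
    show "keys (single x 1 \<bullet> e) \<subseteq> right_arrows"
    proof (cases "G' = G")
      case True
      then have X: "H \<in> Obj \<C>" "X \<in> Mor \<C> H G" using xA x by (simp_all add: in_arrows)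
      then have "(H, X O E, G) \<in> right_arrows"
        using Mor_comp[OF X(1) G G X(2) e_Mor] E_idem by (simp add: right_arrows_def O_assoc)
      then show ?thesis using e_right(1)[OF X, of 1] x True keys_single_subset by metis
    next
      case False
      then show ?thesis by (simp add: x e_eq single_mult arrow_prod_simps)
    qed
  qed
  finally show ?thesis .
qed

lemma e_left_fixes: assumes "keys a \<subseteq> left_arrows" shows "e \<bullet> a = a"
proof -
  have "e \<bullet> a = linear_ext (\<lambda>x. e \<bullet> single x 1) a"
    unfolding A_mult linear_ext_single by (subst linear_ext_swap) simp
  also have "\<dots> = linear_ext (\<lambda>x. single x 1) a"
    by (rule linear_ext_cong) (use assms e_left(2) in \<open>auto simp: left_arrows_def\<close>)
  finally show ?thesis by simp
qed

lemma e_right_fixes: assumes "keys a \<subseteq> right_arrows" shows "a \<bullet> e = a"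
proof -
  have "a \<bullet> e = linear_ext (\<lambda>x. single x 1 \<bullet> e) a"
    unfolding A_mult linear_ext_single by simp
  also have "\<dots> = linear_ext (\<lambda>x. single x 1) a"
    by (rule linear_ext_cong) (use assms e_right(2) in \<open>auto simp: right_arrows_def\<close>)
  finally show ?thesis by simp
qed

lemma corner_arrows_eq: "corner_arrows = left_arrows \<inter> right_arrows" using G by (auto simp: corner_arrows_def left_arrows_def right_arrows_def)

lemma left_right_arrows_subset: "left_arrows \<subseteq> arrows \<C>" "right_arrows \<subseteq> arrows \<C>" using G by (auto simp: left_arrows_def right_arrows_def in_arrows)

lemma corner_carrier: "x \<in> carrier (corner_ring A e) \<longleftrightarrow> keys x \<subseteq> corner_arrows"
proof
  assume "x \<in> carrier (corner_ring A e)"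
  then have "x \<in> carrier A" "e \<bullet> x = x" "x \<bullet> e = x"
    using corner_carrier_iff[OF A.ring_axioms e_carrier e_idem] by blast+
  then show "keys x \<subseteq> corner_arrows"
    using keys_e_left[of x] keys_e_right[of x] by (simp add: corner_arrows_eq)
next
  assume "keys x \<subseteq> corner_arrows"
  then show "x \<in> carrier (corner_ring A e)"
    using corner_carrier_iff[OF A.ring_axioms e_carrier e_idem, of x] e_left_fixes[of x] e_right_fixes[of x] left_right_arrows_subset
    by (auto simp: corner_arrows_eq)
qed

lemma \<pi>_surj:
  assumes "keys a \<subseteq> carrier \<Gamma>"
  obtains b where "keys b \<subseteq> corner_arrows" "\<pi> b = a"
proof
  let ?b = "linear_ext (\<lambda>\<alpha>. single (arr \<alpha>) (of_nat n)) a"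
  show "keys ?b \<subseteq> corner_arrows"
    by (rule keys_linear_ext, rule keys_single_subset) (use assms arr_corner_arrows in blast)
  have "\<pi> ?b = linear_ext (\<lambda>\<alpha>. single \<alpha> 1) a"
    unfolding \<pi>_linear_ext by (rule linear_ext_cong) (use assms nK_pos in \<open>auto simp: \<pi>_arr\<close>)
  then show "\<pi> ?b = a" by simp
qed

lemma \<pi>_e: "\<pi> e = single \<one>\<^bsub>\<Gamma>\<^esub> 1"
  using \<pi>_arr[OF \<Gamma>_one(1), of "of_nat n"] nK_pos by (simp add: e_eq \<Gamma>_one)

text \<open>As \<open>\<pi>\<close> is multiplicative and maps \<open>eAe\<close> onto \<open>R\<Gamma>\<close>, the submodules of \<open>T\<close> over both rings are
  the same.\<close>

lemma simple_corner: "simple_module (corner_ring A e) (change_scalars \<pi> T)"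
  unfolding simple_module_def
proof (intro conjI allI impI)
  note c = corner_carrier
  have s: "x \<oplus>\<^bsub>corner_ring A e\<^esub> y = x + y" "x \<otimes>\<^bsub>corner_ring A e\<^esub> y = x \<bullet> y"
    "\<one>\<^bsub>corner_ring A e\<^esub> = e" for x y
    by (simp_all add: corner_ring_def)
  show "left_module (corner_ring A e) (change_scalars \<pi> T)"
  proof (intro left_module.intro left_module_axioms.intro)
    show "ring (corner_ring A e)" by (rule ring_corner_ring[OF A.ring_axioms e_carrier e_idem])
    show "abelian_group (change_scalars \<pi> T)" by (rule abelian_group_change_scalars[OF T.T.M.abelian_group_axioms])
  qed (auto simp: s c \<pi>_add \<pi>_mult \<pi>_e T.act_add T.act_mult keys_\<pi> T.T.smult_r_distr T.T.smult_one[simplified])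
  show "carrier (change_scalars \<pi> T) \<noteq> {\<zero>\<^bsub>change_scalars \<pi> T\<^esub>}"
    using simple_T by (simp add: simple_module_def)
  fix N assume N: "submodule N (corner_ring A e) (change_scalars \<pi> T)"
  have "submodule N T.RG T"
  proof (intro submodule.intro submodule_axioms.intro)
    have sg: "subgroup N (add_monoid (change_scalars \<pi> T))" using N by (rule submodule.axioms)
    then show "subgroup N (add_monoid T)" by (simp add: subgroup_def m_inv_def)
    fix a t assume a: "a \<in> carrier T.RG" and t: "t \<in> N"
    then obtain b where b: "keys b \<subseteq> corner_arrows" "\<pi> b = a" using \<pi>_surj[of a] by auto
    then show "a \<odot>\<^bsub>T\<^esub> t \<in> N"
      using submodule.smult_closed[OF N _ t, of b] c by simp
  qed
  then show "N = {\<zero>\<^bsub>change_scalars \<pi> T\<^esub>} \<or> N = carrier (change_scalars \<pi> T)"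
    using simple_T by (simp add: simple_module_def)
qed

sublocale ind: induced_module A e "change_scalars \<pi> T"
  by unfold_locales (rule e_carrier e_idem simple_corner)+

end

section \<open>The action on the head\<close>

context twisted_rep
begin

interpretation group G by (rule Obj_group[OF G])

abbreviation "c \<equiv> e_cat \<C> :: 'g arrow \<Rightarrow>\<^sub>0 'r"
abbreviation "single1 x \<equiv> single x (1 :: 'r)"

lemma Delta_Mor:
  assumes H: "H \<in> Obj \<C>" and h: "h \<in> carrier H"
  shows "Delta H h \<in> Mor \<C> H H"
proof -
  interpret H: group H by (rule Obj_group[OF H])
  have "conj_set (H \<times>\<times> H) (h, \<one>\<^bsub>H\<^esub>) (Id_on (carrier H)) = Delta H h"
    using h by (force simp: conj_set_def Delta_def inv_DirProd[OF H.is_group H.is_group])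
  moreover have "(h, \<one>\<^bsub>H\<^esub>) \<in> carrier (H \<times>\<times> H)" using h by simp
  ultimately show ?thesis
    using conj_cl Mor_Id[OF H] H unfolding conj_closed_def by metis
qed

lemma Delta_k2: "H \<in> Obj \<C> \<Longrightarrow> h \<in> carrier H \<Longrightarrow> k2 H (Delta H h) = {\<one>\<^bsub>H\<^esub>}"
proof -
  assume H: "H \<in> Obj \<C>" and h: "h \<in> carrier H"
  interpret H: group H by (rule Obj_group[OF H])
  have "x = \<one>\<^bsub>H\<^esub>" if "x \<in> carrier H" "\<one>\<^bsub>H\<^esub> = h \<otimes>\<^bsub>H\<^esub> x \<otimes>\<^bsub>H\<^esub> inv\<^bsub>H\<^esub> h" for x
  proof -
    have "h \<otimes>\<^bsub>H\<^esub> x = h \<otimes>\<^bsub>H\<^esub> x \<otimes>\<^bsub>H\<^esub> inv\<^bsub>H\<^esub> h \<otimes>\<^bsub>H\<^esub> h" using that(1) h by (simp add: H.m_assoc)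
    also have "\<dots> = h" unfolding that(2)[symmetric] using h by simp
    finally have "h \<otimes>\<^bsub>H\<^esub> x = h" .
    then show ?thesis using that(1) h by simp
  qed
  then show ?thesis using h by (force simp: k2_def Delta_def)
qed

lemma c_eq: "c = (\<Sum>J\<in>Obj \<C>. \<Sum>g\<in>carrier J. single1 (J, Delta J g, J))"
  by (simp add: e_cat_def e_grp_def)

lemma c_carrier: "c \<in> carrier A"
  unfolding A_carrier c_eq by (intro keys_sum_subset keys_single_subset) (simp add: in_arrows Delta_Mor)

text \<open>In the product with \<open>e\<^sub>\<C>\<close> each \<open>\<Delta>\<^sub>h * N2\<close> has coefficient \<open>1/|H|\<close>, because \<open>k\<^sub>2(\<Delta>\<^sub>h)\<close> is
  trivial.\<close>

lemma c_single:
  assumes H: "H \<in> Obj \<C>" and N: "N2 \<in> Mor \<C> H G"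
  shows "c \<bullet> single1 (H, N2, G) = (\<Sum>h\<in>carrier H. single (H, Delta H h O N2, G) (1 / of_nat (card (carrier H))))"
proof -
  have "\<one>\<^bsub>H\<^esub> \<in> k1 G N2" using k_one[OF H G N] by blast
  then have i: "{\<one>\<^bsub>H\<^esub>} \<inter> k1 G N2 = {\<one>\<^bsub>H\<^esub>}" by blast
  have "c \<bullet> single1 (H, N2, G) = (\<Sum>J\<in>Obj \<C>. \<Sum>g\<in>carrier J. arrow_prod (J, Delta J g, J) (H, N2, G))"
    unfolding c_eq A_mult by (simp add: linear_ext_sum)
  also have "\<dots> = (\<Sum>J\<in>Obj \<C>. if J = H then \<Sum>h\<in>carrier H. single (H, Delta H h O N2, G) (1 / of_nat (card (carrier H))) else 0)"
    by (rule sum.cong) (auto simp: arrow_prod_simps Delta_k2 i H intro!: sum.cong)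
  finally show ?thesis using fin_Obj H by simp
qed

lemma sandwich_expansion:
  assumes H: "H \<in> Obj \<C>" and N1: "N1 \<in> Mor \<C> G H" and N2: "N2 \<in> Mor \<C> H G"
  shows "single1 (G, N1, H) \<bullet> (c \<bullet> single1 (H, N2, G)) =
    (\<Sum>h\<in>carrier H. single (G, N1 O (Delta H h O N2), G)
      (of_nat (card (k2 G N1 \<inter> k1 G (Delta H h O N2))) / of_nat (card (carrier H)) ^ 2))"
  unfolding c_single[OF H N2] unfolding A_mult
  by (simp add: linear_ext_sum arrow_prod_simps power2_eq_square mult.commute)

text \<open>These elements span \<open>\<pi>(eAe\<^sub>\<C>Ae)\<close>.\<close>

definition "sandwiches = {\<pi> (single1 k \<bullet> (c \<bullet> single1 l)) | k l. k \<in> left_arrows \<and> l \<in> right_arrows}"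

lemma act_linear_ext_zero:
  assumes t: "t \<in> carrier T" and f: "\<And>x. x \<in> keys a \<Longrightarrow> keys (f x) \<subseteq> carrier \<Gamma> \<and> f x \<odot>\<^bsub>T\<^esub> t = \<zero>\<^bsub>T\<^esub>"
  shows "keys (linear_ext f a) \<subseteq> carrier \<Gamma> \<and> linear_ext f a \<odot>\<^bsub>T\<^esub> t = \<zero>\<^bsub>T\<^esub>"
proof -
  have "keys (\<Sum>x\<in>S. scl (d x) (f x)) \<subseteq> carrier \<Gamma> \<and> (\<Sum>x\<in>S. scl (d x) (f x)) \<odot>\<^bsub>T\<^esub> t = \<zero>\<^bsub>T\<^esub>"
    if "finite S" "S \<subseteq> keys a" for S d
    using that
  proof (induction S)
    case empty then show ?case using T.act_zero[OF t] by simp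
  next
    case (insert x S)
    have fx: "keys (f x) \<subseteq> carrier \<Gamma>" "f x \<odot>\<^bsub>T\<^esub> t = \<zero>\<^bsub>T\<^esub>" using f insert by blast+
    have "scl (d x) (f x) \<odot>\<^bsub>T\<^esub> t = \<zero>\<^bsub>T\<^esub>"
      using T.act_scl[OF fx(1) t, of "d x"] fx(2) T.V.smul_simps(2)[of "d x"] by simp
    moreover have "keys (scl (d x) (f x)) \<subseteq> carrier \<Gamma>" using keys_scl fx(1) by (rule order_trans)
    ultimately show ?case
      using insert t by (simp add: keys_add_subset T.act_add)
  qed
  then show ?thesis unfolding linear_ext_def by simp
qed

lemma keys_single_arrows: "k \<in> left_arrows \<Longrightarrow> keys (single1 k) \<subseteq> left_arrows" "l \<in> right_arrows \<Longrightarrow> keys (single1 l) \<subseteq> right_arrows"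
  by simp_all

lemma single_arrows_carrier: "k \<in> left_arrows \<Longrightarrow> single1 k \<in> carrier A" "l \<in> right_arrows \<Longrightarrow> single1 l \<in> carrier A"
  using left_right_arrows_subset by auto

lemma head_nonzero_iff_sandwiches:
  "(\<lambda>s. c \<odot>\<^bsub>simple_S \<C> G P K T\<^esub> s) ` carrier (simple_S \<C> G P K T) \<noteq> {\<zero>\<^bsub>simple_S \<C> G P K T\<^esub>}
   \<longleftrightarrow> (\<exists>w \<in> sandwiches. \<exists>t \<in> carrier T. w \<odot>\<^bsub>T\<^esub> t \<noteq> \<zero>\<^bsub>T\<^esub>)"
proof -
  have "(\<lambda>s. c \<odot>\<^bsub>simple_S \<C> G P K T\<^esub> s) ` carrier (simple_S \<C> G P K T) \<noteq> {\<zero>\<^bsub>simple_S \<C> G P K T\<^esub>} \<longleftrightarrow>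
    (\<exists>a \<in> carrier A. \<exists>x \<in> carrier A. \<exists>t \<in> carrier T. \<pi> (e \<bullet> (a \<bullet> (c \<bullet> (x \<bullet> e)))) \<odot>\<^bsub>T\<^esub> t \<noteq> \<zero>\<^bsub>T\<^esub>)"
    using ind.head_smult_nonzero_iff[OF c_carrier] by (simp add: simple_S_def)
  also have "\<dots> \<longleftrightarrow> (\<exists>w \<in> sandwiches. \<exists>t \<in> carrier T. w \<odot>\<^bsub>T\<^esub> t \<noteq> \<zero>\<^bsub>T\<^esub>)" (is "?L \<longleftrightarrow> ?R")
  proof
    assume ?R
    then obtain k l t where kl: "k \<in> left_arrows" "l \<in> right_arrows" and t: "t \<in> carrier T"
      and ne: "\<pi> (single1 k \<bullet> (c \<bullet> single1 l)) \<odot>\<^bsub>T\<^esub> t \<noteq> \<zero>\<^bsub>T\<^esub>"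
      unfolding sandwiches_def by blast
    note car = single_arrows_carrier(1)[OF kl(1)] single_arrows_carrier(2)[OF kl(2)] c_carrier e_carrier
    have "e \<bullet> (single1 k \<bullet> (c \<bullet> (single1 l \<bullet> e))) = single1 k \<bullet> (c \<bullet> single1 l)"
      unfolding e_right_fixes[OF keys_single_arrows(2)[OF kl(2)]]
      using A.m_assoc[OF car(4) car(1) A.m_closed[OF car(3,2)]] e_left_fixes[OF keys_single_arrows(1)[OF kl(1)]] by simp
    then show ?L using car t ne by metis
  next
    assume ?L
    then obtain a x t where a: "a \<in> carrier A" and x: "x \<in> carrier A" and t: "t \<in> carrier T"
      and ne: "\<pi> (e \<bullet> (a \<bullet> (c \<bullet> (x \<bullet> e)))) \<odot>\<^bsub>T\<^esub> t \<noteq> \<zero>\<^bsub>T\<^esub>" by blast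
    let ?a = "e \<bullet> a" and ?x = "x \<bullet> e"
    have ka: "keys ?a \<subseteq> left_arrows" and kx: "keys ?x \<subseteq> right_arrows"
      using keys_e_left keys_e_right a x A_carrier by blast+
    have assoc: "e \<bullet> (a \<bullet> (c \<bullet> ?x)) = ?a \<bullet> (c \<bullet> ?x)"
      using A.m_assoc[OF e_carrier a A.m_closed[OF c_carrier A.m_closed[OF x e_carrier]]] by simp
    have cx: "c \<bullet> ?x = linear_ext (\<lambda>l. c \<bullet> single1 l) ?x"
      unfolding A_mult[of c] by (subst linear_ext_swap) simp
    have "?a \<bullet> (c \<bullet> ?x) = linear_ext (\<lambda>k. single1 k \<bullet> (c \<bullet> ?x)) ?a"
      unfolding A_mult[of ?a] A_mult[of "single1 _"] by simp
    also have "(\<lambda>k. single1 k \<bullet> (c \<bullet> ?x)) = (\<lambda>k. linear_ext (\<lambda>l. single1 k \<bullet> (c \<bullet> single1 l)) ?x)"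
      unfolding cx A_mult[of "single1 _"] by (simp add: linear_ext_comp)
    finally have eq: "\<pi> (e \<bullet> (a \<bullet> (c \<bullet> ?x)))
      = linear_ext (\<lambda>k. linear_ext (\<lambda>l. \<pi> (single1 k \<bullet> (c \<bullet> single1 l))) ?x) ?a"
      unfolding assoc by (simp only: \<pi>_linear_ext)
    show ?R
    proof (rule ccontr)
      assume nR: "\<not> ?R"
      have "\<pi> (single1 k \<bullet> (c \<bullet> single1 l)) \<odot>\<^bsub>T\<^esub> t = \<zero>\<^bsub>T\<^esub>" if "k \<in> left_arrows" "l \<in> right_arrows" for k l
        using nR t that unfolding sandwiches_def by blast
      then have "linear_ext (\<lambda>k. linear_ext (\<lambda>l. \<pi> (single1 k \<bullet> (c \<bullet> single1 l))) ?x) ?a \<odot>\<^bsub>T\<^esub> t = \<zero>\<^bsub>T\<^esub>"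
        using ka kx keys_\<pi> by (intro act_linear_ext_zero[THEN conjunct2] act_linear_ext_zero t) blast
      then show False using ne eq by simp
    qed
  qed
  finally show ?thesis .
qed

lemma aut_goursat_left:
  assumes \<alpha>: "\<alpha> \<in> carrier \<Gamma>" and H: "H \<in> Obj \<C>" and N: "N1 \<in> Mor \<C> G H" "E O N1 = N1"
  shows "single (arr \<alpha>) (of_nat n) \<bullet> single1 (G, N1, H) = single1 (G, aut_goursat \<alpha> O N1, H)"
    and "(G, aut_goursat \<alpha> O N1, H) \<in> left_arrows"
proof -
  have M: "aut_goursat \<alpha> \<in> Mor \<C> G G" using \<alpha> \<Gamma>_iff by blast
  have "K \<inter> k1 H N1 = K" using left_stable(2)[OF s.group_section_axioms Mor_one[OF G H N(1)] N(2)] by blast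
  then show "single (arr \<alpha>) (of_nat n) \<bullet> single1 (G, N1, H) = single1 (G, aut_goursat \<alpha> O N1, H)"
    using nK_pos by (simp add: single_mult arrow_prod_simps k_aut_goursat[OF \<alpha>] n_div)
  have "E O aut_goursat \<alpha> = aut_goursat \<alpha>" using e_sec_left \<alpha> \<Gamma>_iff by blast
  then show "(G, aut_goursat \<alpha> O N1, H) \<in> left_arrows"
    using Mor_comp[OF G G H M N(1)] H by (simp add: left_arrows_def O_assoc[symmetric])
qed

lemma aut_goursat_right:
  assumes \<alpha>: "\<alpha> \<in> carrier \<Gamma>" and H: "H \<in> Obj \<C>" and N: "N2 \<in> Mor \<C> H G" "N2 O E = N2"
  shows "single1 (H, N2, G) \<bullet> single (arr \<alpha>) (of_nat n) = single1 (H, N2 O aut_goursat \<alpha>, G)"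
    and "(H, N2 O aut_goursat \<alpha>, G) \<in> right_arrows"
proof -
  have M: "aut_goursat \<alpha> \<in> Mor \<C> G G" using \<alpha> \<Gamma>_iff by blast
  have "k2 H N2 \<inter> K = K" using right_stable(2)[OF s.group_section_axioms Mor_one[OF H G N(1)] N(2)] by blast
  then show "single1 (H, N2, G) \<bullet> single (arr \<alpha>) (of_nat n) = single1 (H, N2 O aut_goursat \<alpha>, G)"
    using nK_pos by (simp add: single_mult arrow_prod_simps k_aut_goursat[OF \<alpha>] n_div)
  have "aut_goursat \<alpha> O E = aut_goursat \<alpha>" using e_sec_right \<alpha> \<Gamma>_iff by blast
  then show "(H, N2 O aut_goursat \<alpha>, G) \<in> right_arrows"
    using Mor_comp[OF H G G N(1) M] H by (simp add: right_arrows_def O_assoc)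
qed

lemma sandwich_in_corner: assumes "k \<in> left_arrows" "l \<in> right_arrows" shows "keys (single1 k \<bullet> (c \<bullet> single1 l)) \<subseteq> corner_arrows"
proof -
  note car = single_arrows_carrier(1)[OF assms(1)] single_arrows_carrier(2)[OF assms(2)] c_carrier e_carrier
  let ?z = "single1 k \<bullet> (c \<bullet> single1 l)"
  have "?z \<in> carrier A" using car by (intro A.m_closed)
  moreover have "e \<bullet> ?z = ?z"
    using A.m_assoc[OF car(4) car(1) A.m_closed[OF car(3,2)]] e_left_fixes[OF keys_single_arrows(1)[OF assms(1)]] by simp
  moreover have "?z \<bullet> e = ?z"
    using A.m_assoc[OF car(1) A.m_closed[OF car(3,2)] car(4)] A.m_assoc[OF car(3,2,4)]
      e_right_fixes[OF keys_single_arrows(2)[OF assms(2)]] by simp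
  ultimately show ?thesis
    using corner_carrier corner_carrier_iff[OF A.ring_axioms e_carrier e_idem] by blast
qed

lemma \<pi>_arr_n: "\<alpha> \<in> carrier \<Gamma> \<Longrightarrow> \<pi> (single (arr \<alpha>) (of_nat n)) = T.bas \<alpha>"
  using \<pi>_arr[of \<alpha> "of_nat n"] nK_pos by simp

text \<open>Multiplication by group elements permutes the spanning elements; it only changes the outer
  morphisms.\<close>

lemma sandwich_left:
  assumes \<alpha>: "\<alpha> \<in> carrier \<Gamma>" and k: "(G, N1, H) \<in> left_arrows" and l: "l \<in> right_arrows"
  shows "T.bas \<alpha> \<otimes>\<^bsub>T.RG\<^esub> \<pi> (single1 (G, N1, H) \<bullet> (c \<bullet> single1 l))
    = \<pi> (single1 (G, aut_goursat \<alpha> O N1, H) \<bullet> (c \<bullet> single1 l))"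
proof -
  have N: "H \<in> Obj \<C>" "N1 \<in> Mor \<C> G H" "E O N1 = N1" using k by (auto simp: left_arrows_def)
  have ca: "single (arr \<alpha>) (of_nat n) \<in> carrier A" using arr_arrow[OF \<alpha>] by simp
  have "T.bas \<alpha> \<otimes>\<^bsub>T.RG\<^esub> \<pi> (single1 (G, N1, H) \<bullet> (c \<bullet> single1 l))
    = \<pi> (single (arr \<alpha>) (of_nat n) \<bullet> (single1 (G, N1, H) \<bullet> (c \<bullet> single1 l)))"
    unfolding \<pi>_arr_n[OF \<alpha>, symmetric]
    by (rule \<pi>_mult[symmetric]) (use arr_corner_arrows[OF \<alpha>] sandwich_in_corner[OF k l] in auto)
  then show ?thesis
    unfolding A.m_assoc[OF ca single_arrows_carrier(1)[OF k] A.m_closed[OF c_carrier single_arrows_carrier(2)[OF l]], symmetric]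
      aut_goursat_left(1)[OF \<alpha> N] .
qed

lemma sandwich_right:
  assumes \<alpha>: "\<alpha> \<in> carrier \<Gamma>" and k: "k \<in> left_arrows" and l: "(H, N2, G) \<in> right_arrows"
  shows "\<pi> (single1 k \<bullet> (c \<bullet> single1 (H, N2, G))) \<otimes>\<^bsub>T.RG\<^esub> T.bas \<alpha>
    = \<pi> (single1 k \<bullet> (c \<bullet> single1 (H, N2 O aut_goursat \<alpha>, G)))"
proof -
  have N: "H \<in> Obj \<C>" "N2 \<in> Mor \<C> H G" "N2 O E = N2" using l by (auto simp: right_arrows_def)
  have ca: "single (arr \<alpha>) (of_nat n) \<in> carrier A" using arr_arrow[OF \<alpha>] by simp
  have "\<pi> (single1 k \<bullet> (c \<bullet> single1 (H, N2, G))) \<otimes>\<^bsub>T.RG\<^esub> T.bas \<alpha>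
    = \<pi> ((single1 k \<bullet> (c \<bullet> single1 (H, N2, G))) \<bullet> single (arr \<alpha>) (of_nat n))"
    unfolding \<pi>_arr_n[OF \<alpha>, symmetric]
    by (rule \<pi>_mult[symmetric]) (use arr_corner_arrows[OF \<alpha>] sandwich_in_corner[OF k l] in auto)
  then show ?thesis
    unfolding A.m_assoc[OF single_arrows_carrier(1)[OF k] A.m_closed[OF c_carrier single_arrows_carrier(2)[OF l]] ca]
      A.m_assoc[OF c_carrier single_arrows_carrier(2)[OF l] ca] aut_goursat_right(1)[OF \<alpha> N] .
qed

lemma sandwiches_chi_iff: "(\<exists>w \<in> sandwiches. \<exists>t \<in> carrier T. w \<odot>\<^bsub>T\<^esub> t \<noteq> \<zero>\<^bsub>T\<^esub>) \<longleftrightarrow> (\<exists>w \<in> sandwiches. T.chi w \<noteq> 0)"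
proof (rule T.character_detects_action)
  fix w assume "w \<in> sandwiches"
  then obtain k l where w: "w = \<pi> (single1 k \<bullet> (c \<bullet> single1 l))" "k \<in> left_arrows" "l \<in> right_arrows" unfolding sandwiches_def by blast
  show "keys w \<subseteq> carrier \<Gamma>" using w keys_\<pi> by simp
  fix \<alpha> assume \<alpha>: "\<alpha> \<in> carrier \<Gamma>"
  obtain N1 H where k: "k = (G, N1, H)" "H \<in> Obj \<C>" "N1 \<in> Mor \<C> G H" "E O N1 = N1" using w(2) by (auto simp: left_arrows_def)
  show "T.bas \<alpha> \<otimes>\<^bsub>T.RG\<^esub> w \<in> sandwiches"
    unfolding w(1) k(1) sandwich_left[OF \<alpha> w(2)[unfolded k(1)] w(3)]
    unfolding sandwiches_def using aut_goursat_left(2)[OF \<alpha> k(2-4)] w(3) by blast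
  obtain N2 H' where l: "l = (H', N2, G)" "H' \<in> Obj \<C>" "N2 \<in> Mor \<C> H' G" "N2 O E = N2" using w(3) by (auto simp: right_arrows_def)
  show "w \<otimes>\<^bsub>T.RG\<^esub> T.bas \<alpha> \<in> sandwiches"
    unfolding w(1) l(1) sandwich_right[OF \<alpha> w(2) w(3)[unfolded l(1)]]
    unfolding sandwiches_def using aut_goursat_right(2)[OF \<alpha> l(2-4)] w(2) by blast
qed

end

section \<open>The character sum\<close>

context twisted_rep
begin

interpretation group G by (rule Obj_group[OF G])

text \<open>Only those \<open>h\<close> contribute for which the two inner sections are linked. The denominator
  consists of \<open>|H|\<close> from each of the two twisted products and of \<open>[G:K]\<close> from \<open>\<pi>\<close>.\<close>

lemma chi_sandwich:
  assumes H: "H \<in> Obj \<C>" and \<sigma>: "section_iso G P K H P' K' \<sigma>" "goursat G P K \<sigma> H P' K' \<in> Mor \<C> G H"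
    and \<rho>: "section_iso H P'' K'' G P K \<rho>" "goursat H P'' K'' \<rho> G P K \<in> Mor \<C> H G"
  shows "T.chi (\<pi> (single1 (G, goursat G P K \<sigma> H P' K', H) \<bullet> (c \<bullet> single1 (H, goursat H P'' K'' \<rho> G P K, G))))
    = (\<Sum>h \<in> {h \<in> carrier H. linked H P' K' (conj_set H h P'') (conj_set H h K'')}.
        of_nat (card (K' \<inter> conj_set H h K'')) *
        T.chi (T.bas (restrict (\<sigma> \<circ> beta H P' K' (conj_set H h P'') (conj_set H h K'') \<circ> conj_set H h \<circ> \<rho>) (carrier Q))))
      / (of_nat n * of_nat (card (carrier H)) ^ 2)"
proof -
  interpret \<sigma>: section_iso G P K H P' K' \<sigma> by fact
  interpret \<rho>: section_iso H P'' K'' G P K \<rho> by fact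
  let ?N1 = "\<sigma>.L" and ?N2 = "\<rho>.L"
  let ?l = "\<lambda>h. linked H P' K' (conj_set H h P'') (conj_set H h K'')"
  let ?tw = "\<lambda>h. \<sigma> \<circ> beta H P' K' (conj_set H h P'') (conj_set H h K'') \<circ> conj_set H h \<circ> \<rho>"
  let ?m = "of_nat (card (carrier H)) ^ 2 :: 'r"
  have term_eq: "\<pi> (single (G, ?N1 O (Delta H h O ?N2), G)
      (of_nat (card (k2 G ?N1 \<inter> k1 G (Delta H h O ?N2))) / ?m))
    = (if ?l h then single (restrict (?tw h) (carrier Q)) (of_nat (card (K' \<inter> conj_set H h K'')) / (of_nat n * ?m)) else 0)
    \<and> (?l h \<longrightarrow> restrict (?tw h) (carrier Q) \<in> carrier \<Gamma>)"
    if h: "h \<in> carrier H" for h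
  proof -
    note D = Delta_comp_goursat[OF \<rho>(1) h]
    interpret d: section_iso H "conj_set H h P''" "conj_set H h K''" G P K "conj_set H h \<circ> \<rho>" by (rule D(2))
    show ?thesis
    proof (cases "?l h")
      case True
      note L = goursat_comp_linked[OF \<sigma>(1) D(2) True]
      have tw: "\<sigma> \<circ> beta H P' K' (conj_set H h P'') (conj_set H h K'') \<circ> (conj_set H h \<circ> \<rho>) = ?tw h"
        by (simp add: comp_assoc)
      have comp: "?N1 O (Delta H h O ?N2) = aut_goursat (?tw h)" unfolding D(1) L(1) tw ..
      have M: "aut_goursat (?tw h) \<in> Mor \<C> G G"
        unfolding comp[symmetric] by (intro Mor_comp[OF G H G \<sigma>(2)] Mor_comp[OF H H G Delta_Mor[OF H h] \<rho>(2)])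
      note R = \<Gamma>_restrict[OF L(2)[unfolded tw] M]
      have "\<pi> (single (G, ?N1 O (Delta H h O ?N2), G) r) = single (restrict (?tw h) (carrier Q)) (r / of_nat n)" for r
        unfolding comp R(2)[symmetric] by (rule \<pi>_arr[OF R(1)])
      moreover have "k2 G ?N1 = K'" "k1 G (Delta H h O ?N2) = conj_set H h K''"
        unfolding D(1) by (rule \<sigma>.k2_L, rule d.k1_L)
      ultimately show ?thesis using True R(1) by (simp add: mult.commute)
    next
      case False
      have "?N1 O (Delta H h O ?N2) \<noteq> aut_goursat \<gamma>" if "\<gamma> \<in> carrier \<Gamma>" for \<gamma>
      proof
        assume eq: "?N1 O (Delta H h O ?N2) = aut_goursat \<gamma>"
        have "section_iso G P K G P K \<gamma>" using that \<Gamma>_iff by blast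
        then show False using linked_of_comp[OF \<sigma>(1) D(2)] eq False unfolding D(1) by blast
      qed
      then have "\<pi> (single (G, ?N1 O (Delta H h O ?N2), G) r) = 0" for r
        by (intro \<pi>_other) simp
      then show ?thesis using False by simp
    qed
  qed
  have fin: "finite (carrier H)" by (rule Obj_group(2)[OF H])
  have "\<pi> (single1 (G, ?N1, H) \<bullet> (c \<bullet> single1 (H, ?N2, G)))
    = (\<Sum>h \<in> carrier H. if ?l h then single (restrict (?tw h) (carrier Q)) (of_nat (card (K' \<inter> conj_set H h K'')) / (of_nat n * ?m)) else 0)"
    unfolding sandwich_expansion[OF H \<sigma>(2) \<rho>(2)] \<pi>_sum by (rule sum.cong) (use term_eq in blast)+
  also have "\<dots> = (\<Sum>h \<in> {h \<in> carrier H. ?l h}. single (restrict (?tw h) (carrier Q)) (of_nat (card (K' \<inter> conj_set H h K'')) / (of_nat n * ?m)))"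
    using fin by (simp add: sum.inter_filter)
  finally have eq: "\<pi> (single1 (G, ?N1, H) \<bullet> (c \<bullet> single1 (H, ?N2, G))) = \<dots>" .
  have in\<Gamma>: "restrict (?tw h) (carrier Q) \<in> carrier \<Gamma>" if "h \<in> {h \<in> carrier H. ?l h}" for h
    using term_eq that by blast
  have chi_single: "T.chi (single \<alpha> r) = r * T.chi (T.bas \<alpha>)" if "\<alpha> \<in> carrier \<Gamma>" for \<alpha> r
    using T.chi_scl[of "T.bas \<alpha>" r] that by simp
  have "T.chi (\<pi> (single1 (G, ?N1, H) \<bullet> (c \<bullet> single1 (H, ?N2, G))))
    = (\<Sum>h \<in> {h \<in> carrier H. ?l h}. T.chi (single (restrict (?tw h) (carrier Q)) (of_nat (card (K' \<inter> conj_set H h K'')) / (of_nat n * ?m))))"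
    unfolding eq by (rule T.chi_sum, rule keys_single_subset, rule in\<Gamma>)
  also have "\<dots> = (\<Sum>h \<in> {h \<in> carrier H. ?l h}. of_nat (card (K' \<inter> conj_set H h K'')) / (of_nat n * ?m) * T.chi (T.bas (restrict (?tw h) (carrier Q))))"
    by (rule sum.cong[OF refl], rule chi_single, rule in\<Gamma>)
  finally show ?thesis by (simp add: sum_divide_distrib)
qed

text \<open>If the value is nonzero, then some composite \<open>N1 * \<Delta>\<^sub>h * N2\<close> lies in \<open>\<Gamma>\<^sub>e\<close>. This determines
  the outer sections of both morphisms, and Goursat's lemma yields their form.\<close>

lemma nonzero_chi_form:
  assumes k: "k \<in> left_arrows" and l: "l \<in> right_arrows" and ne: "T.chi (\<pi> (single1 k \<bullet> (c \<bullet> single1 l))) \<noteq> 0"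
  obtains H P' K' P'' K'' \<sigma> \<rho> where "H \<in> Obj \<C>" "k = (G, goursat G P K \<sigma> H P' K', H)" "l = (H, goursat H P'' K'' \<rho> G P K, G)"
    "section_iso G P K H P' K' \<sigma>" "section_iso H P'' K'' G P K \<rho>"
    "goursat G P K \<sigma> H P' K' \<in> Mor \<C> G H" "goursat H P'' K'' \<rho> G P K \<in> Mor \<C> H G"
proof -
  obtain N1 H where k': "k = (G, N1, H)" "H \<in> Obj \<C>" "N1 \<in> Mor \<C> G H" "E O N1 = N1" using k by (auto simp: left_arrows_def)
  obtain N2 H' where l': "l = (H', N2, G)" "H' \<in> Obj \<C>" "N2 \<in> Mor \<C> H' G" "N2 O E = N2" using l by (auto simp: right_arrows_def)
  have "H = H'"
  proof (rule ccontr)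
    assume "H \<noteq> H'"
    then have "single1 k \<bullet> (c \<bullet> single1 l) = 0"
      unfolding k'(1) l'(1) c_single[OF l'(2,3)] unfolding A_mult
      by (simp add: linear_ext_sum arrow_prod_simps)
    then show False using ne T.chi_zero \<pi>_zero by simp
  qed
  note l' = l'[folded this]
  have "\<exists>h \<in> carrier H. \<exists>\<gamma> \<in> carrier \<Gamma>. N1 O (Delta H h O N2) = aut_goursat \<gamma>"
  proof (rule ccontr)
    assume no: "\<not> (\<exists>h \<in> carrier H. \<exists>\<gamma> \<in> carrier \<Gamma>. N1 O (Delta H h O N2) = aut_goursat \<gamma>)"
    have "\<pi> (single (G, N1 O (Delta H h O N2), G) r) = 0" if "h \<in> carrier H" for h r
      by (rule \<pi>_other) (use no that in auto)
    then have "\<pi> (single1 k \<bullet> (c \<bullet> single1 l)) = 0"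
      unfolding k'(1) l'(1) sandwich_expansion[OF k'(2,3) l'(3)] \<pi>_sum by (intro sum.neutral) blast
    then show False using ne T.chi_zero by simp
  qed
  then obtain h \<gamma> where h: "h \<in> carrier H" and \<gamma>: "\<gamma> \<in> carrier \<Gamma>" and eq: "N1 O (Delta H h O N2) = aut_goursat \<gamma>" by blast
  have s\<gamma>: "section_iso G P K G P K \<gamma>" using \<gamma> \<Gamma>_iff by blast
  have DM: "Delta H h \<in> Mor \<C> H H" by (rule Delta_Mor[OF k'(2) h])
  have M1: "Delta H h O N2 \<in> Mor \<C> H G" by (rule Mor_comp[OF k'(2) k'(2) G DM l'(3)])
  have M2: "N1 O Delta H h \<in> Mor \<C> G H" by (rule Mor_comp[OF G k'(2) k'(2) k'(3) DM])
  have "(Delta H h O N2) O E = Delta H h O N2" unfolding O_assoc l'(4) ..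
  note e1 = invertible_composite_ends(1,2)[OF s\<gamma> eq Mor_one[OF G k'(2,3)] k'(4) Mor_one[OF k'(2) G M1] this]
  have eq2: "(N1 O Delta H h) O N2 = aut_goursat \<gamma>" using eq by (simp add: O_assoc)
  have "E O (N1 O Delta H h) = N1 O Delta H h" unfolding O_assoc[symmetric] k'(4) ..
  note e2 = invertible_composite_ends(3,4)[OF s\<gamma> eq2 Mor_one[OF G k'(2) M2] this Mor_one[OF k'(2) G l'(3)] l'(4)]
  obtain \<sigma> where \<sigma>: "section_iso G P K H (snd ` N1) (k2 G N1) \<sigma>" "N1 = goursat G P K \<sigma> H (snd ` N1) (k2 G N1)"
    using goursat_subgroup_decomp[OF Obj_group(1)[OF G] Obj_group(1)[OF k'(2)] Mor_subgroup[OF G k'(2,3)]] unfolding e1 by metis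
  obtain \<rho> where \<rho>: "section_iso H (fst ` N2) (k1 G N2) G P K \<rho>" "N2 = goursat H (fst ` N2) (k1 G N2) \<rho> G P K"
    using goursat_subgroup_decomp[OF Obj_group(1)[OF k'(2)] Obj_group(1)[OF G] Mor_subgroup[OF k'(2) G l'(3)]] unfolding e2 by metis
  show thesis
    by (rule that[OF k'(2) _ _ \<sigma>(1) \<rho>(1)]) (use k' l' \<sigma>(2) \<rho>(2) in \<open>simp_all only: \<sigma>(2)[symmetric] \<rho>(2)[symmetric]\<close>)
qed

context
  fixes H P'' K''
  assumes H: "H \<in> Obj \<C>" and s'': "group_section H P'' K''" and QQ: "subquot G P K \<cong> subquot H P'' K''"
begin

abbreviation "Q'' \<equiv> subquot H P'' K''"
abbreviation "\<gamma> \<equiv> transport_iso \<C> G P K H P'' K''"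

lemma star_iso:
  assumes "J1 \<in> Obj \<C>" "J2 \<in> Obj \<C>" "group_section J1 P1 K1" "group_section J2 P2 K2" "subquot J1 P1 K1 \<cong> Q" "Q \<cong> subquot J2 P2 K2"
  shows "\<exists>\<alpha>. section_iso J1 P1 K1 J2 P2 K2 \<alpha> \<and> goursat J1 P1 K1 \<alpha> J2 P2 K2 \<in> Mor \<C> J1 J2"
proof -
  interpret i: section_iso G P K G P K id by (rule section_iso_id[OF s.group_section_axioms])
  have "realized \<C> Q"
    unfolding realized_def using G e_Mor i.q_group_L iso_refl unfolding e_sec_def by metis
  then show ?thesis
    using star s.group_Q assms group_section.is_sec[OF assms(3)] group_section.is_sec[OF assms(4)]
    unfolding condition_star_def section_iso_def section_iso_axioms_def by metis
qed

lemma \<gamma>: "section_iso G P K H P'' K'' \<gamma>" "goursat G P K \<gamma> H P'' K'' \<in> Mor \<C> G H"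
proof -
  have "\<exists>\<alpha>. \<alpha> \<in> iso Q'' Q \<and> goursat G P K \<alpha> H P'' K'' \<in> Mor \<C> G H"
    using star_iso[OF G H s.group_section_axioms s'' iso_refl QQ] section_iso.iso by metis
  from someI_ex[OF this] show "section_iso G P K H P'' K'' \<gamma>" "goursat G P K \<gamma> H P'' K'' \<in> Mor \<C> G H"
    using s.group_section_axioms s'' by (simp_all add: transport_iso_def section_iso_def section_iso_axioms_def)
qed

interpretation \<gamma>: section_iso G P K H P'' K'' \<gamma> by (rule \<gamma>(1))

abbreviation "\<gamma>i \<equiv> inv_into (carrier Q'') \<gamma>"

lemma \<gamma>i: "section_iso H P'' K'' G P K \<gamma>i" by (rule section_iso_inv[OF \<gamma>(1)])

lemma \<gamma>_\<gamma>i: "X \<in> carrier Q \<Longrightarrow> \<gamma> (\<gamma>i X) = X" "X \<in> carrier Q \<Longrightarrow> \<gamma>i X \<in> carrier Q''"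
  using bij_betw_inv_into_right[OF \<gamma>.bij] bij_betwE[OF bij_betw_inv_into[OF \<gamma>.bij]] by auto

lemma \<gamma>i_\<gamma>: "X \<in> carrier Q'' \<Longrightarrow> \<gamma>i (\<gamma> X) = X"
  using bij_betw_inv_into_left[OF \<gamma>.bij] by auto

text \<open>Condition \<open>(*)\<close> gives a morphism for some isomorphism \<open>\<delta>\<close> in the opposite direction, which
  need not be \<open>\<gamma>\<^sup>-\<^sup>1\<close>. But \<open>\<gamma> \<delta>\<close> belongs to the group \<open>\<Gamma>\<close>, and \<open>\<gamma>\<^sup>-\<^sup>1 = \<delta> (\<gamma> \<delta>)\<^sup>-\<^sup>1\<close>.\<close>

lemma \<gamma>i_Mor: "goursat H P'' K'' \<gamma>i G P K \<in> Mor \<C> H G"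
proof -
  obtain \<delta> where \<delta>: "section_iso H P'' K'' G P K \<delta>" "goursat H P'' K'' \<delta> G P K \<in> Mor \<C> H G"
    using star_iso[OF H G s'' s.group_section_axioms group.iso_sym[OF s.group_Q QQ] iso_refl] by blast
  interpret \<delta>: section_iso H P'' K'' G P K \<delta> by (rule \<delta>(1))
  have "aut_goursat (\<gamma> \<circ> \<delta>) \<in> Mor \<C> G G"
    unfolding goursat_comp[OF \<gamma>(1) \<delta>(1), symmetric] by (rule Mor_comp[OF G H G \<gamma>(2) \<delta>(2)])
  note a = \<Gamma>_restrict[OF section_iso_comp[OF \<gamma>(1) \<delta>(1)] this]
  define b where "b = inv\<^bsub>\<Gamma>\<^esub> (restrict (\<gamma> \<circ> \<delta>) (carrier Q))"
  have b: "b \<in> carrier \<Gamma>" unfolding b_def by (rule T.inv_closed[OF a(1)])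
  have ab: "restrict (\<gamma> \<circ> \<delta>) (carrier Q) \<otimes>\<^bsub>\<Gamma>\<^esub> b = (\<lambda>x\<in>carrier Q. x)"
    unfolding b_def T.r_inv[OF a(1)] by (rule \<Gamma>_one(3))
  have sb: "section_iso G P K G P K b" "aut_goursat b \<in> Mor \<C> G G" using b \<Gamma>_iff by blast+
  have "(\<delta> \<circ> b) X = \<gamma>i X" if X: "X \<in> carrier Q" for X
  proof -
    have bX: "b X \<in> carrier Q" using bij_betwE[OF section_iso.bij[OF sb(1)]] X by blast
    have dX: "\<delta> (b X) \<in> carrier Q''" using bij_betwE[OF \<delta>.bij] bX by blast
    have "\<gamma> (\<delta> (b X)) = X"
      using fun_cong[OF ab, of X] X bX unfolding \<Gamma>_mult[OF a(1) b] compose_def by simp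
    then show ?thesis using \<gamma>i_\<gamma>[OF dX] by simp
  qed
  then have "goursat H P'' K'' (\<delta> \<circ> b) G P K = goursat H P'' K'' \<gamma>i G P K"
    by (rule goursat_cong[OF s.group_section_axioms])
  then show ?thesis
    using Mor_comp[OF H G G \<delta>(2) sb(2)] goursat_comp[OF \<delta>(1) sb(1)] by simp
qed

text \<open>The field acts on the transported module as it does on \<open>T\<close>; so both traces are taken over the
  same vector space, with the same chosen basis.\<close>

lemma character_transport:
  "module_character (AutC \<C> H P'' K'') (transport_module \<C> G P K T H P'' K'') (twist_aut H P'' K'' \<tau> P' K' h)
   = T.chi (T.bas (restrict (\<gamma> \<circ> \<tau> \<circ> beta H P' K' (conj_set H h P'') (conj_set H h K'') \<circ> conj_set H h \<circ> \<gamma>i) (carrier Q)))"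
proof -
  let ?cb = "conj_by_iso Q'' Q \<gamma>"
  let ?lx = "linear_ext (\<lambda>\<alpha>. single (?cb \<alpha>) (1 :: 'r))"
  have one: "?cb \<one>\<^bsub>AutC \<C> H P'' K''\<^esub> = \<one>\<^bsub>\<Gamma>\<^esub>"
    unfolding \<Gamma>_one(3) conj_by_iso_def
    by (rule restrict_ext) (simp add: AutC_def AutoGroup_def BijGroup_def \<gamma>_\<gamma>i)
  have V: "change_scalars (single \<one>\<^bsub>AutC \<C> H P'' K''\<^esub>) (transport_module \<C> G P K T H P'' K'') = T.V"
    unfolding transport_module_def change_scalars_def by (simp add: one)
  have tw: "?cb (twist_aut H P'' K'' \<tau> P' K' h) =
    restrict (\<gamma> \<circ> \<tau> \<circ> beta H P' K' (conj_set H h P'') (conj_set H h K'') \<circ> conj_set H h \<circ> \<gamma>i) (carrier Q)"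
    unfolding conj_by_iso_def twist_aut_def by (rule restrict_ext) (simp add: \<gamma>_\<gamma>i(2))
  show ?thesis
    unfolding module_character_def V T.chi_def tw[symmetric]
    by (rule arg_cong[where f = "trace_on T.V"], rule ext) (simp add: transport_module_def)
qed

end

text \<open>For the implication from left to right, the automorphism \<open>\<gamma> \<rho>\<close> is split off on the right,
  moved to the left by \<open>chi (ab) = chi (ba)\<close>, and absorbed into \<open>\<sigma>\<close>; after that, \<open>\<rho> = \<gamma>\<^sup>-\<^sup>1\<close>.\<close>

lemma sandwich_chi_iff_character_sum:
  "(\<exists>w \<in> sandwiches. T.chi w \<noteq> 0) \<longleftrightarrow>
     (\<exists>H \<in> Obj \<C>. \<exists>P'' K'' \<tau> P' K'.
        is_section H P'' K'' \<and> is_section H P' K' \<and>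
        \<tau> \<in> iso (subquot H P' K') (subquot H P'' K'') \<and>
        goursat H P'' K'' \<tau> H P' K' \<in> Mor \<C> H H \<and>
        q_group H H (goursat H P'' K'' \<tau> H P' K') \<cong> subquot G P K \<and>
        (\<Sum>h \<in> {h \<in> carrier H. linked H P' K' (conj_set H h P'') (conj_set H h K'')}.
           of_nat (card (K' \<inter> conj_set H h K'')) *
           module_character (AutC \<C> H P'' K'') (transport_module \<C> G P K T H P'' K'')
             (twist_aut H P'' K'' \<tau> P' K' h)) \<noteq> 0)" (is "?L \<longleftrightarrow> ?R")
proof
  assume ?R
  then obtain H P'' K'' \<tau> P' K' where H: "H \<in> Obj \<C>" and secs: "is_section H P'' K''" "is_section H P' K'"
    and \<tau>: "\<tau> \<in> iso (subquot H P' K') (subquot H P'' K'')" "goursat H P'' K'' \<tau> H P' K' \<in> Mor \<C> H H"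
    and q: "q_group H H (goursat H P'' K'' \<tau> H P' K') \<cong> subquot G P K"
    and ne: "(\<Sum>h \<in> {h \<in> carrier H. linked H P' K' (conj_set H h P'') (conj_set H h K'')}.
           of_nat (card (K' \<inter> conj_set H h K'')) *
           module_character (AutC \<C> H P'' K'') (transport_module \<C> G P K T H P'' K'')
             (twist_aut H P'' K'' \<tau> P' K' h)) \<noteq> 0" by blast
  interpret H: group H by (rule Obj_group[OF H])
  have s'': "group_section H P'' K''" and s': "group_section H P' K'" by (unfold_locales, fact)+
  interpret \<tau>: section_iso H P'' K'' H P' K' \<tau> using s'' s' \<tau>(1) by (simp add: section_iso_def section_iso_axioms_def)
  have QQ: "subquot G P K \<cong> subquot H P'' K''"
    by (rule group.iso_sym[OF \<tau>.s1.group_Q q[unfolded \<tau>.q_group_L]])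
  note \<gamma> = \<gamma>[OF H s'' QQ] \<gamma>i[OF H s'' QQ] \<gamma>i_Mor[OF H s'' QQ]
  let ?\<gamma> = "transport_iso \<C> G P K H P'' K''"
  let ?\<sigma> = "?\<gamma> \<circ> \<tau>"
  let ?\<rho> = "inv_into (carrier (subquot H P'' K'')) ?\<gamma>"
  have \<sigma>: "section_iso G P K H P' K' ?\<sigma>" by (rule section_iso_comp[OF \<gamma>(1) \<tau>.section_iso_axioms])
  have \<sigma>M: "goursat G P K ?\<sigma> H P' K' \<in> Mor \<C> G H"
    unfolding goursat_comp[OF \<gamma>(1) \<tau>.section_iso_axioms, symmetric] by (rule Mor_comp[OF G H H \<gamma>(2) \<tau>(2)])
  have kK: "(G, goursat G P K ?\<sigma> H P' K', H) \<in> left_arrows" using \<sigma>M H e_sec_left[OF \<sigma>] by (simp add: left_arrows_def)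
  have lK: "(H, goursat H P'' K'' ?\<rho> G P K, G) \<in> right_arrows" using \<gamma>(4) H e_sec_right[OF \<gamma>(3)] by (simp add: right_arrows_def)
  have "T.chi (\<pi> (single1 (G, goursat G P K ?\<sigma> H P' K', H) \<bullet> (c \<bullet> single1 (H, goursat H P'' K'' ?\<rho> G P K, G)))) \<noteq> 0"
    unfolding chi_sandwich[OF H \<sigma> \<sigma>M \<gamma>(3,4)]
    using ne nK_pos(1) card_pos[OF H] unfolding character_transport[OF H s'' QQ] by simp
  then show ?L unfolding sandwiches_def using kK lK by blast
next
  assume ?L
  then obtain k l where kl: "k \<in> left_arrows" "l \<in> right_arrows" and ne: "T.chi (\<pi> (single1 k \<bullet> (c \<bullet> single1 l))) \<noteq> 0"
    unfolding sandwiches_def by blast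
  obtain H P' K' P'' K'' \<sigma> \<rho> where H: "H \<in> Obj \<C>" and k: "k = (G, goursat G P K \<sigma> H P' K', H)" and l: "l = (H, goursat H P'' K'' \<rho> G P K, G)"
    and \<sigma>: "section_iso G P K H P' K' \<sigma>" and \<rho>: "section_iso H P'' K'' G P K \<rho>"
    and M: "goursat G P K \<sigma> H P' K' \<in> Mor \<C> G H" "goursat H P'' K'' \<rho> G P K \<in> Mor \<C> H G"
    by (rule nonzero_chi_form[OF kl ne], rule that)
  interpret \<sigma>: section_iso G P K H P' K' \<sigma> by fact
  interpret \<rho>: section_iso H P'' K'' G P K \<rho> by fact
  note s'' = \<rho>.s1.group_section_axioms
  have QQ: "subquot G P K \<cong> subquot H P'' K''" using \<rho>.iso unfolding is_iso_def by blast
  note \<gamma> = \<gamma>[OF H s'' QQ] \<gamma>i[OF H s'' QQ] \<gamma>i_Mor[OF H s'' QQ]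
  let ?\<gamma> = "transport_iso \<C> G P K H P'' K''"
  let ?\<gamma>i = "inv_into (carrier (subquot H P'' K'')) ?\<gamma>"
  let ?a = "restrict (?\<gamma> \<circ> \<rho>) (carrier Q)"
  have "aut_goursat (?\<gamma> \<circ> \<rho>) \<in> Mor \<C> G G"
    unfolding goursat_comp[OF \<gamma>(1) \<rho>, symmetric] by (rule Mor_comp[OF G H G \<gamma>(2) M(2)])
  note a = \<Gamma>_restrict[OF section_iso_comp[OF \<gamma>(1) \<rho>] this]
  have sa: "section_iso G P K G P K ?a" "aut_goursat ?a \<in> Mor \<C> G G" using a(1) \<Gamma>_iff by blast+
  let ?l0 = "(H, goursat H P'' K'' ?\<gamma>i G P K, G)"
  have l0: "?l0 \<in> right_arrows" using \<gamma>(4) H e_sec_right[OF \<gamma>(3)] by (simp add: right_arrows_def)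
  have "goursat H P'' K'' ?\<gamma>i G P K O aut_goursat ?a = goursat H P'' K'' (?\<gamma>i \<circ> ?a) G P K"
    by (rule goursat_comp[OF \<gamma>(3) sa(1)])
  also have "\<dots> = goursat H P'' K'' \<rho> G P K"
  proof (rule goursat_cong[OF s.group_section_axioms])
    fix X assume X: "X \<in> carrier Q"
    then have "\<rho> X \<in> carrier (subquot H P'' K'')" using bij_betwE[OF \<rho>.bij] by blast
    then show "(?\<gamma>i \<circ> ?a) X = \<rho> X" using X \<gamma>i_\<gamma>[OF H s'' QQ] by simp
  qed
  finally have lfac: "goursat H P'' K'' ?\<gamma>i G P K O aut_goursat ?a = goursat H P'' K'' \<rho> G P K" .
  let ?k' = "(G, aut_goursat ?a O goursat G P K \<sigma> H P' K', H)"
  have "T.chi (\<pi> (single1 k \<bullet> (c \<bullet> single1 l)))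
    = T.chi (\<pi> (single1 k \<bullet> (c \<bullet> single1 ?l0)) \<otimes>\<^bsub>T.RG\<^esub> T.bas ?a)"
    unfolding sandwich_right[OF a(1) kl(1) l0] lfac l ..
  also have "\<dots> = T.chi (T.bas ?a \<otimes>\<^bsub>T.RG\<^esub> \<pi> (single1 k \<bullet> (c \<bullet> single1 ?l0)))"
    using a(1) by (intro T.chi_comm keys_\<pi> keys_single_subset)
  also have "\<dots> = T.chi (\<pi> (single1 ?k' \<bullet> (c \<bullet> single1 ?l0)))"
    unfolding k sandwich_left[OF a(1) kl(1)[unfolded k] l0] ..
  finally have ne': "T.chi (\<pi> (single1 ?k' \<bullet> (c \<bullet> single1 ?l0))) \<noteq> 0" using ne by simp
  \<comment> \<open>so that \<open>\<gamma> \<tau>\<close> is the isomorphism on the left after the automorphism has been absorbed\<close>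
  define \<tau> where "\<tau> = ?\<gamma>i \<circ> (?a \<circ> \<sigma>)"
  have sa\<sigma>: "section_iso G P K H P' K' (?a \<circ> \<sigma>)" by (rule section_iso_comp[OF sa(1) \<sigma>])
  have Ma\<sigma>: "goursat G P K (?a \<circ> \<sigma>) H P' K' \<in> Mor \<C> G H"
    unfolding goursat_comp[OF sa(1) \<sigma>, symmetric] by (rule Mor_comp[OF G G H sa(2) M(1)])
  have s\<tau>: "section_iso H P'' K'' H P' K' \<tau>" unfolding \<tau>_def by (rule section_iso_comp[OF \<gamma>(3) sa\<sigma>])
  then interpret \<tau>: section_iso H P'' K'' H P' K' \<tau> .
  have M\<tau>: "goursat H P'' K'' \<tau> H P' K' \<in> Mor \<C> H H"
    unfolding \<tau>_def goursat_comp[OF \<gamma>(3) sa\<sigma>, symmetric] by (rule Mor_comp[OF H G H \<gamma>(4) Ma\<sigma>])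
  let ?\<sigma> = "?\<gamma> \<circ> \<tau>"
  have \<sigma>': "section_iso G P K H P' K' ?\<sigma>" by (rule section_iso_comp[OF \<gamma>(1) s\<tau>])
  have "goursat G P K ?\<sigma> H P' K' = goursat G P K (?a \<circ> \<sigma>) H P' K'"
  proof (rule goursat_cong[OF \<sigma>.s2.group_section_axioms])
    fix X assume X: "X \<in> carrier (subquot H P' K')"
    have "(?a \<circ> \<sigma>) X \<in> carrier Q" using bij_betwE[OF section_iso.bij[OF sa\<sigma>]] X by blast
    then show "?\<sigma> X = (?a \<circ> \<sigma>) X" unfolding \<tau>_def using \<gamma>_\<gamma>i(1)[OF H s'' QQ] by simp
  qed
  then have k'_eq: "?k' = (G, goursat G P K ?\<sigma> H P' K', H)" using goursat_comp[OF sa(1) \<sigma>] by simp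
  have \<sigma>'M: "goursat G P K ?\<sigma> H P' K' \<in> Mor \<C> G H"
    unfolding goursat_comp[OF \<gamma>(1) s\<tau>, symmetric] by (rule Mor_comp[OF G H H \<gamma>(2) M\<tau>])
  have "(\<Sum>h \<in> {h \<in> carrier H. linked H P' K' (conj_set H h P'') (conj_set H h K'')}.
           of_nat (card (K' \<inter> conj_set H h K'')) *
           module_character (AutC \<C> H P'' K'') (transport_module \<C> G P K T H P'' K'')
             (twist_aut H P'' K'' \<tau> P' K' h)) \<noteq> 0"
    using ne' unfolding k'_eq chi_sandwich[OF H \<sigma>' \<sigma>'M \<gamma>(3,4)] character_transport[OF H s'' QQ] by auto
  moreover have "q_group H H (goursat H P'' K'' \<tau> H P' K') \<cong> subquot G P K"
    unfolding \<tau>.q_group_L by (rule group.iso_sym[OF s.group_Q QQ])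
  ultimately show ?R
    using H \<rho>.s1.is_sec \<sigma>.s2.is_sec \<tau>.iso M\<tau> by blast
qed

end

theorem theorem7p1:
  fixes \<G> :: "'g monoid set"
    and \<C> :: "'g group_cat"
    and G :: "'g monoid"
    and P K :: "'g set"
    and T :: "(('g set \<Rightarrow> 'g set) \<Rightarrow>\<^sub>0 'r::field_char_0, 't) module"
  assumes "represents_finite_groups \<G>"
    and "subcategory \<C> (subgroup_cat \<G>)"
    and "finite_cat \<C>"
    and "condition_star \<C>"
    and "conj_closed \<C>"
    and "G \<in> Obj \<C>"
    and "is_section G P K"
    and "e_sec G P K \<in> Mor \<C> G G"
    and "simple_module (group_algebra (AutC \<C> G P K)) T"
  shows
    "(\<lambda>s. e_cat \<C> \<odot>\<^bsub>simple_S \<C> G P K T\<^esub> s) ` carrier (simple_S \<C> G P K T)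
       \<noteq> {\<zero>\<^bsub>simple_S \<C> G P K T\<^esub>}
     \<longleftrightarrow>
     (\<exists>H \<in> Obj \<C>. \<exists>P'' K'' \<tau> P' K'.
        is_section H P'' K'' \<and> is_section H P' K' \<and>
        \<tau> \<in> iso (subquot H P' K') (subquot H P'' K'') \<and>
        goursat H P'' K'' \<tau> H P' K' \<in> Mor \<C> H H \<and>
        q_group H H (goursat H P'' K'' \<tau> H P' K') \<cong> subquot G P K \<and>
        (\<Sum>h \<in> {h \<in> carrier H. linked H P' K' (conj_set H h P'') (conj_set H h K'')}.
           of_nat (card (K' \<inter> conj_set H h K'')) *
           module_character (AutC \<C> H P'' K'') (transport_module \<C> G P K T H P'' K'')
             (twist_aut H P'' K'' \<tau> P' K' h))
          \<noteq> (0 :: 'r))"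
proof -
  interpret twisted_rep \<G> \<C> G P K T
    by unfold_locales (rule assms)+
  show ?thesis
    unfolding head_nonzero_iff_sandwiches sandwiches_chi_iff by (rule sandwich_chi_iff_character_sum)
qed

end
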